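(* Let $\delta\ge 0$, $M\ge 0$, and let $(X,d)$ be an $M$-roughly starlike $\delta$-Gromov hyperbolic space. Fix a base point $p\in X$ and $\epsilon>0$, and let $X^{\epsilon}=(X,d_\epsilon)$ be the uniformized space. Then the following are equivalent: (1) the Gehring-Hayman property for metric boundary points holds for $X^\epsilon$; (2) the canonical boundary map $\Phi:\partial_G X\to\partial_{d_\epsilon}X^\epsilon$ is bijective and the Gehring-Hayman property for Gromov sequences holds for $X^\epsilon$; (3) the Gehring-Hayman theorem holds for $X^\epsilon$; (4) $X^\epsilon$ is a uniform space (i.e. $A$-uniform for some $A>0$).
   Context: For $x,y,p$ in a metric space $(X,d)$, the Gromov product is $(x|y)_p=\frac12(d(p,x)+d(p,y)-d(x,y))$. $(X,d)$ is $\delta$-Gromov hyperbolic if it is unbounded, proper, geodesic, and $(x|z)_p\ge \min\{(x|y)_p,(y|z)_p\}-\delta$ for all $x,y,z,p\in X$. $(X,d)$ is $M$-roughly starlike if there is a point $o\in X$ such that for every $x\in X$ there is a geodesic ray $\gamma:[0,\infty)\to X$ with $\gamma(0)=o$ and $\mathrm{dist}_d(x,\gamma)\le M$. Uniformization: for $\epsilon>0$ and base point $p$, set $\rho_\epsilon(z)=e^{-\epsilon d(p,z)}$ and $d_\epsilon(x,y)=\inf_\gamma\int_\gamma\rho_\epsilon\,ds$, infimum over all $d$-rectifiable curves from $x$ to $y$ (integral with respect to $d$-arclength). $X^\epsilon=(X,d_\epsilon)$; $l_{d_\epsilon}(\gamma)$ denotes the length of a curve with respect to $d_\epsilon$. The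 metric boundary is $\partial_{d_\epsilon}X^\epsilon=\overline{X^\epsilon}\setminus X^\epsilon$, closure in the completion. $[x,y]$ denotes a $d$-geodesic from $x$ to $y$. Gromov boundary $\partial_G X$: the set of geodesic rays $\gamma$ with $\gamma(0)=p$ modulo the equivalence $\gamma\sim\tilde\gamma$ iff $\sup_{t\ge0}d(\gamma(t),\tilde\gamma(t))<\infty$. The canonical boundary map $\Phi:\partial_GX\to\partial_{d_\epsilon}X^\epsilon$ sends $[\gamma]$ to the $d_\epsilon$-limit of $\gamma(k)$ as $k\to\infty$ (this limit exists and is independent of the representative). A Gromov sequence is $(x_n)\subseteq X$ with $(x_n|x_m)_p\to\infty$ as $n,m\to\infty$; two Gromov sequences $(x_n),(y_n)$ are equivalent if $(x_n|y_n)_p\to\infty$. The Gehring-Hayman theorem holds for $X^\epsilon$ if there is $A>0$ with $l_{d_\epsilon}([x,y])\le A\,d_\epsilon(x,y)$ for all $x,y\in X$ and every $d$-geodesic $[x,y]$. The Gehring-Hayman property for Gromov sequences holds if for each Gromov sequence $(x_n)$ there is $C\ge1$ (possibly depending on the sequence) with $l_{d_\epsilon}([x_n,x_m])\le C d_\epsilon(x_n,x_m)$ for all $n,m$. The Gehring-Hayman property for metric boundary points holds if for every $x\in\partial_{d_\epsilon}X^\epsilon$ and every sequence $(x_n)\subseteq X$ with $d_\epsilon(x_n,x)\to0$ there is $C\ge1$ with $l_{d_\epsilon}([x_n,x_m])\le Cd_\epsilon(x_n,x_m)$ for all $n,m$. For a metric space $(Y,\varrho)$ with metric boundary $\partial_\varrho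 Y=\overline Y\setminus Y$, a curve $\gamma:[a,b]\to Y$ is $A$-uniform if $l_\varrho(\gamma)\le A\varrho(\gamma(a),\gamma(b))$ and $\min\{l_\varrho(\gamma|_{[a,t]}),l_\varrho(\gamma|_{[t,b]})\}\le A\,\mathrm{dist}_\varrho(\gamma(t),\partial_\varrho Y)$ for all $t\in[a,b]$. A noncomplete locally compact metric space is $A$-uniform if every pair of points is joined by an $A$-uniform curve. *)

theory Defs
  imports "HOL-Analysis.Analysis"
begin

text \<open>The space X is the whole type 'a with d = dist.\<close>

definition gromov_product :: "'a::metric_space \<Rightarrow> 'a \<Rightarrow> 'a \<Rightarrow> real" where
  "gromov_product p x y = (dist p x + dist p y - dist x y) / 2"

definition geodesic_seg :: "(real \<Rightarrow> 'a::metric_space) \<Rightarrow> 'a \<Rightarrow> 'a \<Rightarrow> bool" where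
  "geodesic_seg \<gamma> x y \<longleftrightarrow> \<gamma> 0 = x \<and> \<gamma> (dist x y) = y \<and>
     (\<forall>s\<in>{0..dist x y}. \<forall>t\<in>{0..dist x y}. dist (\<gamma> s) (\<gamma> t) = \<bar>s - t\<bar>)"

definition geodesic_ray :: "(real \<Rightarrow> 'a::metric_space) \<Rightarrow> 'a \<Rightarrow> bool" where
  "geodesic_ray \<gamma> o' \<longleftrightarrow> \<gamma> 0 = o' \<and> (\<forall>s\<ge>0. \<forall>t\<ge>0. dist (\<gamma> s) (\<gamma> t) = \<bar>s - t\<bar>)"

definition gromov_hyperbolic :: "real \<Rightarrow> 'a::metric_space itself \<Rightarrow> bool" where
  "gromov_hyperbolic \<delta> _ \<longleftrightarrow>
     \<not> bounded (UNIV :: 'a set) \<and>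
     (\<forall>x::'a. \<forall>r. compact (cball x r)) \<and>
     (\<forall>x y::'a. \<exists>\<gamma>. geodesic_seg \<gamma> x y) \<and>
     (\<forall>x y z p::'a. gromov_product p x z \<ge> min (gromov_product p x y) (gromov_product p y z) - \<delta>)"

definition roughly_starlike :: "real \<Rightarrow> 'a::metric_space itself \<Rightarrow> bool" where
  "roughly_starlike M _ \<longleftrightarrow>
     (\<exists>o'::'a. \<forall>x::'a. \<exists>\<gamma>. geodesic_ray \<gamma> o' \<and> infdist x (\<gamma> ` {0..}) \<le> M)"

definition partitions :: "real \<Rightarrow> real \<Rightarrow> (nat \<times> (nat \<Rightarrow> real)) set" where
  "partitions a b = {(n, t). t 0 = a \<and> t n = b \<and> (\<forall>i<n. t i \<le> t (Suc i))}"

definition curve_length :: "('a \<Rightarrow> 'a \<Rightarrow> real) \<Rightarrow> (real \<Rightarrow> 'a) \<Rightarrow> real \<Rightarrow> real \<Rightarrow> ereal" where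
  "curve_length rd \<gamma> a b =
     (SUP (n, t) \<in> partitions a b. ereal (\<Sum>i<n. rd (\<gamma> (t i)) (\<gamma> (t (Suc i)))))"

definition rectifiable :: "(real \<Rightarrow> 'a::metric_space) \<Rightarrow> real \<Rightarrow> real \<Rightarrow> bool" where
  "rectifiable \<gamma> a b \<longleftrightarrow> a \<le> b \<and> continuous_on {a..b} \<gamma> \<and> curve_length dist \<gamma> a b < \<infinity>"

definition arclength_fun :: "(real \<Rightarrow> 'a::metric_space) \<Rightarrow> real \<Rightarrow> real \<Rightarrow> real \<Rightarrow> real" where
  "arclength_fun \<gamma> a b t = real_of_ereal (curve_length dist \<gamma> a (max a (min b t)))"

text \<open>Line integral of rho along gamma with respect to d-arclength, as the
  Lebesgue-Stieltjes integral with respect to the arclength function.\<close>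
definition line_integral :: "('a::metric_space \<Rightarrow> real) \<Rightarrow> (real \<Rightarrow> 'a) \<Rightarrow> real \<Rightarrow> real \<Rightarrow> real" where
  "line_integral \<rho> \<gamma> a b =
     enn2real (\<integral>\<^sup>+ t. ennreal (\<rho> (\<gamma> t)) * indicator {a..b} t \<partial>(interval_measure (arclength_fun \<gamma> a b)))"

definition rho_eps :: "real \<Rightarrow> 'a::metric_space \<Rightarrow> 'a \<Rightarrow> real" where
  "rho_eps \<epsilon> p z = exp (- \<epsilon> * dist p z)"

definition d_eps :: "real \<Rightarrow> 'a::metric_space \<Rightarrow> 'a \<Rightarrow> 'a \<Rightarrow> real" where
  "d_eps \<epsilon> p x y = Inf {line_integral (rho_eps \<epsilon> p) \<gamma> a b | \<gamma> a b.
       rectifiable \<gamma> a b \<and> \<gamma> a = x \<and> \<gamma> b = y}"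

text \<open>Metric boundary of X^eps: points of the completion not in X, i.e. classes of
  d_eps-Cauchy sequences which do not converge in X, modulo d_eps(s_n,t_n) -> 0.\<close>
definition eps_Cauchy :: "real \<Rightarrow> 'a::metric_space \<Rightarrow> (nat \<Rightarrow> 'a) \<Rightarrow> bool" where
  "eps_Cauchy \<epsilon> p s \<longleftrightarrow> (\<forall>e>0. \<exists>N. \<forall>m\<ge>N. \<forall>n\<ge>N. d_eps \<epsilon> p (s m) (s n) < e)"

definition eps_convergent :: "real \<Rightarrow> 'a::metric_space \<Rightarrow> (nat \<Rightarrow> 'a) \<Rightarrow> bool" where
  "eps_convergent \<epsilon> p s \<longleftrightarrow> (\<exists>x. (\<lambda>n. d_eps \<epsilon> p (s n) x) \<longlonglongrightarrow> 0)"

definition boundary_seq :: "real \<Rightarrow> 'a::metric_space \<Rightarrow> (nat \<Rightarrow> 'a) \<Rightarrow> bool" where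
  "boundary_seq \<epsilon> p s \<longleftrightarrow> eps_Cauchy \<epsilon> p s \<and> \<not> eps_convergent \<epsilon> p s"

definition metric_boundary :: "real \<Rightarrow> 'a::metric_space \<Rightarrow> (nat \<Rightarrow> 'a) set set" where
  "metric_boundary \<epsilon> p =
     {{t. boundary_seq \<epsilon> p t \<and> (\<lambda>n. d_eps \<epsilon> p (s n) (t n)) \<longlonglongrightarrow> 0} | s. boundary_seq \<epsilon> p s}"

text \<open>Completion distance between a point z of X and a boundary point xi.\<close>
definition bdist :: "real \<Rightarrow> 'a::metric_space \<Rightarrow> 'a \<Rightarrow> (nat \<Rightarrow> 'a) set \<Rightarrow> real" where
  "bdist \<epsilon> p z \<xi> = lim (\<lambda>k. d_eps \<epsilon> p z ((SOME s. s \<in> \<xi>) k))"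

definition dist_to_boundary :: "real \<Rightarrow> 'a::metric_space \<Rightarrow> 'a \<Rightarrow> real" where
  "dist_to_boundary \<epsilon> p z = Inf (bdist \<epsilon> p z ` metric_boundary \<epsilon> p)"

definition gromov_boundary :: "'a::metric_space \<Rightarrow> (real \<Rightarrow> 'a) set set" where
  "gromov_boundary p =
     {{\<eta>. geodesic_ray \<eta> p \<and> (\<exists>K. \<forall>t\<ge>0. dist (\<gamma> t) (\<eta> t) \<le> K)} | \<gamma>. geodesic_ray \<gamma> p}"

definition Phi :: "real \<Rightarrow> 'a::metric_space \<Rightarrow> (real \<Rightarrow> 'a) set \<Rightarrow> (nat \<Rightarrow> 'a) set" where
  "Phi \<epsilon> p C = (THE \<xi>. \<xi> \<in> metric_boundary \<epsilon> p \<and>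
       (\<forall>\<gamma>\<in>C. (\<lambda>k. bdist \<epsilon> p (\<gamma> (real k)) \<xi>) \<longlonglongrightarrow> 0))"

definition gromov_sequence :: "'a::metric_space \<Rightarrow> (nat \<Rightarrow> 'a) \<Rightarrow> bool" where
  "gromov_sequence p x \<longleftrightarrow> (\<forall>K. \<exists>N. \<forall>n\<ge>N. \<forall>m\<ge>N. gromov_product p (x n) (x m) \<ge> K)"

definition GH_theorem :: "real \<Rightarrow> 'a::metric_space \<Rightarrow> bool" where
  "GH_theorem \<epsilon> p \<longleftrightarrow> (\<exists>A>0. \<forall>x y \<gamma>. geodesic_seg \<gamma> x y \<longrightarrow>
      curve_length (d_eps \<epsilon> p) \<gamma> 0 (dist x y) \<le> ereal (A * d_eps \<epsilon> p x y))"

definition GH_gromov_seq :: "real \<Rightarrow> 'a::metric_space \<Rightarrow> bool" where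
  "GH_gromov_seq \<epsilon> p \<longleftrightarrow> (\<forall>x. gromov_sequence p x \<longrightarrow>
      (\<exists>C\<ge>1. \<forall>n m \<gamma>. geodesic_seg \<gamma> (x n) (x m) \<longrightarrow>
         curve_length (d_eps \<epsilon> p) \<gamma> 0 (dist (x n) (x m)) \<le> ereal (C * d_eps \<epsilon> p (x n) (x m))))"

definition GH_boundary :: "real \<Rightarrow> 'a::metric_space \<Rightarrow> bool" where
  "GH_boundary \<epsilon> p \<longleftrightarrow> (\<forall>\<xi>\<in>metric_boundary \<epsilon> p. \<forall>x. (\<lambda>n. bdist \<epsilon> p (x n) \<xi>) \<longlonglongrightarrow> 0 \<longrightarrow>
      (\<exists>C\<ge>1. \<forall>n m \<gamma>. geodesic_seg \<gamma> (x n) (x m) \<longrightarrow>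
         curve_length (d_eps \<epsilon> p) \<gamma> 0 (dist (x n) (x m)) \<le> ereal (C * d_eps \<epsilon> p (x n) (x m))))"

definition uniform_curve :: "real \<Rightarrow> 'a::metric_space \<Rightarrow> real \<Rightarrow> (real \<Rightarrow> 'a) \<Rightarrow> real \<Rightarrow> real \<Rightarrow> bool" where
  "uniform_curve \<epsilon> p A \<gamma> a b \<longleftrightarrow> a \<le> b \<and>
     continuous_map (subtopology euclideanreal {a..b}) (Metric_space.mtopology UNIV (d_eps \<epsilon> p)) \<gamma> \<and>
     curve_length (d_eps \<epsilon> p) \<gamma> a b \<le> ereal (A * d_eps \<epsilon> p (\<gamma> a) (\<gamma> b)) \<and>
     (\<forall>t\<in>{a..b}. min (curve_length (d_eps \<epsilon> p) \<gamma> a t) (curve_length (d_eps \<epsilon> p) \<gamma> t b)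
                    \<le> ereal (A * dist_to_boundary \<epsilon> p (\<gamma> t)))"

definition uniform_space :: "real \<Rightarrow> 'a::metric_space \<Rightarrow> bool" where
  "uniform_space \<epsilon> p \<longleftrightarrow>
     \<not> Metric_space.mcomplete UNIV (d_eps \<epsilon> p) \<and>
     locally_compact_space (Metric_space.mtopology UNIV (d_eps \<epsilon> p)) \<and>
     (\<exists>A>0. \<forall>x y. \<exists>\<gamma> a b. \<gamma> a = x \<and> \<gamma> b = y \<and> uniform_curve \<epsilon> p A \<gamma> a b)"

end

theory Submission
  imports Defs
begin

text \<open>
  Write \<open>|x| = d(p, x)\<close>. The triangle inequality alone gives \<open>|\<gamma>(t)| \<ge> (x|y) + |t - t\<^sub>0|\<close> along a geodesic from
  \<open>x\<close> to \<open>y\<close>, with \<open>t\<^sub>0 = |x| - (x|y)\<close>, and hyperbolicity makes this sharp up to \<open>2\<delta>\<close>. Hence the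
  \<open>d\<^sub>\<epsilon>\<close>-length of \<open>[x, y]\<close> is comparable to \<open>exp(-\<epsilon>(x|y)) min(1, d(x,y))\<close>, and every
  Gehring-Hayman condition becomes the lower bound \<open>d\<^sub>\<epsilon>(x,y) \<ge> c exp(-\<epsilon>(x|y)) min(1, d(x,y))\<close>, called
  \<open>separated c x y\<close> below; it is automatic at bounded distance.

  If this bound fails for every \<open>c\<close>, the offending pairs escape to infinity and, by properness, converge
  along a subsequence to one boundary point; interleaving them contradicts (1). The boundary map is always
  surjective, and when it is injective every sequence converging to a boundary point is a Gromov sequence,
  which gives (2) \<open>\<Longrightarrow>\<close> (1).

  Under the bound, geodesics are uniform curves because \<open>dist(z, \<partial>X) \<ge> c exp(-\<epsilon>|z|)\<close>. Conversely rough
  starlikeness gives \<open>dist(z, \<partial>X) \<le> C exp(-\<epsilon>|z|)\<close>, so that a uniform curve of length \<open>L\<close> passes from its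
  midpoint to each endpoint through points whose remaining length decreases geometrically, at bounded
  \<open>d\<close>-steps. Choosing the ratio so large that each step gains more than \<open>\<delta>\<close> in the Gromov product, the
  hyperbolicity inequality telescopes to \<open>(x|y) \<ge> log(1/L)/\<epsilon> - C\<close>.
\<close>

subsection \<open>Length of curves\<close>

text \<open>Since \<epsilon> is arbitrary, the length of an arbitrary curve can be bounded below
  only locally. \<open>E_lower\<close> is the sole unconditional source of lower bounds for
  \<open>d_eps\<close>: leaving the unit ball around \<open>z\<close> costs at least a fixed
  multiple of \<open>rho_eps \<epsilon> p z\<close>. Applied at different points, it yields
  positivity of the metric, the unchanged topology, the distance to the boundary and the unit steps
  of the final chain. The integral in \<open>d_eps\<close> is a Stieltjes integral against
  arclength. Only its mean value inequalities are used, through a primitive whose increments they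
  determine, so reversal and concatenation of curves need no transformation of measures. Local
  estimates are glued by bisection (\<open>Bolzano\<close>), being stable under juxtaposition of
  intervals. Lengths with respect to both d and \<open>d_eps\<close> occur, hence the theory of
  length for any function that is a metric on the whole type.\<close>

locale total_metric = Metric_space UNIV rd for rd :: "'a \<Rightarrow> 'a \<Rightarrow> real"
begin

abbreviation cl :: "(real \<Rightarrow> 'a) \<Rightarrow> real \<Rightarrow> real \<Rightarrow> ereal" where
  "cl \<equiv> curve_length rd"

abbreviation len :: "(real \<Rightarrow> 'a) \<Rightarrow> real \<Rightarrow> real \<Rightarrow> real" where
  "len \<gamma> a b \<equiv> real_of_ereal (curve_length rd \<gamma> a b)"

lemma rd_triangle: "rd x z \<le> rd x y + rd y z"
  by (rule triangle) auto

lemma cl_upper: "(n, t) \<in> partitions a b \<Longrightarrow> ereal (\<Sum>i<n. rd (\<gamma> (t i)) (\<gamma> (t (Suc i)))) \<le> cl \<gamma> a b"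
  unfolding curve_length_def by (rule SUP_upper2[where i="(n,t)"]) auto

lemma cl_least:
  "(\<And>n t. (n, t) \<in> partitions a b \<Longrightarrow> ereal (\<Sum>i<n. rd (\<gamma> (t i)) (\<gamma> (t (Suc i)))) \<le> B) \<Longrightarrow> cl \<gamma> a b \<le> B"
  unfolding curve_length_def by (rule SUP_least) auto

lemma partitions_bounds:
  assumes "(n, t) \<in> partitions a b" "i \<le> n"
  shows "a \<le> t i" "t i \<le> b"
proof -
  have mono: "t i \<le> t j" if "i \<le> j" "j \<le> n" for i j
    using that
  proof (induction j rule: dec_induct)
    case (step j)
    then show ?case using assms(1) unfolding partitions_def by (auto intro: order_trans)
  qed auto
  show "a \<le> t i" "t i \<le> b"
    using mono[of 0 i] mono[of i n] assms by (auto simp: partitions_def)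
qed

text \<open>Most upper bounds for lengths come from this: a function \<open>\<Phi>\<close> whose
  increments dominate \<open>rd\<close> along the curve dominates every partition sum, because the
  increments telescope. Finding \<open>\<Phi>\<close> replaces the handling of partitions.\<close>

lemma cl_telescope:
  assumes "\<And>s t. a \<le> s \<Longrightarrow> s \<le> t \<Longrightarrow> t \<le> b \<Longrightarrow> rd (\<gamma> s) (\<gamma> t) \<le> \<Phi> t - \<Phi> s"
  shows "cl \<gamma> a b \<le> ereal (\<Phi> b - \<Phi> a)"
proof (rule cl_least)
  fix n t assume nt: "(n, t) \<in> partitions a b"
  have "(\<Sum>i<n. rd (\<gamma> (t i)) (\<gamma> (t (Suc i)))) \<le> (\<Sum>i<n. \<Phi> (t (Suc i)) - \<Phi> (t i))"
  proof (rule sum_mono)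
    fix i assume "i \<in> {..<n}"
    then show "rd (\<gamma> (t i)) (\<gamma> (t (Suc i))) \<le> \<Phi> (t (Suc i)) - \<Phi> (t i)"
      using partitions_bounds[OF nt, of i] partitions_bounds[OF nt, of "Suc i"] nt
      by (intro assms) (auto simp: partitions_def)
  qed
  also have "\<dots> = \<Phi> b - \<Phi> a"
    using nt by (subst sum_lessThan_telescope) (auto simp: partitions_def)
  finally show "ereal (\<Sum>i<n. rd (\<gamma> (t i)) (\<gamma> (t (Suc i)))) \<le> ereal (\<Phi> b - \<Phi> a)" by simp
qed

lemma cl_ge_dist:
  assumes "a \<le> b" shows "ereal (rd (\<gamma> a) (\<gamma> b)) \<le> cl \<gamma> a b"
  using cl_upper[of 1 "\<lambda>i. if i = 0 then a else b" a b \<gamma>] assms by (auto simp: partitions_def)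

lemma cl_nonneg: "a \<le> b \<Longrightarrow> 0 \<le> cl \<gamma> a b"
  using cl_ge_dist[of a b \<gamma>] by (meson ereal_less_eq(5) nonneg order_trans)

lemma cl_refl [simp]: "cl \<gamma> a a = 0"
proof (rule antisym)
  show "cl \<gamma> a a \<le> 0"
  proof -
    have "rd (\<gamma> s) (\<gamma> t) \<le> 0 - 0" if "a \<le> s" "s \<le> t" "t \<le> a" for s t
    proof -
      have "s = t" using that by linarith
      then show ?thesis by simp
    qed
    from cl_telescope[OF this] show ?thesis by (simp add: zero_ereal_def)
  qed
qed (simp add: cl_nonneg)

text \<open>A partition of \<open>[a, s]\<close> becomes one of \<open>[a, t]\<close> by appending
  the point \<open>t\<close>. Additivity is built on this one-point extension, so partitions are
  never concatenated.\<close>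

lemma cl_step:
  assumes "a \<le> s" "s \<le> t"
  shows "cl \<gamma> a s + ereal (rd (\<gamma> s) (\<gamma> t)) \<le> cl \<gamma> a t"
proof -
  have "cl \<gamma> a s \<le> cl \<gamma> a t - ereal (rd (\<gamma> s) (\<gamma> t))"
  proof (rule cl_least)
    fix n p assume np: "(n, p) \<in> partitions a s"
    have *: "(Suc n, p(Suc n := t)) \<in> partitions a t"
      using np assms by (auto simp: partitions_def less_Suc_eq)
    have "(\<Sum>i<n. rd (\<gamma> ((p(Suc n := t)) i)) (\<gamma> ((p(Suc n := t)) (Suc i)))) = (\<Sum>i<n. rd (\<gamma> (p i)) (\<gamma> (p (Suc i))))"
      by (rule sum.cong) auto
    then show "ereal (\<Sum>i<n. rd (\<gamma> (p i)) (\<gamma> (p (Suc i)))) \<le> cl \<gamma> a t - ereal (rd (\<gamma> s) (\<gamma> t))"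
      using cl_upper[OF *, of \<gamma>] np by (simp add: ereal_le_minus partitions_def)
  qed
  then show ?thesis by (simp add: ereal_le_minus)
qed

lemma cl_superadd:
  assumes "a \<le> b" "b \<le> c"
  shows "cl \<gamma> a b + cl \<gamma> b c \<le> cl \<gamma> a c"
proof (cases "cl \<gamma> a b = \<infinity>")
  case True
  then show ?thesis using cl_step[OF assms, of \<gamma>] by (auto simp: ereal_infty_less_eq)
next
  case False
  then have fin: "\<bar>cl \<gamma> a b\<bar> \<noteq> \<infinity>" using cl_nonneg[OF assms(1), of \<gamma>] by auto
  have "cl \<gamma> b c \<le> cl \<gamma> a c - cl \<gamma> a b"
  proof (rule cl_least)
    fix n t assume nt: "(n, t) \<in> partitions b c"
    \<comment> \<open>The points of the partition of \<open>[b, c]\<close> are appended one at a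
      time to the curve up to \<open>b\<close>.\<close>
    have "k \<le> n \<Longrightarrow> ereal (\<Sum>i<k. rd (\<gamma> (t i)) (\<gamma> (t (Suc i)))) + cl \<gamma> a b \<le> cl \<gamma> a (t k)" for k
    proof (induction k)
      case 0
      then show ?case using nt by (simp add: partitions_def)
    next
      case (Suc k)
      have "a \<le> t k" "t k \<le> t (Suc k)"
        using partitions_bounds[OF nt, of k] Suc.prems assms nt by (auto simp: partitions_def)
      let ?r = "rd (\<gamma> (t k)) (\<gamma> (t (Suc k)))"
      have "ereal (\<Sum>i<Suc k. rd (\<gamma> (t i)) (\<gamma> (t (Suc i)))) + cl \<gamma> a b
          = (ereal (\<Sum>i<k. rd (\<gamma> (t i)) (\<gamma> (t (Suc i)))) + cl \<gamma> a b) + ereal ?r"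
        by (simp add: ac_simps flip: plus_ereal.simps(1))
      also have "\<dots> \<le> cl \<gamma> a (t k) + ereal ?r"
        using Suc by (intro add_right_mono) auto
      also have "\<dots> \<le> cl \<gamma> a (t (Suc k))"
        by (rule cl_step) fact+
      finally show ?case .
    qed
    from this[of n] show "ereal (\<Sum>i<n. rd (\<gamma> (t i)) (\<gamma> (t (Suc i)))) \<le> cl \<gamma> a c - cl \<gamma> a b"
      using nt fin by (simp add: ereal_le_minus partitions_def)
  qed
  then show ?thesis using fin by (simp add: ereal_le_minus add.commute)
qed

lemma cl_sub_le:
  assumes "a \<le> s" "s \<le> t" "t \<le> b"
  shows "cl \<gamma> s t \<le> cl \<gamma> a b"
proof -
  have "cl \<gamma> s t \<le> cl \<gamma> a s + cl \<gamma> s t" using cl_nonneg[of a s \<gamma>] assms by (simp add: add_increasing)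
  also have "\<dots> \<le> cl \<gamma> a t" using assms by (intro cl_superadd) auto
  also have "\<dots> \<le> cl \<gamma> a t + cl \<gamma> t b" using cl_nonneg[of t b \<gamma>] assms by (simp add: add_increasing2)
  also have "\<dots> \<le> cl \<gamma> a b" using assms by (intro cl_superadd) auto
  finally show ?thesis .
qed

lemma cl_eq_len:
  assumes "cl \<gamma> a b < \<infinity>" "a \<le> s" "s \<le> t" "t \<le> b"
  shows "cl \<gamma> s t = ereal (len \<gamma> s t)"
  using cl_sub_le[OF assms(2-4), of \<gamma>] cl_nonneg[OF assms(3), of \<gamma>] assms(1)
  by (cases "cl \<gamma> s t") auto

lemma len_nonneg: "s \<le> t \<Longrightarrow> 0 \<le> len \<gamma> s t"
  by (simp add: cl_nonneg real_of_ereal_pos)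

lemma len_ge_dist:
  assumes "cl \<gamma> a b < \<infinity>" "a \<le> s" "s \<le> t" "t \<le> b"
  shows "rd (\<gamma> s) (\<gamma> t) \<le> len \<gamma> s t"
  using cl_ge_dist[OF assms(3), of \<gamma>] cl_eq_len[OF assms] by (metis ereal_less_eq(3))

lemma len_step:
  assumes "cl \<gamma> a b < \<infinity>" "a \<le> s" "s \<le> t" "t \<le> b"
  shows "len \<gamma> a s + rd (\<gamma> s) (\<gamma> t) \<le> len \<gamma> a t"
  using cl_step[OF assms(2,3), of \<gamma>] cl_eq_len[OF assms(1), of a s] cl_eq_len[OF assms(1), of a t] assms
  by (metis ereal_less_eq(3) order_refl order_trans plus_ereal.simps(1))

text \<open>For the upper bound, the length from \<open>a\<close>, continued past \<open>b\<close>
  by the length from \<open>b\<close>, serves as \<open>\<Phi>\<close> in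
  \<open>cl_telescope\<close>. An interval straddling \<open>b\<close> is split by the triangle
  inequality through \<open>\<gamma> b\<close>.\<close>

lemma cl_add:
  assumes "a \<le> b" "b \<le> c"
  shows "cl \<gamma> a c = cl \<gamma> a b + cl \<gamma> b c"
proof (rule antisym[OF _ cl_superadd[OF assms]])
  show "cl \<gamma> a c \<le> cl \<gamma> a b + cl \<gamma> b c"
  proof (cases "cl \<gamma> a b = \<infinity> \<or> cl \<gamma> b c = \<infinity>")
    case True
    then show ?thesis using cl_nonneg[OF assms(1), of \<gamma>] cl_nonneg[OF assms(2), of \<gamma>] by auto
  next
    case False
    then have fin: "cl \<gamma> a b < \<infinity>" "cl \<gamma> b c < \<infinity>" by auto
    define \<Phi> where "\<Phi> t = (if t \<le> b then len \<gamma> a t else len \<gamma> a b + len \<gamma> b t)" for t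
    have "cl \<gamma> a c \<le> ereal (\<Phi> c - \<Phi> a)"
    proof (rule cl_telescope)
      fix s t assume st: "a \<le> s" "s \<le> t" "t \<le> c"
      consider "t \<le> b" | "s \<le> b" "b < t" | "b < s" by linarith
      then show "rd (\<gamma> s) (\<gamma> t) \<le> \<Phi> t - \<Phi> s"
      proof cases
        case 1
        then show ?thesis using len_step[OF fin(1) st(1,2)] st by (simp add: \<Phi>_def)
      next
        case 2
        have "rd (\<gamma> s) (\<gamma> t) \<le> rd (\<gamma> s) (\<gamma> b) + rd (\<gamma> b) (\<gamma> t)" by (rule rd_triangle)
        also have "\<dots> \<le> (len \<gamma> a b - len \<gamma> a s) + len \<gamma> b t"
          using len_step[OF fin(1) st(1) 2(1)] len_ge_dist[OF fin(2), of b t] 2 st by simp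
        finally show ?thesis using 2 by (simp add: \<Phi>_def)
      next
        case 3
        then show ?thesis using len_step[OF fin(2), of s t] st by (simp add: \<Phi>_def)
      qed
    qed
    also have "\<Phi> c - \<Phi> a = len \<gamma> a b + len \<gamma> b c"
      using assms by (auto simp: \<Phi>_def)
    also have "ereal \<dots> = cl \<gamma> a b + cl \<gamma> b c"
      using cl_eq_len[OF fin(1), of a b] cl_eq_len[OF fin(2), of b c] assms by (metis order_refl plus_ereal.simps(1))
    finally show ?thesis .
  qed
qed

lemma len_add:
  assumes "cl \<gamma> a b < \<infinity>" "a \<le> r" "r \<le> s" "s \<le> t" "t \<le> b"
  shows "len \<gamma> r t = len \<gamma> r s + len \<gamma> s t"
proof -
  have "cl \<gamma> r s = ereal (len \<gamma> r s)" "cl \<gamma> s t = ereal (len \<gamma> s t)"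
    using assms by (auto intro!: cl_eq_len[OF assms(1)])
  then have "cl \<gamma> r t = ereal (len \<gamma> r s + len \<gamma> s t)"
    using cl_add[OF assms(3,4), of \<gamma>] by (metis plus_ereal.simps(1))
  then show ?thesis by simp
qed

text \<open>The negated length of \<open>\<gamma>\<close> from \<open>a\<close> to
  \<open>k - t\<close> is a dominating function for the reversed curve. Equality follows by
  reversing twice.\<close>

lemma cl_reverse_le:
  assumes "a \<le> b"
  shows "cl (\<lambda>s. \<gamma> (k - s)) (k - b) (k - a) \<le> cl \<gamma> a b"
proof (cases "cl \<gamma> a b = \<infinity>")
  case False
  then have fin: "cl \<gamma> a b < \<infinity>" by simp
  have "cl (\<lambda>s. \<gamma> (k - s)) (k - b) (k - a) \<le> ereal ((- len \<gamma> a (k - (k - a))) - (- len \<gamma> a (k - (k - b))))"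
  proof (rule cl_telescope[where \<Phi>="\<lambda>t. - len \<gamma> a (k - t)"])
    fix s t assume "k - b \<le> s" "s \<le> t" "t \<le> k - a"
    then show "rd (\<gamma> (k - s)) (\<gamma> (k - t)) \<le> - len \<gamma> a (k - t) - - len \<gamma> a (k - s)"
      using len_step[OF fin, of "k - t" "k - s"] commute[of "\<gamma> (k - s)" "\<gamma> (k - t)"] by simp
  qed
  then show ?thesis using cl_eq_len[OF fin, of a b] assms by simp
qed simp

lemma cl_reverse:
  assumes "a \<le> b"
  shows "cl (\<lambda>s. \<gamma> (k - s)) (k - b) (k - a) = cl \<gamma> a b"
  using cl_reverse_le[OF assms, of \<gamma> k] cl_reverse_le[of "k - b" "k - a" "\<lambda>s. \<gamma> (k - s)" k] assms
  by (intro antisym) auto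

text \<open>Take a partition whose sum is within \<open>e/2\<close> of the whole length. For
  \<open>t\<close> in its first proper interval, the sum is at most the chord from
  \<open>\<gamma> a\<close> to \<open>\<gamma> t\<close> plus the length after \<open>t\<close>. By
  additivity the length up to \<open>t\<close> is below \<open>e/2\<close> plus that chord, which is
  small by continuity.\<close>

lemma len_right_small:
  assumes fin: "cl \<gamma> a b < \<infinity>"
    and cont: "((\<lambda>t. rd (\<gamma> a) (\<gamma> t)) \<longlongrightarrow> 0) (at a within {a..b})"
    and "e > 0"
  shows "\<exists>d>0. \<forall>t\<in>{a..b}. t - a < d \<longrightarrow> len \<gamma> a t < e"
proof (cases "a < b")
  case False
  then have "len \<gamma> a t < e" if "t \<in> {a..b}" for t
    using \<open>e > 0\<close> that by (cases "t = a") auto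
  then show ?thesis by (intro exI[of _ 1]) auto
next
  case True
  have "ereal (len \<gamma> a b - e / 2) < cl \<gamma> a b"
    by (subst cl_eq_len[OF fin, of a b]) (use True \<open>e > 0\<close> in auto)
  then obtain n p where np: "(n, p) \<in> partitions a b"
    and big: "len \<gamma> a b - e / 2 < (\<Sum>i<n. rd (\<gamma> (p i)) (\<gamma> (p (Suc i))))"
    unfolding curve_length_def by (auto simp: less_SUP_iff)
  \<comment> \<open>Partition points may repeat, so several of the first ones can equal
    \<open>a\<close>. Their chords vanish, and \<open>t1\<close> appears with the first point beyond
    \<open>a\<close>.\<close>
  have key: "k \<le> n \<Longrightarrow> if p k > a then \<exists>t1>a. \<forall>t. a \<le> t \<and> t < t1 \<longrightarrow> t \<le> p k \<and>
      (\<Sum>i<k. rd (\<gamma> (p i)) (\<gamma> (p (Suc i)))) \<le> rd (\<gamma> a) (\<gamma> t) + len \<gamma> t (p k)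
      else (\<Sum>i<k. rd (\<gamma> (p i)) (\<gamma> (p (Suc i)))) = 0" for k
  proof (induction k)
    case 0
    then show ?case using np by (auto simp: partitions_def)
  next
    case (Suc k)
    have b: "a \<le> p k" "p k \<le> p (Suc k)" "p (Suc k) \<le> b"
      using partitions_bounds[OF np, of k] partitions_bounds[OF np, of "Suc k"] Suc.prems np
      by (auto simp: partitions_def)
    show ?case
    proof (cases "p k > a")
      case True
      then obtain t1 where t1: "t1 > a" "\<And>t. a \<le> t \<Longrightarrow> t < t1 \<Longrightarrow> t \<le> p k \<and>
        (\<Sum>i<k. rd (\<gamma> (p i)) (\<gamma> (p (Suc i)))) \<le> rd (\<gamma> a) (\<gamma> t) + len \<gamma> t (p k)"
        using Suc by (auto split: if_splits)
      have "t \<le> p (Suc k) \<and> (\<Sum>i<Suc k. rd (\<gamma> (p i)) (\<gamma> (p (Suc i)))) \<le> rd (\<gamma> a) (\<gamma> t) + len \<gamma> t (p (Suc k))"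
        if "a \<le> t" "t < t1" for t
      proof -
        have "len \<gamma> t (p (Suc k)) = len \<gamma> t (p k) + len \<gamma> (p k) (p (Suc k))"
          using t1(2)[OF that] b that by (intro len_add[OF fin]) auto
        then show ?thesis using t1(2)[OF that] len_ge_dist[OF fin b] b by simp
      qed
      then show ?thesis using t1(1) True b by auto
    next
      case False
      then have pk: "p k = a" and z: "(\<Sum>i<k. rd (\<gamma> (p i)) (\<gamma> (p (Suc i)))) = 0" using Suc b by auto
      show ?thesis
      proof (cases "p (Suc k) > a")
        case True
        have "rd (\<gamma> a) (\<gamma> (p (Suc k))) \<le> rd (\<gamma> a) (\<gamma> t) + len \<gamma> t (p (Suc k))" if "a \<le> t" "t < p (Suc k)" for t
          using rd_triangle[of "\<gamma> a" "\<gamma> (p (Suc k))" "\<gamma> t"] len_ge_dist[OF fin, of t "p (Suc k)"] that b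
          by auto
        then show ?thesis using True z pk by (auto intro!: exI[of _ "p (Suc k)"])
      next
        case False
        then have "p (Suc k) = a" using pk b by simp
        then show ?thesis using z pk by simp
      qed
    qed
  qed
  have "p n = b" using np by (simp add: partitions_def)
  with key[of n] True obtain t1 where t1: "t1 > a" "\<And>t. a \<le> t \<Longrightarrow> t < t1 \<Longrightarrow> t \<le> b \<and>
        (\<Sum>i<n. rd (\<gamma> (p i)) (\<gamma> (p (Suc i)))) \<le> rd (\<gamma> a) (\<gamma> t) + len \<gamma> t b" by auto
  obtain d where d: "d > 0" "\<And>t. t \<in> {a..b} \<Longrightarrow> t \<noteq> a \<Longrightarrow> dist t a < d \<Longrightarrow> rd (\<gamma> a) (\<gamma> t) < e / 2"
    using tendstoD[OF cont, of "e/2"] \<open>e > 0\<close> by (auto simp: eventually_at)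
  have "len \<gamma> a t < e" if "t \<in> {a..b}" "t - a < min d (t1 - a)" for t
  proof (cases "t = a")
    case True
    then show ?thesis using \<open>e > 0\<close> by simp
  next
    case False
    then have "rd (\<gamma> a) (\<gamma> t) < e / 2" using d(2)[of t] that by (auto simp: dist_real_def)
    moreover have "len \<gamma> a b = len \<gamma> a t + len \<gamma> t b" using that by (intro len_add[OF fin]) auto
    moreover have "(\<Sum>i<n. rd (\<gamma> (p i)) (\<gamma> (p (Suc i)))) \<le> rd (\<gamma> a) (\<gamma> t) + len \<gamma> t b"
      using t1(2)[of t] that by auto
    ultimately show ?thesis using big by linarith
  qed
  then show ?thesis using d(1) t1(1) by (intro exI[of _ "min d (t1 - a)"]) auto
qed

text \<open>\<open>rd\<close> is a mere function on the type, so continuity with respect to it is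
  stated by real-valued limits.\<close>

definition rd_continuous :: "(real \<Rightarrow> 'a) \<Rightarrow> real \<Rightarrow> real \<Rightarrow> bool" where
  "rd_continuous \<gamma> a b \<longleftrightarrow> (\<forall>t\<in>{a..b}. ((\<lambda>s. rd (\<gamma> t) (\<gamma> s)) \<longlongrightarrow> 0) (at t within {a..b}))"

lemma rd_continuous_reverse:
  assumes "rd_continuous \<gamma> a b"
  shows "rd_continuous (\<lambda>s. \<gamma> (k - s)) (k - b) (k - a)"
  unfolding rd_continuous_def
proof
  fix t assume t: "t \<in> {k - b..k - a}"
  have "((\<lambda>s. rd (\<gamma> (k - t)) (\<gamma> s)) \<longlongrightarrow> 0) (at (k - t) within {a..b})"
    using assms t by (auto simp: rd_continuous_def)
  moreover have "filterlim (\<lambda>s. k - s) (at (k - t) within {a..b}) (at t within {k - b..k - a})"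
    unfolding filterlim_at
    by (auto intro!: tendsto_eq_intros simp: eventually_at_filter)
  ultimately show "((\<lambda>s. rd (\<gamma> (k - t)) (\<gamma> (k - s))) \<longlongrightarrow> 0) (at t within {k - b..k - a})"
    by (rule filterlim_compose)
qed

lemma len_right_continuous:
  assumes fin: "cl \<gamma> a b < \<infinity>" and cont: "rd_continuous \<gamma> a b" and s: "s \<in> {a..b}" and "e > 0"
  shows "\<exists>d>0. \<forall>t\<in>{s..b}. t - s < d \<longrightarrow> len \<gamma> s t < e"
proof (rule len_right_small[OF _ _ \<open>e > 0\<close>])
  show "cl \<gamma> s b < \<infinity>" using cl_sub_le[of a s b b \<gamma>] s fin by auto
  show "((\<lambda>t. rd (\<gamma> s) (\<gamma> t)) \<longlongrightarrow> 0) (at s within {s..b})"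
    by (rule tendsto_within_subset[where S="{a..b}"]) (use cont s in \<open>auto simp: rd_continuous_def\<close>)
qed

lemma continuous_on_len:
  assumes fin: "cl \<gamma> a b < \<infinity>" and cont: "rd_continuous \<gamma> a b"
  shows "continuous_on {a..b} (len \<gamma> a)"
  unfolding continuous_on_iff
proof (intro ballI allI impI)
  fix s e :: real assume s: "s \<in> {a..b}" and "e > 0"
  obtain d1 where d1: "d1 > 0" "\<And>t. t \<in> {s..b} \<Longrightarrow> t - s < d1 \<Longrightarrow> len \<gamma> s t < e"
    using len_right_continuous[OF fin cont s \<open>e > 0\<close>] by auto
  \<comment> \<open>Continuity from the left is continuity from the right for the reversed
    curve.\<close>
  let ?g = "\<lambda>u. \<gamma> (0 - u)"
  have fin': "cl ?g (0 - b) (0 - a) < \<infinity>" using cl_reverse[of a b \<gamma> 0] fin s by auto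
  obtain d2 where d2: "d2 > 0" "\<And>t. t \<in> {0 - s..0 - a} \<Longrightarrow> t - (0 - s) < d2 \<Longrightarrow> len ?g (0 - s) t < e"
    using len_right_continuous[OF fin' rd_continuous_reverse[OF cont], of "0 - s" e] s \<open>e > 0\<close> by auto
  have left: "len \<gamma> t s < e" if "t \<in> {a..s}" "s - t < d2" for t
    using d2(2)[of "0 - t"] cl_reverse[of t s \<gamma> 0] that by auto
  show "\<exists>d>0. \<forall>t\<in>{a..b}. dist t s < d \<longrightarrow> dist (len \<gamma> a t) (len \<gamma> a s) < e"
  proof (intro exI[of _ "min d1 d2"] conjI ballI impI)
    show "0 < min d1 d2" using d1 d2 by simp
    fix t assume t: "t \<in> {a..b}" "dist t s < min d1 d2"
    show "dist (len \<gamma> a t) (len \<gamma> a s) < e"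
    proof (cases "s \<le> t")
      case True
      then have "len \<gamma> a t = len \<gamma> a s + len \<gamma> s t" using s t by (intro len_add[OF fin]) auto
      moreover have "len \<gamma> s t < e" using d1(2)[of t] t True by (auto simp: dist_real_def)
      ultimately show ?thesis using len_nonneg[OF True, of \<gamma>] unfolding dist_real_def by linarith
    next
      case False
      then have "len \<gamma> a s = len \<gamma> a t + len \<gamma> t s" using s t by (intro len_add[OF fin]) auto
      moreover have "len \<gamma> t s < e" using left[of t] t False by (auto simp: dist_real_def)
      ultimately show ?thesis using len_nonneg[of t s \<gamma>] False unfolding dist_real_def by linarith
    qed
  qed
qed

end

subsection \<open>Line integrals\<close>

text \<open>\<open>G\<close> is an antiderivative of \<open>h dV\<close>, with \<open>V s t\<close>
  as the mass of \<open>[s, t]\<close>, encoded by the two mean value inequalities on all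
  subintervals.\<close>

definition stieltjes_primitive ::
  "(real \<Rightarrow> real) \<Rightarrow> (real \<Rightarrow> real \<Rightarrow> real) \<Rightarrow> real \<Rightarrow> real \<Rightarrow> (real \<Rightarrow> real) \<Rightarrow> bool" where
  "stieltjes_primitive h V a b G \<longleftrightarrow> (\<forall>s t m. a \<le> s \<and> s \<le> t \<and> t \<le> b \<longrightarrow>
     ((\<forall>u\<in>{s..t}. h u \<le> m) \<longrightarrow> G t - G s \<le> m * V s t) \<and>
     ((\<forall>u\<in>{s..t}. m \<le> h u) \<longrightarrow> m * V s t \<le> G t - G s))"

lemma stieltjes_primitive_upper:
  "stieltjes_primitive h V a b G \<Longrightarrow> a \<le> s \<Longrightarrow> s \<le> t \<Longrightarrow> t \<le> b \<Longrightarrow> (\<And>u. u \<in> {s..t} \<Longrightarrow> h u \<le> m)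
    \<Longrightarrow> G t - G s \<le> m * V s t"
  unfolding stieltjes_primitive_def by blast

lemma stieltjes_primitive_lower:
  "stieltjes_primitive h V a b G \<Longrightarrow> a \<le> s \<Longrightarrow> s \<le> t \<Longrightarrow> t \<le> b \<Longrightarrow> (\<And>u. u \<in> {s..t} \<Longrightarrow> m \<le> h u)
    \<Longrightarrow> m * V s t \<le> G t - G s"
  unfolding stieltjes_primitive_def by blast

text \<open>On a short interval around \<open>x\<close> both increments lie between
  \<open>(h x - e) * V s t\<close> and \<open>(h x + e) * V s t\<close>, so they differ by at most
  \<open>2 * e * V s t\<close>. This bound is additive because \<open>V\<close> is, hence bisection
  carries it to \<open>[a, b]\<close>.\<close>

lemma stieltjes_primitive_unique:
  assumes "a \<le> b" and cont: "continuous_on {a..b} h"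
    and add: "\<And>r s t. a \<le> r \<Longrightarrow> r \<le> s \<Longrightarrow> s \<le> t \<Longrightarrow> t \<le> b \<Longrightarrow> V r t = V r s + V s t"
    and G: "stieltjes_primitive h V a b G" and H: "stieltjes_primitive h V a b H"
  shows "G b - G a = H b - H a"
proof -
  define D where "D s t = (G t - G s) - (H t - H s)" for s t
  have bound: "\<bar>D a b\<bar> \<le> 2 * e * V a b" if "e > 0" for e
  proof -
    have "a \<le> a \<and> b \<le> b \<longrightarrow> \<bar>D a b\<bar> \<le> 2 * e * V a b"
      using \<open>a \<le> b\<close>
    proof (rule Bolzano[where P="\<lambda>s t. a \<le> s \<and> t \<le> b \<longrightarrow> \<bar>D s t\<bar> \<le> 2 * e * V s t"])
      fix r s t
      assume 1: "a \<le> r \<and> s \<le> b \<longrightarrow> \<bar>D r s\<bar> \<le> 2 * e * V r s"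
        and 2: "a \<le> s \<and> t \<le> b \<longrightarrow> \<bar>D s t\<bar> \<le> 2 * e * V s t" and le: "r \<le> s" "s \<le> t"
      show "a \<le> r \<and> t \<le> b \<longrightarrow> \<bar>D r t\<bar> \<le> 2 * e * V r t"
      proof
        assume *: "a \<le> r \<and> t \<le> b"
        then have "V r t = V r s + V s t" using le by (intro add) auto
        then have "2 * e * V r t = 2 * e * V r s + 2 * e * V s t" by (simp add: algebra_simps)
        moreover have "D r t = D r s + D s t" by (simp add: D_def)
        moreover have "\<bar>D r s\<bar> \<le> 2 * e * V r s" "\<bar>D s t\<bar> \<le> 2 * e * V s t" using 1 2 * le by auto
        ultimately show "\<bar>D r t\<bar> \<le> 2 * e * V r t" by linarith
      qed
    next
      fix x assume x: "a \<le> x" "x \<le> b"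
      obtain d where d: "d > 0" "\<And>u. u \<in> {a..b} \<Longrightarrow> dist u x < d \<Longrightarrow> dist (h u) (h x) < e"
        using cont x \<open>e > 0\<close> unfolding continuous_on_iff by (metis atLeastAtMost_iff)
      have "\<bar>D s t\<bar> \<le> 2 * e * V s t" if st: "s \<le> x" "x \<le> t" "t - s < d" "a \<le> s" "t \<le> b" for s t
      proof -
        have *: "h u \<le> h x + e" "h x - e \<le> h u" if "u \<in> {s..t}" for u
          using d(2)[of u] st that by (auto simp: dist_real_def abs_less_iff)
        have "G t - G s \<le> (h x + e) * V s t" "(h x - e) * V s t \<le> G t - G s"
          "H t - H s \<le> (h x + e) * V s t" "(h x - e) * V s t \<le> H t - H s"
          using st * by (auto intro!: stieltjes_primitive_upper[OF G] stieltjes_primitive_lower[OF G]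
              stieltjes_primitive_upper[OF H] stieltjes_primitive_lower[OF H])
        then show ?thesis unfolding D_def abs_le_iff by (auto simp: algebra_simps)
      qed
      then show "\<exists>d>0. \<forall>s t. s \<le> x \<and> x \<le> t \<and> t - s < d \<longrightarrow> a \<le> s \<and> t \<le> b \<longrightarrow> \<bar>D s t\<bar> \<le> 2 * e * V s t"
        using d(1) by blast
    qed
    then show ?thesis by simp
  qed
  have "\<bar>D a b\<bar> \<le> 0"
  proof (rule field_le_epsilon)
    fix e :: real assume "e > 0"
    \<comment> \<open>The sign of \<open>V a b\<close> is unknown, hence the absolute value; the
      summand 1 keeps the denominator positive.\<close>
    define e' where "e' = e / (2 * (\<bar>V a b\<bar> + 1))"
    have "e' > 0" using \<open>e > 0\<close> by (simp add: e'_def)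
    from bound[OF this] have "\<bar>D a b\<bar> \<le> 2 * e' * (\<bar>V a b\<bar> + 1)"
      by (rule order_trans) (use \<open>e' > 0\<close> in \<open>auto intro!: mult_left_mono\<close>)
    also have "\<dots> = e" by (simp add: e'_def add_nonneg_pos field_simps)
    finally show "\<bar>D a b\<bar> \<le> 0 + e" by simp
  qed
  then show ?thesis by (simp add: D_def)
qed

interpretation dist_len: total_metric "dist :: 'a::metric_space \<Rightarrow> 'a \<Rightarrow> real"
  by (simp add: total_metric_def Met_TC.Metric_space_axioms)

lemma dist_rd_continuous:
  "continuous_on {a..b} \<gamma> \<Longrightarrow> dist_len.rd_continuous \<gamma> a b"
  unfolding dist_len.rd_continuous_def continuous_on_def
  by (auto intro!: tendsto_eq_intros)

lemma rectifiable_sub: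
  assumes "rectifiable \<gamma> a b" "a \<le> s" "s \<le> t" "t \<le> b"
  shows "rectifiable \<gamma> s t"
  using assms dist_len.cl_sub_le[OF assms(2-4), of \<gamma>]
  by (auto simp: rectifiable_def intro: continuous_on_subset)

text \<open>\<open>G t\<close> is the Stieltjes integral over \<open>{a<..t}\<close>. Continuity of
  the arclength function gives half-open intervals their length as \<open>interval_measure\<close>,
  and its constancy to the left of \<open>a\<close> leaves no mass at \<open>a\<close>.\<close>

lemma line_integral_primitive:
  fixes \<rho> :: "'a::metric_space \<Rightarrow> real"
  assumes rect: "rectifiable \<gamma> a b" and cont: "continuous_on UNIV \<rho>" and pos: "\<And>x. 0 \<le> \<rho> x"
  obtains G where "G a = 0" "G b = line_integral \<rho> \<gamma> a b"
    "stieltjes_primitive (\<lambda>u. \<rho> (\<gamma> u)) (dist_len.len \<gamma>) a b G"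
proof -
  have ab: "a \<le> b" and c\<gamma>: "continuous_on {a..b} \<gamma>" and fin: "curve_length dist \<gamma> a b < \<infinity>"
    using rect by (auto simp: rectifiable_def)
  define F where "F = arclength_fun \<gamma> a b"
  have F_in: "F t = dist_len.len \<gamma> a t" if "t \<in> {a..b}" for t
    using that by (simp add: F_def arclength_fun_def)
  have F_clamp: "F t = dist_len.len \<gamma> a (max a (min b t))" for t
    by (simp add: F_def arclength_fun_def)
  have F_diff: "F t - F s = dist_len.len \<gamma> s t" if "a \<le> s" "s \<le> t" "t \<le> b" for s t
    using dist_len.len_add[OF fin, of a s t] that by (simp add: F_in)
  have F_mono: "F s \<le> F t" if "s \<le> t" for s t
  proof -
    let ?c = "\<lambda>t. max a (min b t)"
    have "F (?c t) - F (?c s) = dist_len.len \<gamma> (?c s) (?c t)"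
      using that ab by (intro F_diff) auto
    moreover have "0 \<le> dist_len.len \<gamma> (?c s) (?c t)" using that by (intro dist_len.len_nonneg) auto
    moreover have "F (?c t) = F t" for t unfolding F_clamp using ab by (simp add: min_def max_def)
    ultimately show ?thesis by (metis diff_ge_0_iff_ge)
  qed
  have "continuous_on UNIV (\<lambda>t. dist_len.len \<gamma> a (max a (min b t)))"
    by (rule continuous_on_compose2[OF dist_len.continuous_on_len[OF fin dist_rd_continuous[OF c\<gamma>]]])
      (use ab in \<open>auto intro!: continuous_intros\<close>)
  then have "continuous_on UNIV F" by (simp add: F_clamp[abs_def])
  then have F_cont: "continuous (at_right x) F" for x
    by (simp add: continuous_on_eq_continuous_at continuous_at_imp_continuous_at_within)
  define \<mu> where "\<mu> = interval_measure F"
  have sets_mu [measurable_cong]: "sets \<mu> = sets borel" by (simp add: \<mu>_def)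
  have mu_Ioc: "emeasure \<mu> {s<..t} = ennreal (F t - F s)" if "s \<le> t" for s t
    unfolding \<mu>_def using that F_mono F_cont by (rule emeasure_interval_measure_Ioc)
  define f where "f u = ennreal (\<rho> (\<gamma> u)) * indicator {a..b} u" for u
  have c\<rho>: "continuous_on {a..b} (\<lambda>u. \<rho> (\<gamma> u))"
    using continuous_on_compose2[OF cont c\<gamma>] by auto
  have "(\<lambda>u. indicator {a..b} u *\<^sub>R \<rho> (\<gamma> u)) \<in> borel_measurable borel"
    by (rule borel_measurable_continuous_on_indicator) (use c\<rho> in auto)
  then have "(\<lambda>u. ennreal (indicator {a..b} u *\<^sub>R \<rho> (\<gamma> u))) \<in> borel_measurable borel" by simp
  also have "(\<lambda>u. ennreal (indicator {a..b} u *\<^sub>R \<rho> (\<gamma> u))) = f"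
    by (auto simp: f_def indicator_def fun_eq_iff)
  finally have f_meas [measurable]: "f \<in> borel_measurable \<mu>"
    using measurable_cong_sets[OF sets_mu refl] by blast
  define J where "J A = (\<integral>\<^sup>+u. f u * indicator A u \<partial>\<mu>)" for A
  have J_upper: "J {s<..t} \<le> ennreal (m * dist_len.len \<gamma> s t)"
    if st: "a \<le> s" "s \<le> t" "t \<le> b" and m: "\<And>u. u \<in> {s..t} \<Longrightarrow> \<rho> (\<gamma> u) \<le> m" for s t m
  proof -
    have "0 \<le> m" using m[of s] pos[of "\<gamma> s"] st by auto
    have "J {s<..t} \<le> (\<integral>\<^sup>+u. ennreal m * indicator {s<..t} u \<partial>\<mu>)"
      unfolding J_def by (rule nn_integral_mono) (use st m in \<open>auto simp: f_def indicator_def intro!: ennreal_leI\<close>)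
    also have "\<dots> = ennreal m * ennreal (F t - F s)"
      using st by (subst nn_integral_cmult_indicator) (auto simp: mu_Ioc sets_mu)
    also have "\<dots> = ennreal (m * dist_len.len \<gamma> s t)"
      using F_diff[OF st] \<open>0 \<le> m\<close> dist_len.len_nonneg[OF st(2), of \<gamma>] by (simp add: ennreal_mult)
    finally show ?thesis .
  qed
  have J_lower: "ennreal (m * dist_len.len \<gamma> s t) \<le> J {s<..t}"
    if st: "a \<le> s" "s \<le> t" "t \<le> b" and m: "\<And>u. u \<in> {s..t} \<Longrightarrow> m \<le> \<rho> (\<gamma> u)" for s t m
  proof (cases "0 \<le> m")
    case True
    have "ennreal (m * dist_len.len \<gamma> s t) = ennreal m * ennreal (F t - F s)"
      using F_diff[OF st] \<open>0 \<le> m\<close> dist_len.len_nonneg[OF st(2), of \<gamma>] by (simp add: ennreal_mult)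
    also have "\<dots> = (\<integral>\<^sup>+u. ennreal m * indicator {s<..t} u \<partial>\<mu>)"
      using st by (subst nn_integral_cmult_indicator) (auto simp: mu_Ioc sets_mu)
    also have "\<dots> \<le> J {s<..t}"
      unfolding J_def by (rule nn_integral_mono) (use st m in \<open>auto simp: f_def indicator_def intro!: ennreal_leI\<close>)
    finally show ?thesis .
  next
    case False
    then have "m * dist_len.len \<gamma> s t \<le> 0"
      using dist_len.len_nonneg[OF st(2), of \<gamma>] by (simp add: mult_nonpos_nonneg)
    then show ?thesis by (simp add: ennreal_neg)
  qed
  have J_add: "J {r<..t} = J {r<..s} + J {s<..t}" if "r \<le> s" "s \<le> t" for r s t
  proof -
    have "J {r<..t} = (\<integral>\<^sup>+u. f u * indicator {r<..s} u + f u * indicator {s<..t} u \<partial>\<mu>)"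
      unfolding J_def by (rule nn_integral_cong) (use that in \<open>auto simp: indicator_def\<close>)
    also have "\<dots> = J {r<..s} + J {s<..t}"
      unfolding J_def by (rule nn_integral_add) measurable
    finally show ?thesis .
  qed
  \<comment> \<open>A bound on the weight keeps the integrals finite, so that
    \<open>enn2real\<close> in \<open>G\<close> loses nothing.\<close>
  obtain B where B: "\<And>u. u \<in> {a..b} \<Longrightarrow> \<rho> (\<gamma> u) \<le> B"
    using continuous_attains_sup[OF compact_Icc _ c\<rho>] ab by (metis atLeastatMost_empty_iff)
  have J_fin: "J {a<..t} < \<infinity>" if "t \<in> {a..b}" for t
    using J_upper[of a t B] B that by (auto intro: le_less_trans)
  define G where "G t = enn2real (J {a<..t})" for t
  have G_diff: "ennreal (G t - G s) = J {s<..t}" "G s \<le> G t" if st: "a \<le> s" "s \<le> t" "t \<le> b" for s t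
  proof -
    have e: "J {a<..t} = J {a<..s} + J {s<..t}" using st by (intro J_add)
    have 1: "J {a<..s} = ennreal (G s)" "J {a<..t} = ennreal (G t)"
      using J_fin[of s] J_fin[of t] st by (auto simp: G_def less_top)
    have "J {s<..t} < \<infinity>" using e J_fin[of t] st by (auto simp: less_top)
    then have 2: "J {s<..t} = ennreal (enn2real (J {s<..t}))" by (simp add: less_top)
    have "ennreal (G t) = ennreal (G s + enn2real (J {s<..t}))"
      using e 1 2 by (metis ennreal_plus enn2real_nonneg G_def)
    then have "G t = G s + enn2real (J {s<..t})"
      by (subst (asm) ennreal_inj) (auto simp: G_def)
    then show "ennreal (G t - G s) = J {s<..t}" "G s \<le> G t" using 2 by auto
  qed
  \<comment> \<open>\<open>line_integral\<close> is taken over the closed interval, \<open>G\<close>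
    over half-open ones.\<close>
  have null: "emeasure \<mu> {a} = 0"
  proof -
    have "F a - F (a - 1) = 0" using ab by (simp add: F_clamp min_def max_def)
    then have "emeasure \<mu> {a - 1<..a} = 0" by (simp add: mu_Ioc)
    moreover have "emeasure \<mu> {a} \<le> emeasure \<mu> {a - 1<..a}"
      by (rule emeasure_mono) (auto simp: sets_mu)
    ultimately show ?thesis by simp
  qed
  have "{a} \<in> null_sets \<mu>" using null by (auto simp: null_sets_def sets_mu)
  then have AE: "AE u in \<mu>. u \<noteq> a" by (rule AE_not_in[THEN AE_mp]) auto
  have "(\<integral>\<^sup>+u. f u \<partial>\<mu>) = J {a<..b}"
    unfolding J_def by (rule nn_integral_cong_AE) (use AE in eventually_elim, auto simp: f_def indicator_def)
  then have Gb: "G b = line_integral \<rho> \<gamma> a b"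
    unfolding G_def line_integral_def f_def \<mu>_def F_def by simp
  have Ga: "G a = 0" by (simp add: G_def J_def)
  have "stieltjes_primitive (\<lambda>u. \<rho> (\<gamma> u)) (dist_len.len \<gamma>) a b G"
    unfolding stieltjes_primitive_def
  proof (intro allI impI conjI)
    fix s t m assume st: "a \<le> s \<and> s \<le> t \<and> t \<le> b"
    then have st': "a \<le> s" "s \<le> t" "t \<le> b" by auto
    {
      assume m: "\<forall>u\<in>{s..t}. \<rho> (\<gamma> u) \<le> m"
      then have "\<rho> (\<gamma> s) \<le> m" using st by auto
      then have "0 \<le> m" using pos[of "\<gamma> s"] by linarith
      then show "G t - G s \<le> m * dist_len.len \<gamma> s t"
        using J_upper[OF st', of m] m G_diff[OF st'] dist_len.len_nonneg[OF st'(2), of \<gamma>]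
        by (metis ennreal_le_iff mult_nonneg_nonneg)
    next
      assume m: "\<forall>u\<in>{s..t}. m \<le> \<rho> (\<gamma> u)"
      show "m * dist_len.len \<gamma> s t \<le> G t - G s"
        using J_lower[OF st', of m] m G_diff[OF st']
        by (metis diff_ge_0_iff_ge ennreal_le_iff)
    }
  qed
  with Ga Gb show ?thesis by (rule that)
qed

lemma rectifiable_reverse:
  assumes "rectifiable \<gamma> a b"
  shows "rectifiable (\<lambda>s. \<gamma> (k - s)) (k - b) (k - a)"
  using assms dist_len.cl_reverse[of a b \<gamma> k] unfolding rectifiable_def
  by (auto intro!: continuous_on_compose2[of "{a..b}" \<gamma>] continuous_intros)

text \<open>The primitive \<open>H\<close> of the reversed curve, reflected and negated, is a
  primitive for \<open>\<gamma>\<close>; uniqueness of the increments identifies the integrals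
  without a change of variables.\<close>

lemma line_integral_reverse:
  fixes \<rho> :: "'a::metric_space \<Rightarrow> real"
  assumes rect: "rectifiable \<gamma> a b" and cont: "continuous_on UNIV \<rho>" and pos: "\<And>x. 0 \<le> \<rho> x"
  shows "line_integral \<rho> (\<lambda>s. \<gamma> (k - s)) (k - b) (k - a) = line_integral \<rho> \<gamma> a b"
proof -
  have ab: "a \<le> b" and c\<gamma>: "continuous_on {a..b} \<gamma>" and fin: "curve_length dist \<gamma> a b < \<infinity>"
    using rect by (auto simp: rectifiable_def)
  obtain G where G: "G a = 0" "G b = line_integral \<rho> \<gamma> a b"
    "stieltjes_primitive (\<lambda>u. \<rho> (\<gamma> u)) (dist_len.len \<gamma>) a b G"
    by (rule line_integral_primitive[OF rect cont pos])
  obtain H where H: "H (k - b) = 0" "H (k - a) = line_integral \<rho> (\<lambda>s. \<gamma> (k - s)) (k - b) (k - a)"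
    "stieltjes_primitive (\<lambda>u. \<rho> (\<gamma> (k - u))) (dist_len.len (\<lambda>s. \<gamma> (k - s))) (k - b) (k - a) H"
    by (rule line_integral_primitive[OF rectifiable_reverse[OF rect] cont pos])
  have "stieltjes_primitive (\<lambda>u. \<rho> (\<gamma> u)) (dist_len.len \<gamma>) a b (\<lambda>t. - H (k - t))"
    unfolding stieltjes_primitive_def
  proof (intro allI impI conjI)
    fix s t m assume st: "a \<le> s \<and> s \<le> t \<and> t \<le> b"
    have len: "dist_len.len (\<lambda>s. \<gamma> (k - s)) (k - t) (k - s) = dist_len.len \<gamma> s t"
      using dist_len.cl_reverse[of s t \<gamma> k] st by simp
    {
      assume m: "\<forall>u\<in>{s..t}. \<rho> (\<gamma> u) \<le> m"
      show "- H (k - t) - - H (k - s) \<le> m * dist_len.len \<gamma> s t"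
        using stieltjes_primitive_upper[OF H(3), of "k - t" "k - s" m] st m len by auto
    next
      assume m: "\<forall>u\<in>{s..t}. m \<le> \<rho> (\<gamma> u)"
      show "m * dist_len.len \<gamma> s t \<le> - H (k - t) - - H (k - s)"
        using stieltjes_primitive_lower[OF H(3), of "k - t" "k - s" m] st m len by auto
    }
  qed
  from stieltjes_primitive_unique[OF ab continuous_on_compose2[OF cont c\<gamma>] dist_len.len_add[OF fin] G(3) this]
  have "G b - G a = H (k - a) - H (k - b)" by simp
  then show ?thesis using G H by simp
qed

lemma line_integral_add:
  fixes \<rho> :: "'a::metric_space \<Rightarrow> real"
  assumes rect: "rectifiable \<gamma> a c" and cont: "continuous_on UNIV \<rho>" and pos: "\<And>x. 0 \<le> \<rho> x"
    and b: "a \<le> b" "b \<le> c"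
  shows "line_integral \<rho> \<gamma> a c = line_integral \<rho> \<gamma> a b + line_integral \<rho> \<gamma> b c"
proof -
  obtain G where G: "G a = 0" "G c = line_integral \<rho> \<gamma> a c"
    "stieltjes_primitive (\<lambda>u. \<rho> (\<gamma> u)) (dist_len.len \<gamma>) a c G"
    by (rule line_integral_primitive[OF rect cont pos])
  \<comment> \<open>The primitive for the whole curve restricts to one on \<open>[s, t]\<close>, so
    uniqueness makes its increment the line integral over \<open>[s, t]\<close>.\<close>
  have part: "line_integral \<rho> \<gamma> s t = G t - G s" if st: "a \<le> s" "s \<le> t" "t \<le> c" for s t
  proof -
    have rect': "rectifiable \<gamma> s t" by (rule rectifiable_sub[OF rect st])
    obtain H where H: "H s = 0" "H t = line_integral \<rho> \<gamma> s t"
      "stieltjes_primitive (\<lambda>u. \<rho> (\<gamma> u)) (dist_len.len \<gamma>) s t H"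
      by (rule line_integral_primitive[OF rect' cont pos])
    have G': "stieltjes_primitive (\<lambda>u. \<rho> (\<gamma> u)) (dist_len.len \<gamma>) s t G"
      using G(3) st unfolding stieltjes_primitive_def by force
    have "continuous_on {s..t} \<gamma>" and fin: "curve_length dist \<gamma> s t < \<infinity>"
      using rect' by (auto simp: rectifiable_def)
    from stieltjes_primitive_unique[OF st(2) continuous_on_compose2[OF cont this(1)] dist_len.len_add[OF fin] G' H(3)]
    show ?thesis using H(1,2) by simp
  qed
  show ?thesis using part[of a c] part[of a b] part[of b c] b by simp
qed

subsection \<open>The uniformized metric\<close>

lemma curve_length_cong:
  assumes "\<And>u. u \<in> {a..b} \<Longrightarrow> \<gamma> u = \<eta> u"
  shows "curve_length rd \<gamma> a b = curve_length rd \<eta> a b"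
  unfolding curve_length_def
proof (rule SUP_cong[OF refl])
  fix q assume "q \<in> partitions a b"
  then obtain n t where q: "q = (n, t)" and nt: "(n, t) \<in> partitions a b" by (cases q) auto
  have "\<gamma> (t i) = \<eta> (t i)" if "i \<le> n" for i
    using dist_len.partitions_bounds[OF nt that] assms by auto
  then show "(case q of (n, t) \<Rightarrow> ereal (\<Sum>i<n. rd (\<gamma> (t i)) (\<gamma> (t (Suc i)))))
      = (case q of (n, t) \<Rightarrow> ereal (\<Sum>i<n. rd (\<eta> (t i)) (\<eta> (t (Suc i)))))"
    by (simp add: q)
qed

lemma rectifiable_cong:
  assumes "\<And>u. u \<in> {a..b} \<Longrightarrow> \<gamma> u = \<eta> u"
  shows "rectifiable \<gamma> a b \<longleftrightarrow> rectifiable \<eta> a b"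
proof -
  have "curve_length dist \<gamma> a b = curve_length dist \<eta> a b" by (rule curve_length_cong) (rule assms)
  moreover have "continuous_on {a..b} \<gamma> \<longleftrightarrow> continuous_on {a..b} \<eta>"
    by (rule continuous_on_cong) (auto simp: assms)
  ultimately show ?thesis by (simp add: rectifiable_def)
qed

lemma line_integral_cong:
  assumes "\<And>u. u \<in> {a..b} \<Longrightarrow> \<gamma> u = \<eta> u" "a \<le> b"
  shows "line_integral \<rho> \<gamma> a b = line_integral \<rho> \<eta> a b"
proof -
  have "arclength_fun \<gamma> a b = arclength_fun \<eta> a b"
    unfolding arclength_fun_def fun_eq_iff
    using assms by (auto intro!: arg_cong[where f=real_of_ereal] curve_length_cong)
  then show ?thesis unfolding line_integral_def
    by (auto intro!: arg_cong[where f=enn2real] nn_integral_cong simp: indicator_def assms)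
qed

lemma rectifiable_join:
  assumes "rectifiable \<gamma> a b" "rectifiable \<gamma> b c"
  shows "rectifiable \<gamma> a c"
proof -
  have le: "a \<le> b" "b \<le> c" using assms by (auto simp: rectifiable_def)
  then have "{a..b} \<union> {b..c} = {a..c}" by auto
  then have "continuous_on {a..c} \<gamma>"
    using continuous_on_closed_Un[of "{a..b}" "{b..c}" \<gamma>] assms by (auto simp: rectifiable_def)
  then show ?thesis using assms dist_len.cl_add[OF le, of \<gamma>] le by (auto simp: rectifiable_def)
qed

text \<open>A composite of two reflections is a translation; hence the argument
  \<open>a - (c - s)\<close>, and the reversal lemma suffices.\<close>

lemma rectifiable_translate:
  assumes "rectifiable \<gamma> a b"
  shows "rectifiable (\<lambda>s. \<gamma> (a - (c - s))) c (c + (b - a))"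
  using rectifiable_reverse[OF rectifiable_reverse[OF assms, of a], of c] by (simp add: algebra_simps)

lemma line_integral_translate:
  fixes \<rho> :: "'a::metric_space \<Rightarrow> real"
  assumes rect: "rectifiable \<gamma> a b" and cont: "continuous_on UNIV \<rho>" and pos: "\<And>x. 0 \<le> \<rho> x"
  shows "line_integral \<rho> (\<lambda>s. \<gamma> (a - (c - s))) c (c + (b - a)) = line_integral \<rho> \<gamma> a b"
  using line_integral_reverse[OF rectifiable_reverse[OF rect, of a] cont pos, of c]
    line_integral_reverse[OF rect cont pos, of a] by (simp add: algebra_simps)

text \<open>Common form of geodesic segments, rays and their restrictions to intervals that need not
  start at 0.\<close>

definition isometric_path :: "(real \<Rightarrow> 'a::metric_space) \<Rightarrow> real \<Rightarrow> real \<Rightarrow> bool" where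
  "isometric_path \<gamma> a b \<longleftrightarrow> (\<forall>s\<in>{a..b}. \<forall>t\<in>{a..b}. dist (\<gamma> s) (\<gamma> t) = \<bar>s - t\<bar>)"

lemma isometric_path_sub:
  "isometric_path \<gamma> a b \<Longrightarrow> a \<le> s \<Longrightarrow> t \<le> b \<Longrightarrow> isometric_path \<gamma> s t"
  by (auto simp: isometric_path_def)

lemma geodesic_seg_isometric: "geodesic_seg \<gamma> x y \<Longrightarrow> isometric_path \<gamma> 0 (dist x y)"
  by (simp add: geodesic_seg_def isometric_path_def)

lemma geodesic_ray_isometric: "geodesic_ray \<gamma> x \<Longrightarrow> isometric_path \<gamma> 0 b"
  by (simp add: geodesic_ray_def isometric_path_def)

lemma isometric_path_continuous:
  assumes "isometric_path \<gamma> a b" shows "continuous_on {a..b} \<gamma>"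
  unfolding continuous_on_iff using assms by (auto simp: isometric_path_def dist_real_def)

lemma isometric_path_length:
  assumes "isometric_path \<gamma> a b" "a \<le> b"
  shows "curve_length dist \<gamma> a b = ereal (b - a)"
proof (rule antisym)
  show "curve_length dist \<gamma> a b \<le> ereal (b - a)"
    by (rule dist_len.cl_telescope[where \<Phi>="\<lambda>t. t"]) (use assms in \<open>auto simp: isometric_path_def\<close>)
  show "ereal (b - a) \<le> curve_length dist \<gamma> a b"
    using dist_len.cl_ge_dist[OF assms(2), of \<gamma>] assms by (auto simp: isometric_path_def)
qed

lemma isometric_path_rectifiable:
  "isometric_path \<gamma> a b \<Longrightarrow> a \<le> b \<Longrightarrow> rectifiable \<gamma> a b"
  by (simp add: rectifiable_def isometric_path_continuous isometric_path_length)

locale uniformization =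
  fixes \<epsilon> :: real and p :: "'a::metric_space"
  assumes eps_pos: "\<epsilon> > 0"
    and geodesic: "\<And>x y :: 'a. \<exists>\<gamma>. geodesic_seg \<gamma> x y"
begin

abbreviation E :: "'a \<Rightarrow> 'a \<Rightarrow> real" where "E \<equiv> d_eps \<epsilon> p"
abbreviation \<rho> :: "'a \<Rightarrow> real" where "\<rho> \<equiv> rho_eps \<epsilon> p"

lemma rho_continuous: "continuous_on UNIV \<rho>"
  unfolding rho_eps_def by (intro continuous_intros)

lemma rho_pos: "0 < \<rho> z"
  by (simp add: rho_eps_def)

lemma rho_nonneg: "0 \<le> \<rho> z"
  by (simp add: rho_eps_def)

lemma rho_le_exp:
  assumes "dist p z \<ge> r" shows "\<rho> z \<le> exp (- \<epsilon> * r)"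
  using eps_pos assms by (simp add: rho_eps_def)

lemma rho_ge_exp:
  assumes "dist p z \<le> r" shows "exp (- \<epsilon> * r) \<le> \<rho> z"
  using eps_pos assms by (simp add: rho_eps_def)

lemma rho_harnack: "exp (- \<epsilon> * dist z w) * \<rho> z \<le> \<rho> w"
proof -
  have "\<epsilon> * dist p w \<le> \<epsilon> * (dist p z + dist z w)"
    using eps_pos by (intro mult_left_mono dist_triangle) auto
  then show ?thesis unfolding rho_eps_def exp_add[symmetric] by (simp add: algebra_simps)
qed

lemma line_integral_nonneg: "0 \<le> line_integral \<rho> \<gamma> a b"
  by (simp add: line_integral_def)

lemma E_le_line_integral:
  assumes "rectifiable \<gamma> a b"
  shows "E (\<gamma> a) (\<gamma> b) \<le> line_integral \<rho> \<gamma> a b"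
  unfolding d_eps_def
proof (rule cInf_lower)
  show "bdd_below {line_integral \<rho> \<eta> c d |\<eta> c d. rectifiable \<eta> c d \<and> \<eta> c = \<gamma> a \<and> \<eta> d = \<gamma> b}"
    by (rule bdd_belowI[where m=0]) (auto simp: line_integral_nonneg)
qed (use assms in blast)

text \<open>Guards the \<open>Inf\<close> in \<open>d_eps\<close> against the empty set: a geodesic
  is a rectifiable curve.\<close>

lemma line_integrals_nonempty:
  "{line_integral \<rho> \<gamma> a b |\<gamma> a b. rectifiable \<gamma> a b \<and> \<gamma> a = x \<and> \<gamma> b = y} \<noteq> {}"
proof -
  obtain \<gamma> where g: "geodesic_seg \<gamma> x y" using geodesic by blast
  have "rectifiable \<gamma> 0 (dist x y)" "\<gamma> 0 = x" "\<gamma> (dist x y) = y"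
    using isometric_path_rectifiable[OF geodesic_seg_isometric[OF g]] g by (auto simp: geodesic_seg_def)
  then show ?thesis by blast
qed

lemma E_greatest:
  assumes "\<And>\<gamma> a b. rectifiable \<gamma> a b \<Longrightarrow> \<gamma> a = x \<Longrightarrow> \<gamma> b = y \<Longrightarrow> B \<le> line_integral \<rho> \<gamma> a b"
  shows "B \<le> E x y"
  unfolding d_eps_def by (rule cInf_greatest[OF line_integrals_nonempty]) (use assms in blast)

lemma E_approx:
  assumes "e > 0"
  obtains \<gamma> a b where "rectifiable \<gamma> a b" "\<gamma> a = x" "\<gamma> b = y" "line_integral \<rho> \<gamma> a b < E x y + e"
proof -
  have "Inf {line_integral \<rho> \<gamma> a b |\<gamma> a b. rectifiable \<gamma> a b \<and> \<gamma> a = x \<and> \<gamma> b = y} < E x y + e"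
    using assms by (simp add: d_eps_def)
  from cInf_lessD[OF line_integrals_nonempty this] show ?thesis using that by blast
qed

lemma E_nonneg: "0 \<le> E x y"
  by (rule E_greatest) (rule line_integral_nonneg)

lemma E_isometric_path:
  assumes iso: "isometric_path \<gamma> a b" and "a \<le> b" and S: "\<And>u. u \<in> {a..b} \<Longrightarrow> \<rho> (\<gamma> u) \<le> S"
  shows "E (\<gamma> a) (\<gamma> b) \<le> S * (b - a)"
proof -
  have rect: "rectifiable \<gamma> a b" using assms by (intro isometric_path_rectifiable)
  obtain G where G: "G a = 0" "G b = line_integral \<rho> \<gamma> a b"
    "stieltjes_primitive (\<lambda>u. \<rho> (\<gamma> u)) (dist_len.len \<gamma>) a b G"
    by (rule line_integral_primitive[OF rect rho_continuous rho_nonneg])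
  have "G b - G a \<le> S * dist_len.len \<gamma> a b"
    by (rule stieltjes_primitive_upper[OF G(3)]) (use assms in auto)
  then show ?thesis
    using G E_le_line_integral[OF rect] isometric_path_length[OF iso \<open>a \<le> b\<close>] by simp
qed

lemma E_le_exp_dist:
  assumes "\<And>z. dist x z \<le> dist x y \<Longrightarrow> dist p z \<ge> r"
  shows "E x y \<le> exp (- \<epsilon> * r) * dist x y"
proof -
  obtain \<gamma> where g: "geodesic_seg \<gamma> x y" using geodesic by blast
  have "E (\<gamma> 0) (\<gamma> (dist x y)) \<le> exp (- \<epsilon> * r) * (dist x y - 0)"
  proof (rule E_isometric_path[OF geodesic_seg_isometric[OF g]])
    fix u assume u: "u \<in> {0..dist x y}"
    then have "dist (\<gamma> 0) (\<gamma> u) = \<bar>0 - u\<bar>"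
      using geodesic_seg_isometric[OF g] unfolding isometric_path_def by auto
    then have "dist x (\<gamma> u) = u" using g u by (simp add: geodesic_seg_def)
    then show "\<rho> (\<gamma> u) \<le> exp (- \<epsilon> * r)" using u by (intro rho_le_exp assms) auto
  qed auto
  then show ?thesis using g by (simp add: geodesic_seg_def)
qed

lemma E_le_near: "E x y \<le> exp (- \<epsilon> * (dist p x - dist x y)) * dist x y"
proof (rule E_le_exp_dist)
  fix z assume "dist x z \<le> dist x y"
  then show "dist p x - dist x y \<le> dist p z" using dist_triangle[of p x z] by (simp add: dist_commute)
qed

lemma E_le_dist: "E x y \<le> dist x y"
  using E_le_exp_dist[of x y 0] by simp

lemma E_commute_le: "E x y \<le> E y x"
proof (rule E_greatest)
  fix \<gamma> :: "real \<Rightarrow> 'a" and a b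
  assume r: "rectifiable \<gamma> a b" and "\<gamma> a = y" "\<gamma> b = x"
  then show "E x y \<le> line_integral \<rho> \<gamma> a b"
    using E_le_line_integral[OF rectifiable_reverse[OF r, of 0]]
      line_integral_reverse[OF r rho_continuous rho_nonneg, of 0] by simp
qed

lemma E_commute: "E x y = E y x"
  by (intro antisym E_commute_le)

lemma E_triangle: "E x z \<le> E x y + E y z"
proof (rule field_le_epsilon)
  fix e :: real assume "e > 0"
  obtain \<gamma> a b where g: "rectifiable \<gamma> a b" "\<gamma> a = x" "\<gamma> b = y" "line_integral \<rho> \<gamma> a b < E x y + e/2"
    using E_approx[of "e/2" x y] \<open>e > 0\<close> by (metis half_gt_zero)
  obtain \<eta> c d where h: "rectifiable \<eta> c d" "\<eta> c = y" "\<eta> d = z" "line_integral \<rho> \<eta> c d < E y z + e/2"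
    using E_approx[of "e/2" y z] \<open>e > 0\<close> by (metis half_gt_zero)
  have le: "a \<le> b" "c \<le> d" using g h by (auto simp: rectifiable_def)
  \<comment> \<open>\<open>\<eta>\<close> is translated so as to start at \<open>b\<close>; at the
    joint both branches have the value \<open>y\<close>.\<close>
  define \<theta> where "\<theta> t = (if t \<le> b then \<gamma> t else \<eta> (c - (b - t)))" for t
  define m where "m = b + (d - c)"
  have eq1: "\<theta> u = \<gamma> u" if "u \<in> {a..b}" for u using that by (simp add: \<theta>_def)
  have eq2: "\<theta> u = \<eta> (c - (b - u))" if "u \<in> {b..m}" for u using that g h by (auto simp: \<theta>_def)
  have r1: "rectifiable \<theta> a b" using rectifiable_cong[of a b \<theta> \<gamma>] eq1 g by blast
  have r2: "rectifiable \<theta> b m"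
    using rectifiable_cong[of b m \<theta> "\<lambda>u. \<eta> (c - (b - u))"] eq2 rectifiable_translate[OF h(1), of b]
    by (simp add: m_def)
  have r: "rectifiable \<theta> a m" by (rule rectifiable_join[OF r1 r2])
  have bm: "b \<le> m" using le by (simp add: m_def)
  have "E x z \<le> line_integral \<rho> \<theta> a m"
    using E_le_line_integral[OF r] eq1[of a] eq2[of m] le g h bm by (simp add: m_def)
  also have "\<dots> = line_integral \<rho> \<theta> a b + line_integral \<rho> \<theta> b m"
    by (rule line_integral_add[OF r rho_continuous rho_nonneg le(1) bm])
  also have "line_integral \<rho> \<theta> a b = line_integral \<rho> \<gamma> a b"
    by (rule line_integral_cong) (use eq1 le in auto)
  also have "line_integral \<rho> \<theta> b m = line_integral \<rho> (\<lambda>u. \<eta> (c - (b - u))) b m"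
    by (rule line_integral_cong) (use eq2 bm in auto)
  also have "\<dots> = line_integral \<rho> \<eta> c d"
    unfolding m_def by (rule line_integral_translate[OF h(1) rho_continuous rho_nonneg])
  finally show "E x z \<le> E x y + E y z + e" using g h by simp
qed

text \<open>Let \<open>f\<close> be the distance from \<open>z\<close>, capped at 1. Within distance
  2 of \<open>z\<close> the weight is at least \<open>exp (- 2 * \<epsilon>) * \<rho> z\<close> and
  \<open>f\<close> grows no faster than arclength; at distance at least 1 from \<open>z\<close>,
  \<open>f\<close> is constant. The overlap of the two regions allows short pieces to be glued by
  bisection, and the cap makes the bound valid for curves that run far away.\<close>

lemma E_lower: "exp (- 2 * \<epsilon>) * \<rho> z * min 1 (dist z w) \<le> E z w"
proof (rule E_greatest)
  fix \<gamma> :: "real \<Rightarrow> 'a" and a b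
  assume rect: "rectifiable \<gamma> a b" and ends: "\<gamma> a = z" "\<gamma> b = w"
  then have ab: "a \<le> b" and c\<gamma>: "continuous_on {a..b} \<gamma>" and fin: "curve_length dist \<gamma> a b < \<infinity>"
    by (auto simp: rectifiable_def)
  obtain G where G: "G a = 0" "G b = line_integral \<rho> \<gamma> a b"
    "stieltjes_primitive (\<lambda>u. \<rho> (\<gamma> u)) (dist_len.len \<gamma>) a b G"
    by (rule line_integral_primitive[OF rect rho_continuous rho_nonneg])
  define m where "m = exp (- 2 * \<epsilon>) * \<rho> z"
  have "m \<ge> 0" by (simp add: m_def rho_nonneg)
  define f where "f t = min 1 (dist z (\<gamma> t))" for t
  have "a \<le> a \<and> b \<le> b \<longrightarrow> m * (f b - f a) \<le> G b - G a"
    using ab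
  proof (rule Bolzano[where P="\<lambda>s t. a \<le> s \<and> t \<le> b \<longrightarrow> m * (f t - f s) \<le> G t - G s"])
    fix x assume x: "a \<le> x" "x \<le> b"
    have cd: "continuous_on {a..b} (\<lambda>u. dist z (\<gamma> u))" using c\<gamma> by (intro continuous_intros)
    \<comment> \<open>With the threshold \<open>3/2\<close> and an oscillation below
      \<open>1/2\<close>, each short piece stays within distance 2 of \<open>z\<close> or at
      distance at least 1 from it.\<close>
    obtain d where d: "d > 0" "\<And>u. u \<in> {a..b} \<Longrightarrow> dist u x < d \<Longrightarrow> dist (dist z (\<gamma> u)) (dist z (\<gamma> x)) < 1/2"
      using cd[unfolded continuous_on_iff, rule_format, of x "1/2"] x by auto
    have "m * (f t - f s) \<le> G t - G s" if st: "s \<le> x" "x \<le> t" "t - s < d" "a \<le> s" "t \<le> b" for s t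
    proof -
      have near: "\<bar>dist z (\<gamma> u) - dist z (\<gamma> x)\<bar> < 1/2" if "u \<in> {s..t}" for u
        using d(2)[of u] that st by (auto simp: dist_real_def)
      show ?thesis
      proof (cases "dist z (\<gamma> x) \<le> 3/2")
        case True
        have "m \<le> \<rho> (\<gamma> u)" if "u \<in> {s..t}" for u
        proof -
          have "dist z (\<gamma> u) \<le> 2" using near[OF that] True by linarith
          then have "m \<le> exp (- \<epsilon> * dist z (\<gamma> u)) * \<rho> z"
            unfolding m_def using eps_pos by (intro mult_right_mono) (auto simp: rho_nonneg)
          also have "\<dots> \<le> \<rho> (\<gamma> u)" by (rule rho_harnack)
          finally show ?thesis .
        qed
        then have 1: "m * dist_len.len \<gamma> s t \<le> G t - G s"
          using st by (intro stieltjes_primitive_lower[OF G(3)]) auto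
        have "f t - f s \<le> dist (\<gamma> s) (\<gamma> t)"
          using dist_triangle[of z "\<gamma> t" "\<gamma> s"] zero_le_dist[of "\<gamma> s" "\<gamma> t"]
          unfolding f_def min_def by (auto simp del: zero_le_dist)
        also have "\<dots> \<le> dist_len.len \<gamma> s t" using st by (intro dist_len.len_ge_dist[OF fin]) auto
        finally show ?thesis using 1 \<open>m \<ge> 0\<close> by (meson mult_left_mono order_trans)
      next
        case False
        have "1 \<le> dist z (\<gamma> s)" "1 \<le> dist z (\<gamma> t)" using near[of s] near[of t] st False by (simp_all only: atLeastAtMost_iff) linarith+
        then have "f s = 1" "f t = 1" by (auto simp: f_def)
        moreover have "0 * dist_len.len \<gamma> s t \<le> G t - G s"
          using st by (intro stieltjes_primitive_lower[OF G(3)]) (auto simp: rho_nonneg)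
        ultimately show ?thesis by simp
      qed
    qed
    then show "\<exists>d>0. \<forall>s t. s \<le> x \<and> x \<le> t \<and> t - s < d \<longrightarrow> a \<le> s \<and> t \<le> b \<longrightarrow> m * (f t - f s) \<le> G t - G s"
      using d(1) by blast
  qed (auto simp: algebra_simps)
  then show "exp (- 2 * \<epsilon>) * \<rho> z * min 1 (dist z w) \<le> line_integral \<rho> \<gamma> a b"
    using G ends by (simp add: m_def f_def)
qed

section \<open>Metric and topology of the uniformized space\<close>

lemma E_zero_iff: "E x y = 0 \<longleftrightarrow> x = y"
proof
  assume "E x y = 0"
  then have "exp (- 2 * \<epsilon>) * \<rho> x * min 1 (dist x y) \<le> 0" using E_lower[of x y] by simp
  then have "min 1 (dist x y) \<le> 0"
    using mult_pos_pos[of "exp (- 2 * \<epsilon>) * \<rho> x" "min 1 (dist x y)"] rho_pos[of x]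
    by (meson exp_gt_zero linorder_not_less mult_pos_pos)
  then have "dist x y \<le> 0" by linarith
  then show "x = y" by simp
next
  assume "x = y"
  then show "E x y = 0" using E_le_dist[of x y] E_nonneg[of x y] by simp
qed

lemma E_refl [simp]: "E x x = 0"
  by (simp add: E_zero_iff)

sublocale eps: total_metric "d_eps \<epsilon> p"
proof
  show "E x y = E y x" for x y by (rule E_commute)
qed (auto simp: E_nonneg E_zero_iff intro: E_triangle)

text \<open>Contrapositive of \<open>E_lower\<close> at scale 1; it later converts
  \<open>d_eps\<close>-length into a count of unit steps in d.\<close>

lemma dist_less_1:
  assumes "E z w < exp (- 2 * \<epsilon>) * \<rho> z" shows "dist z w < 1"
proof (rule ccontr)
  assume "\<not> dist z w < 1"
  then show False using E_lower[of z w] assms by (simp add: min_def split: if_splits)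
qed

text \<open>\<open>E_le_dist\<close> gives one inclusion and \<open>E_lower\<close> the other.
  Continuity of curves and local compactness in the uniformized space can hence be checked with
  respect to d.\<close>

lemma mtopology_eps: "eps.mtopology = euclidean"
  unfolding topology_eq eps.openin_mtopology open_openin[symmetric]
proof
  fix U :: "'a set"
  show "(U \<subseteq> UNIV \<and> (\<forall>x. x \<in> U \<longrightarrow> (\<exists>r>0. eps.mball x r \<subseteq> U))) \<longleftrightarrow> open U"
  proof
    assume *: "U \<subseteq> UNIV \<and> (\<forall>x. x \<in> U \<longrightarrow> (\<exists>r>0. eps.mball x r \<subseteq> U))"
    show "open U" unfolding open_dist
    proof
      fix x assume "x \<in> U"
      then obtain r where "r > 0" "eps.mball x r \<subseteq> U" using * by blast
      moreover have "y \<in> eps.mball x r" if "dist y x < r" for y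
        using E_le_dist[of x y] that by (simp add: dist_commute)
      ultimately show "\<exists>e>0. \<forall>y. dist y x < e \<longrightarrow> y \<in> U" by blast
    qed
  next
    assume "open U"
    have "\<exists>r>0. eps.mball x r \<subseteq> U" if xU: "x \<in> U" for x
    proof -
      obtain r where r: "r > 0" "\<And>y. dist y x < r \<Longrightarrow> y \<in> U" using \<open>open U\<close> xU unfolding open_dist by blast
      let ?r = "exp (- 2 * \<epsilon>) * \<rho> x * min 1 r"
      have "dist x y < r" if "E x y < ?r" for y
      proof -
        have "exp (- 2 * \<epsilon>) * \<rho> x * min 1 (dist x y) < ?r" using E_lower[of x y] that by linarith
        then have "min 1 (dist x y) < min 1 r"
          by (rule mult_left_less_imp_less) (simp add: rho_nonneg)
        then show ?thesis by linarith
      qed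
      then have "eps.mball x ?r \<subseteq> U" using r(2) by (auto simp: dist_commute)
      moreover have "?r > 0" using rho_pos[of x] r(1) by simp
      ultimately show ?thesis by blast
    qed
    then show "U \<subseteq> UNIV \<and> (\<forall>x. x \<in> U \<longrightarrow> (\<exists>r>0. eps.mball x r \<subseteq> U))" by simp
  qed
qed

text \<open>On a piece shorter than 1, \<open>exp (\<kappa> * u)\<close> varies at most by the
  factor \<open>exp \<bar>\<kappa>\<bar>\<close>, so its supremum is compared with its value at a
  mean value point of the antiderivative. The bound is kept as a difference of values at
  \<open>t\<close> and \<open>s\<close>, the form that bisection and \<open>cl_telescope\<close>
  require. The rate \<kappa> will be \<epsilon> or -\<epsilon>.\<close>

lemma E_exp_bound:
  assumes iso: "isometric_path \<gamma> a b" and st: "a \<le> s" "s \<le> t" "t \<le> b" and "\<kappa> \<noteq> 0"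
    and B: "\<And>u. u \<in> {a..b} \<Longrightarrow> \<rho> (\<gamma> u) \<le> B * exp (\<kappa> * u)"
  shows "E (\<gamma> s) (\<gamma> t) \<le> exp \<bar>\<kappa>\<bar> * B / \<kappa> * exp (\<kappa> * t) - exp \<bar>\<kappa>\<bar> * B / \<kappa> * exp (\<kappa> * s)"
proof -
  define C where "C = exp \<bar>\<kappa>\<bar> * B / \<kappa>"
  have "0 < B * exp (\<kappa> * s)" using B[of s] rho_pos[of "\<gamma> s"] st by auto
  then have "B > 0" by (simp add: zero_less_mult_iff)
  have "s \<le> s \<and> t \<le> t \<longrightarrow> E (\<gamma> s) (\<gamma> t) \<le> C * exp (\<kappa> * t) - C * exp (\<kappa> * s)"
    using \<open>s \<le> t\<close>
  proof (rule Bolzano[where P="\<lambda>r r'. s \<le> r \<and> r' \<le> t \<longrightarrow> E (\<gamma> r) (\<gamma> r') \<le> C * exp (\<kappa> * r') - C * exp (\<kappa> * r)"])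
    fix u v w
    assume "s \<le> u \<and> v \<le> t \<longrightarrow> E (\<gamma> u) (\<gamma> v) \<le> C * exp (\<kappa> * v) - C * exp (\<kappa> * u)"
      "s \<le> v \<and> w \<le> t \<longrightarrow> E (\<gamma> v) (\<gamma> w) \<le> C * exp (\<kappa> * w) - C * exp (\<kappa> * v)" "u \<le> v" "v \<le> w"
    then show "s \<le> u \<and> w \<le> t \<longrightarrow> E (\<gamma> u) (\<gamma> w) \<le> C * exp (\<kappa> * w) - C * exp (\<kappa> * u)"
      using E_triangle[of "\<gamma> u" "\<gamma> w" "\<gamma> v"] by auto
  next
    fix x
    have "E (\<gamma> u) (\<gamma> v) \<le> C * exp (\<kappa> * v) - C * exp (\<kappa> * u)"
      if uv: "u \<le> v" "v - u < 1" "s \<le> u" "v \<le> t" for u v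
    proof (cases "u = v")
      case False
      then have "u < v" using uv by simp
      have "\<exists>z. u < z \<and> z < v \<and> C * exp (\<kappa> * v) - C * exp (\<kappa> * u) = (v - u) * (C * (exp (\<kappa> * z) * \<kappa>))"
        by (rule MVT2[OF \<open>u < v\<close>]) (auto intro!: derivative_eq_intros)
      then obtain z where z: "u < z" "z < v" "C * exp (\<kappa> * v) - C * exp (\<kappa> * u) = (v - u) * (C * (exp (\<kappa> * z) * \<kappa>))"
        by blast
      have "E (\<gamma> u) (\<gamma> v) \<le> (B * exp (\<bar>\<kappa>\<bar> + \<kappa> * z)) * (v - u)"
      proof (rule E_isometric_path)
        show "isometric_path \<gamma> u v" using isometric_path_sub[OF iso] uv st by auto
        fix r assume r: "r \<in> {u..v}"
        have "\<kappa> * (r - z) \<le> \<bar>\<kappa>\<bar> * \<bar>r - z\<bar>" by (metis abs_ge_self abs_mult)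
        also have "\<dots> \<le> \<bar>\<kappa>\<bar> * 1" using r z uv by (intro mult_left_mono) auto
        finally have "\<kappa> * r \<le> \<bar>\<kappa>\<bar> + \<kappa> * z" by (simp add: algebra_simps)
        then have "B * exp (\<kappa> * r) \<le> B * exp (\<bar>\<kappa>\<bar> + \<kappa> * z)" using \<open>B > 0\<close> by simp
        then show "\<rho> (\<gamma> r) \<le> B * exp (\<bar>\<kappa>\<bar> + \<kappa> * z)" using B[of r] r uv st by force
      qed (use uv in auto)
      also have "\<dots> = (v - u) * (C * (exp (\<kappa> * z) * \<kappa>))"
        using \<open>\<kappa> \<noteq> 0\<close> by (simp add: C_def exp_add)
      finally show ?thesis using z by simp
    qed auto
    then show "\<exists>d>0. \<forall>u v. u \<le> x \<and> x \<le> v \<and> v - u < d \<longrightarrow> s \<le> u \<and> v \<le> t \<longrightarrow>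
        E (\<gamma> u) (\<gamma> v) \<le> C * exp (\<kappa> * v) - C * exp (\<kappa> * u)"
      by (intro exI[of _ 1]) auto
  qed
  then show ?thesis by (simp add: C_def)
qed

end

subsection \<open>Geodesics in the uniformized metric\<close>

lemma gromov_product_commute: "gromov_product p x y = gromov_product p y x"
  by (simp add: gromov_product_def dist_commute)

lemma gromov_product_nonneg: "0 \<le> gromov_product p x y"
  using dist_triangle[of x y p] by (simp add: gromov_product_def dist_commute)

lemma gromov_product_ge: "dist p x - dist x y \<le> gromov_product p x y"
  using dist_triangle[of p x y] by (simp add: gromov_product_def dist_commute)

lemma geodesic_seg_dist:
  assumes "geodesic_seg \<gamma> x y" "t \<in> {0..dist x y}"
  shows "dist x (\<gamma> t) = t" "dist (\<gamma> t) y = dist x y - t"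
proof -
  have *: "\<gamma> 0 = x" "\<gamma> (dist x y) = y"
    "\<And>s t. s \<in> {0..dist x y} \<Longrightarrow> t \<in> {0..dist x y} \<Longrightarrow> dist (\<gamma> s) (\<gamma> t) = \<bar>s - t\<bar>"
    using assms(1) unfolding geodesic_seg_def by auto
  show "dist x (\<gamma> t) = t" using *(3)[of 0 t] assms(2) *(1) by simp
  show "dist (\<gamma> t) y = dist x y - t" using *(3)[of t "dist x y"] assms(2) *(2) by simp
qed

text \<open>The distance from \<open>p\<close> is 1-Lipschitz along the segment, seen from either
  end; the third bound is the mean of the first two.\<close>

lemma geodesic_seg_far:
  assumes "geodesic_seg \<gamma> x y" "t \<in> {0..dist x y}"
  shows "dist p x - t \<le> dist p (\<gamma> t)" "dist p y - (dist x y - t) \<le> dist p (\<gamma> t)"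
    "gromov_product p x y \<le> dist p (\<gamma> t)"
proof -
  show 1: "dist p x - t \<le> dist p (\<gamma> t)"
    using dist_triangle[of p x "\<gamma> t"] geodesic_seg_dist(1)[OF assms] by (simp add: dist_commute)
  show 2: "dist p y - (dist x y - t) \<le> dist p (\<gamma> t)"
    using dist_triangle[of p y "\<gamma> t"] geodesic_seg_dist(2)[OF assms] by simp
  show "gromov_product p x y \<le> dist p (\<gamma> t)"
    using 1 2 by (simp add: gromov_product_def)
qed

lemma geodesic_ray_dist:
  assumes "geodesic_ray \<gamma> q" "0 \<le> t"
  shows "dist q (\<gamma> t) = t"
proof -
  have "dist (\<gamma> 0) (\<gamma> t) = \<bar>0 - t\<bar>" using assms unfolding geodesic_ray_def by blast
  then show ?thesis using assms by (simp add: geodesic_ray_def)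
qed

context uniformization
begin

abbreviation gp :: "'a \<Rightarrow> 'a \<Rightarrow> real" where "gp \<equiv> gromov_product p"

text \<open>The factor \<open>exp \<bar>\<kappa>\<bar> / \<bar>\<kappa>\<bar>\<close> of
  \<open>E_exp_bound\<close> at the rates \<epsilon> and -\<epsilon>.\<close>

definition K :: real where "K = exp \<epsilon> / \<epsilon>"

lemma K_pos: "0 < K"
  using eps_pos by (simp add: K_def)

text \<open>The weight at parameter \<open>u\<close> is at most
  \<open>exp (- \<epsilon> * (dist p x - u))\<close>, which grows exponentially towards
  \<open>t\<close>, so its integral is dominated by the value at \<open>t\<close>. The bound is
  meant for \<open>t\<close> up to the foot of \<open>gromov_foot\<close>.\<close>

lemma geodesic_length_left:
  assumes seg: "geodesic_seg \<gamma> x y" and t: "t \<in> {0..dist x y}"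
  shows "eps.cl \<gamma> 0 t \<le> ereal (K * exp (- \<epsilon> * (dist p x - t)))"
proof -
  define B where "B = exp (- \<epsilon> * dist p x)"
  have "eps.cl \<gamma> 0 t \<le> ereal (exp \<bar>\<epsilon>\<bar> * B / \<epsilon> * exp (\<epsilon> * t) - exp \<bar>\<epsilon>\<bar> * B / \<epsilon> * exp (\<epsilon> * 0))"
  proof (rule eps.cl_telescope)
    fix s s' assume s: "0 \<le> s" "s \<le> s'" "s' \<le> t"
    show "E (\<gamma> s) (\<gamma> s') \<le> exp \<bar>\<epsilon>\<bar> * B / \<epsilon> * exp (\<epsilon> * s') - exp \<bar>\<epsilon>\<bar> * B / \<epsilon> * exp (\<epsilon> * s)"
    proof (rule E_exp_bound[OF geodesic_seg_isometric[OF seg]])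
      fix u assume u: "u \<in> {0..dist x y}"
      show "\<rho> (\<gamma> u) \<le> B * exp (\<epsilon> * u)"
        using rho_le_exp[OF geodesic_seg_far(1)[OF seg u, of p]]
        by (simp add: B_def algebra_simps flip: exp_add)
    qed (use s t eps_pos in auto)
  qed
  also have "\<dots> \<le> ereal (exp \<bar>\<epsilon>\<bar> * B / \<epsilon> * exp (\<epsilon> * t))"
    using eps_pos by (simp add: B_def)
  also have "exp \<bar>\<epsilon>\<bar> * B / \<epsilon> * exp (\<epsilon> * t) = K * exp (- \<epsilon> * (dist p x - t))"
    using eps_pos by (simp add: B_def K_def algebra_simps flip: exp_add)
  finally show ?thesis .
qed

lemma geodesic_length_right:
  assumes seg: "geodesic_seg \<gamma> x y" and t: "t \<in> {0..dist x y}"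
  shows "eps.cl \<gamma> t (dist x y) \<le> ereal (K * exp (- \<epsilon> * (dist p y - (dist x y - t))))"
proof -
  define B where "B = exp (- \<epsilon> * (dist p y - dist x y))"
  let ?C = "exp \<bar>- \<epsilon>\<bar> * B / - \<epsilon>"
  have "eps.cl \<gamma> t (dist x y) \<le> ereal (?C * exp (- \<epsilon> * dist x y) - ?C * exp (- \<epsilon> * t))"
  proof (rule eps.cl_telescope)
    fix s s' assume s: "t \<le> s" "s \<le> s'" "s' \<le> dist x y"
    show "E (\<gamma> s) (\<gamma> s') \<le> ?C * exp (- \<epsilon> * s') - ?C * exp (- \<epsilon> * s)"
    proof (rule E_exp_bound[OF geodesic_seg_isometric[OF seg]])
      fix u assume u: "u \<in> {0..dist x y}"
      show "\<rho> (\<gamma> u) \<le> B * exp (- \<epsilon> * u)"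
        using rho_le_exp[OF geodesic_seg_far(2)[OF seg u, of p]]
        by (simp add: B_def algebra_simps flip: exp_add)
    qed (use s t eps_pos in auto)
  qed
  also have "\<dots> \<le> ereal (- (?C * exp (- \<epsilon> * t)))"
    using eps_pos by (simp add: B_def)
  also have "- (?C * exp (- \<epsilon> * t)) = K * exp (- \<epsilon> * (dist p y - (dist x y - t)))"
    using eps_pos by (simp add: B_def K_def algebra_simps flip: exp_add)
  finally show ?thesis .
qed

text \<open>The parameter at which the two linear bounds of \<open>geodesic_seg_far\<close> agree,
  that is, the branch point of the comparison tripod of \<open>p\<close>, \<open>x\<close> and
  \<open>y\<close>.\<close>

lemma gromov_foot:
  fixes x y
  defines "t0 \<equiv> dist p x - gp x y"
  shows "t0 \<in> {0..dist x y}" "dist p x - t0 = gp x y" "dist p y - (dist x y - t0) = gp x y"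
  using dist_triangle[of p x y] dist_triangle[of p y x] dist_triangle[of x y p]
  by (auto simp: t0_def gromov_product_def dist_commute field_simps)

text \<open>Splitting at the foot gives the first bound, which suits distant endpoints; the second
  integrates a constant bound on the weight and suits nearby ones.\<close>

lemma geodesic_length_upper:
  assumes seg: "geodesic_seg \<gamma> x y"
  shows "eps.cl \<gamma> 0 (dist x y) \<le> ereal (2 * K * exp (- \<epsilon> * gp x y))"
    "eps.cl \<gamma> 0 (dist x y) \<le> ereal (exp (- \<epsilon> * gp x y) * dist x y)"
proof -
  let ?t = "dist p x - gp x y"
  note foot = gromov_foot[where x=x and y=y]
  have "eps.cl \<gamma> 0 (dist x y) = eps.cl \<gamma> 0 ?t + eps.cl \<gamma> ?t (dist x y)"
    using foot(1) by (intro eps.cl_add) auto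
  also have "\<dots> \<le> ereal (K * exp (- \<epsilon> * gp x y)) + ereal (K * exp (- \<epsilon> * gp x y))"
    using geodesic_length_left[OF seg foot(1)] geodesic_length_right[OF seg foot(1)]
    unfolding foot(2,3) by (rule add_mono)
  finally show "eps.cl \<gamma> 0 (dist x y) \<le> ereal (2 * K * exp (- \<epsilon> * gp x y))" by (simp add: mult.assoc)
  have "eps.cl \<gamma> 0 (dist x y) \<le> ereal (exp (- \<epsilon> * gp x y) * dist x y - exp (- \<epsilon> * gp x y) * 0)"
  proof (rule eps.cl_telescope)
    fix s t assume st: "0 \<le> s" "s \<le> t" "t \<le> dist x y"
    have "E (\<gamma> s) (\<gamma> t) \<le> exp (- \<epsilon> * gp x y) * (t - s)"
    proof (rule E_isometric_path)
      show "isometric_path \<gamma> s t"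
        using isometric_path_sub[OF geodesic_seg_isometric[OF seg]] st by auto
      fix u assume "u \<in> {s..t}"
      then show "\<rho> (\<gamma> u) \<le> exp (- \<epsilon> * gp x y)"
        using st by (intro rho_le_exp geodesic_seg_far(3)[OF seg]) auto
    qed (use st in auto)
    then show "E (\<gamma> s) (\<gamma> t) \<le> exp (- \<epsilon> * gp x y) * t - exp (- \<epsilon> * gp x y) * s"
      by (simp add: algebra_simps)
  qed
  then show "eps.cl \<gamma> 0 (dist x y) \<le> ereal (exp (- \<epsilon> * gp x y) * dist x y)" by simp
qed

lemma E_le_gp: "E x y \<le> 2 * K * exp (- \<epsilon> * gp x y)"
proof -
  obtain \<gamma> where seg: "geodesic_seg \<gamma> x y" using geodesic by blast
  have "ereal (E x y) \<le> eps.cl \<gamma> 0 (dist x y)"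
    using eps.cl_ge_dist[of 0 "dist x y" \<gamma>] seg by (simp add: geodesic_seg_def)
  also have "\<dots> \<le> ereal (2 * K * exp (- \<epsilon> * gp x y))" by (rule geodesic_length_upper[OF seg])
  finally show ?thesis by simp
qed

text \<open>The starting point \<open>q\<close> is arbitrary because the centre of rough
  starlikeness may differ from \<open>p\<close>; the factor
  \<open>exp (\<epsilon> * dist p q)\<close> is the price of changing the base point.\<close>

lemma E_ray_le:
  assumes ray: "geodesic_ray \<eta> q" and st: "0 \<le> s" "s \<le> t"
  shows "E (\<eta> s) (\<eta> t) \<le> K * exp (\<epsilon> * dist p q) * exp (- \<epsilon> * s)"
proof -
  let ?C = "exp \<bar>- \<epsilon>\<bar> * exp (\<epsilon> * dist p q) / - \<epsilon>"
  have "E (\<eta> s) (\<eta> t) \<le> ?C * exp (- \<epsilon> * t) - ?C * exp (- \<epsilon> * s)"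
  proof (rule E_exp_bound[OF geodesic_ray_isometric[OF ray]])
    fix u assume u: "u \<in> {0..t}"
    have "u - dist p q \<le> dist p (\<eta> u)"
      using dist_triangle[of q "\<eta> u" p] geodesic_ray_dist[OF ray, of u] u by (simp add: dist_commute)
    from rho_le_exp[OF this] show "\<rho> (\<eta> u) \<le> exp (\<epsilon> * dist p q) * exp (- \<epsilon> * u)"
      by (simp add: algebra_simps flip: exp_add)
  qed (use st eps_pos in auto)
  also have "\<dots> \<le> - (?C * exp (- \<epsilon> * s))" using eps_pos by simp
  also have "\<dots> = K * exp (\<epsilon> * dist p q) * exp (- \<epsilon> * s)" using eps_pos by (simp add: K_def)
  finally show ?thesis .
qed

end

locale hyperbolic_uniformization = uniformization \<epsilon> p
  for \<epsilon> :: real and p :: "'a::metric_space" +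
  fixes \<delta> :: real
  assumes delta_nonneg: "\<delta> \<ge> 0"
    and hyperbolic: "\<And>x y z. min (gromov_product p x y) (gromov_product p y z) - \<delta> \<le> gromov_product p x z"
    and proper: "\<And>(x::'a) r. compact (cball x r)"
    and unbounded: "\<not> bounded (UNIV :: 'a set)"
begin

text \<open>For the foot \<open>m\<close> both \<open>gp x m\<close> and \<open>gp m y\<close> equal
  half of \<open>gp x y + dist p m\<close>; hyperbolicity applied to \<open>x\<close>,
  \<open>m\<close>, \<open>y\<close> then bounds \<open>dist p m\<close>.\<close>

lemma geodesic_foot_near:
  assumes seg: "geodesic_seg \<gamma> x y"
  shows "dist p (\<gamma> (dist p x - gp x y)) \<le> gp x y + 2 * \<delta>"
proof -
  let ?t = "dist p x - gp x y" and ?m = "\<gamma> (dist p x - gp x y)"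
  note foot = gromov_foot[where x=x and y=y]
  have "gp x ?m = (gp x y + dist p ?m) / 2" "gp ?m y = (gp x y + dist p ?m) / 2"
    using geodesic_seg_dist[OF seg foot(1)] foot(2,3) by (auto simp: gromov_product_def field_simps)
  then show ?thesis using hyperbolic[of x ?m y] by (simp add: min_def field_simps)
qed

lemma geodesic_near:
  assumes seg: "geodesic_seg \<gamma> x y" and t: "t \<in> {0..dist x y}"
  shows "t \<le> dist p x - gp x y \<Longrightarrow> dist p (\<gamma> t) \<le> dist p x - t + 2 * \<delta>"
    "dist p x - gp x y \<le> t \<Longrightarrow> dist p (\<gamma> t) \<le> dist p y - (dist x y - t) + 2 * \<delta>"
proof -
  let ?t = "dist p x - gp x y"
  note foot = gromov_foot[where x=x and y=y]
  have "dist (\<gamma> ?t) (\<gamma> t) = \<bar>?t - t\<bar>"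
    using geodesic_seg_isometric[OF seg] foot(1) t unfolding isometric_path_def by blast
  then have "dist p (\<gamma> t) \<le> gp x y + 2 * \<delta> + \<bar>?t - t\<bar>"
    using dist_triangle[of p "\<gamma> t" "\<gamma> ?t"] geodesic_foot_near[OF seg] by linarith
  then show "t \<le> ?t \<Longrightarrow> dist p (\<gamma> t) \<le> dist p x - t + 2 * \<delta>"
    "?t \<le> t \<Longrightarrow> dist p (\<gamma> t) \<le> dist p y - (dist x y - t) + 2 * \<delta>"
    using foot(2,3) by auto
qed

text \<open>\<open>exp (- 2 * \<epsilon>)\<close> comes from \<open>E_lower\<close>,
  \<open>exp (- 2 * \<epsilon> * \<delta>)\<close> from the height of the foot, at most
  \<open>gp x y + 2 * \<delta>\<close>, and the half from dividing \<open>min 1 (dist x y)\<close>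
  between the two sides of the foot.\<close>

definition c1 :: real where "c1 = exp (- 2 * \<epsilon> - 2 * \<epsilon> * \<delta>) / 2"

lemma c1_pos: "0 < c1" by (simp add: c1_def)

text \<open>The two chords through the foot suffice: up to a constant the weight is largest there,
  and \<open>E_lower\<close> is applied at that point.\<close>

lemma geodesic_length_lower:
  assumes seg: "geodesic_seg \<gamma> x y"
  shows "ereal (c1 * exp (- \<epsilon> * gp x y) * min 1 (dist x y)) \<le> eps.cl \<gamma> 0 (dist x y)"
proof -
  let ?t = "dist p x - gp x y"
  let ?m = "\<gamma> ?t"
  note foot = gromov_foot[where x=x and y=y]
  have "exp (- \<epsilon> * (gp x y + 2 * \<delta>)) \<le> \<rho> ?m" by (rule rho_ge_exp[OF geodesic_foot_near[OF seg]])
  then have c: "2 * c1 * exp (- \<epsilon> * gp x y) \<le> exp (- 2 * \<epsilon>) * \<rho> ?m"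
    by (simp add: c1_def algebra_simps exp_add exp_diff exp_minus divide_simps)
  have "E ?m x + E ?m y \<ge> exp (- 2 * \<epsilon>) * \<rho> ?m * (min 1 (dist ?m x) + min 1 (dist ?m y))"
    using E_lower[of ?m x] E_lower[of ?m y] by (simp only: distrib_left)
  moreover have "exp (- 2 * \<epsilon>) * \<rho> ?m * (min 1 (dist ?m x) + min 1 (dist ?m y))
      \<ge> (2 * c1 * exp (- \<epsilon> * gp x y)) * (1/2 * min 1 (dist x y))"
  proof (rule mult_mono[OF c])
    have "dist x y \<le> dist ?m x + dist ?m y" using dist_triangle2[of x y ?m] by (simp add: dist_commute)
    then show "1/2 * min 1 (dist x y) \<le> min 1 (dist ?m x) + min 1 (dist ?m y)"
      by (auto simp: min_def) (smt (verit) zero_le_dist)+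
  qed (auto simp: rho_nonneg)
  ultimately have "c1 * exp (- \<epsilon> * gp x y) * min 1 (dist x y) \<le> E x ?m + E ?m y"
    by (simp add: E_commute)
  then have "ereal (c1 * exp (- \<epsilon> * gp x y) * min 1 (dist x y)) \<le> ereal (E x ?m) + ereal (E ?m y)" by simp
  also have "\<dots> \<le> eps.cl \<gamma> 0 ?t + eps.cl \<gamma> ?t (dist x y)"
    using eps.cl_ge_dist[of 0 ?t \<gamma>] eps.cl_ge_dist[of ?t "dist x y" \<gamma>] foot(1) seg
    by (intro add_mono) (auto simp: geodesic_seg_def)
  also have "\<dots> = eps.cl \<gamma> 0 (dist x y)"
    using foot(1) by (intro eps.cl_add[symmetric]) auto
  finally show ?thesis .
qed

definition separated :: "real \<Rightarrow> 'a \<Rightarrow> 'a \<Rightarrow> bool" where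
  "separated c x y \<longleftrightarrow> c * exp (- \<epsilon> * gp x y) * min 1 (dist x y) \<le> E x y"

lemma separated_mono: "separated c x y \<Longrightarrow> c' \<le> c \<Longrightarrow> separated c' x y"
  unfolding separated_def by (smt (verit) mult_right_mono exp_ge_zero zero_le_dist mult_nonneg_nonneg)

lemma separated_of_geodesic_length:
  assumes "geodesic_seg \<gamma> x y" "eps.cl \<gamma> 0 (dist x y) \<le> ereal (C * E x y)" "C > 0"
  shows "separated (c1 / C) x y"
  using geodesic_length_lower[OF assms(1)] assms(2,3) unfolding separated_def
  by (simp add: field_simps) (metis ereal_less_eq(3) order_trans mult.commute)

lemma geodesic_length_of_separated:
  assumes seg: "geodesic_seg \<gamma> x y" and sep: "separated c x y" and "c > 0"
  shows "eps.cl \<gamma> 0 (dist x y) \<le> ereal (max 1 (2 * K) / c * E x y)"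
proof -
  let ?e = "exp (- \<epsilon> * gp x y)"
  have "eps.cl \<gamma> 0 (dist x y) \<le> ereal (?e * (max 1 (2 * K) * min 1 (dist x y)))"
  proof (cases "dist x y \<le> 1")
    case True
    have "eps.cl \<gamma> 0 (dist x y) \<le> ereal (?e * dist x y)" by (rule geodesic_length_upper[OF seg])
    also have "dist x y \<le> max 1 (2 * K) * min 1 (dist x y)"
      using True mult_right_mono[of 1 "max 1 (2 * K)" "dist x y"] by simp
    finally show ?thesis by simp
  next
    case False
    have "eps.cl \<gamma> 0 (dist x y) \<le> ereal (2 * K * ?e)" by (rule geodesic_length_upper[OF seg])
    also have "\<dots> \<le> ereal (?e * (max 1 (2 * K) * min 1 (dist x y)))"
      using False by simp
    finally show ?thesis .
  qed
  also have "?e * (max 1 (2 * K) * min 1 (dist x y)) = max 1 (2 * K) / c * (c * ?e * min 1 (dist x y))"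
    using \<open>c > 0\<close> by simp
  also have "\<dots> \<le> max 1 (2 * K) / c * E x y"
    using sep \<open>c > 0\<close> unfolding separated_def by (intro mult_left_mono) auto
  finally show ?thesis by simp
qed

text \<open>At distance at most \<open>R\<close> the Gromov product is \<open>dist p x\<close> up to
  an error \<open>R\<close>, so the local bound \<open>E_lower\<close> at \<open>x\<close> already
  has the right size.\<close>

lemma separated_near:
  assumes "dist x y \<le> R" shows "separated (exp (- 2 * \<epsilon> - \<epsilon> * R)) x y"
proof -
  have "dist p x \<le> gp x y + R" using gromov_product_ge[of p x y] assms by simp
  then have "exp (- \<epsilon> * (gp x y + R)) \<le> \<rho> x" by (rule rho_ge_exp)
  then have "exp (- 2 * \<epsilon>) * exp (- \<epsilon> * (gp x y + R)) * min 1 (dist x y) \<le> exp (- 2 * \<epsilon>) * \<rho> x * min 1 (dist x y)"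
    by (intro mult_right_mono mult_left_mono) auto
  also have "\<dots> \<le> E x y" by (rule E_lower)
  also have "exp (- 2 * \<epsilon>) * exp (- \<epsilon> * (gp x y + R)) = exp (- 2 * \<epsilon> - \<epsilon> * R) * exp (- \<epsilon> * gp x y)"
    by (simp add: algebra_simps flip: exp_add)
  finally show ?thesis by (simp only: separated_def)
qed

lemma GH_theorem_iff: "GH_theorem \<epsilon> p \<longleftrightarrow> (\<exists>c>0. \<forall>x y. separated c x y)"
proof
  assume "GH_theorem \<epsilon> p"
  then obtain A where A: "A > 0" "\<And>x y \<gamma>. geodesic_seg \<gamma> x y \<Longrightarrow> eps.cl \<gamma> 0 (dist x y) \<le> ereal (A * E x y)"
    unfolding GH_theorem_def by blast
  then have "separated (c1 / A) x y" for x y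
    using geodesic[of x y] separated_of_geodesic_length by blast
  then show "\<exists>c>0. \<forall>x y. separated c x y" using A(1) c1_pos by (meson divide_pos_pos)
next
  assume "\<exists>c>0. \<forall>x y. separated c x y"
  then obtain c where "c > 0" "\<And>x y. separated c x y" by blast
  then show "GH_theorem \<epsilon> p"
    unfolding GH_theorem_def
    using geodesic_length_of_separated by (intro exI[of _ "max 1 (2 * K) / c"]) (simp del: times_divide_eq_left)
qed

end

subsection \<open>Rays and boundary points\<close>

text \<open>Tychonoff's theorem for the product of the \<open>S t\<close>: a cluster point in the
  product topology is approached at finitely many parameters at once. This is enough for a limit of
  geodesics, since the isometry identity involves two parameters.\<close>

lemma compact_pointwise_cluster:
  fixes f :: "nat \<Rightarrow> 'b \<Rightarrow> 'a::metric_space"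
  assumes "\<And>t. compact (S t)" and "\<And>n t. f n t \<in> S t"
  shows "\<exists>g. (\<forall>t. g t \<in> S t) \<and>
    (\<forall>T e N. finite T \<longrightarrow> e > 0 \<longrightarrow> (\<exists>n\<ge>N. \<forall>t\<in>T. dist (f n t) (g t) < e))"
proof -
  have "compactin (product_topology (\<lambda>_. euclidean) UNIV) (PiE UNIV S)"
    unfolding compactin_PiE using assms(1) by simp
  then have "compact (PiE UNIV S)"
    by (simp add: euclidean_product_topology)
  moreover have "filtermap f sequentially \<noteq> bot" by (simp add: filtermap_bot_iff)
  moreover have "eventually (\<lambda>h. h \<in> PiE UNIV S) (filtermap f sequentially)"
    using assms(2) by (auto simp: eventually_filtermap PiE_UNIV_domain)
  ultimately obtain g where g: "g \<in> PiE UNIV S" "inf (nhds g) (filtermap f sequentially) \<noteq> bot"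
    unfolding compact_filter by blast
  have "\<exists>n\<ge>N. \<forall>t\<in>T. dist (f n t) (g t) < e" if "finite T" "e > 0" for T e N
  proof (rule ccontr)
    assume neg: "\<not> ?thesis"
    define U where "U = (\<Inter>t\<in>T. {h. dist (h t) (g t) < e})"
    have "open {h. dist (h t) (g t) < e}" for t
      by (intro open_Collect_less continuous_intros continuous_on_product_coordinates)
    then have "open U" unfolding U_def using \<open>finite T\<close> by (intro open_INT) auto
    moreover have "g \<in> U" using \<open>e > 0\<close> by (simp add: U_def)
    ultimately have "eventually (\<lambda>h. h \<in> U) (nhds g)" by (rule eventually_nhds_in_open)
    moreover have "eventually (\<lambda>h. h \<notin> U) (filtermap f sequentially)"
      unfolding eventually_filtermap eventually_sequentially using neg by (auto simp: U_def)
    ultimately have "eventually (\<lambda>_. False) (inf (nhds g) (filtermap f sequentially))"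
      unfolding eventually_inf by blast
    then show False using g(2) by (simp add: eventually_False)
  qed
  moreover have "g t \<in> S t" for t using g(1) by auto
  ultimately show ?thesis by blast
qed

lemma strict_mono_choice:
  assumes "\<And>(k::nat) N. \<exists>n\<ge>N. P k (n::nat)"
  shows "\<exists>r. strict_mono r \<and> (\<forall>k. P k (r k))"
proof -
  have "\<exists>r. \<forall>k. P k (r k) \<and> r k < r (Suc k)"
    by (rule dependent_nat_choice) (use assms Suc_le_eq in \<open>metis+\<close>)
  then show ?thesis by (metis strict_mono_Suc_iff)
qed

lemma filterlim_real_shift: "filterlim (\<lambda>n. real n - c) at_top sequentially"
  using filterlim_tendsto_add_at_top[OF tendsto_const[of "- c"] filterlim_real_sequentially] by simp

context hyperbolic_uniformization
begin

text \<open>The ray is a cluster point of geodesics from \<open>p\<close> to the \<open>x n\<close>.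
  The index \<open>r k\<close> is chosen so that the geodesic to \<open>x (r k)\<close> passes
  within 1 of \<open>\<gamma> k\<close>; hyperbolicity is used twice to get from
  \<open>x (r k)\<close> over this passage to \<open>\<gamma> t\<close>, whence the loss
  \<open>1 + 2 * \<delta>\<close>.\<close>

lemma ray_subsequence:
  assumes inf: "filterlim (\<lambda>n. dist p (x n)) at_top sequentially"
  shows "\<exists>\<gamma> r. geodesic_ray \<gamma> p \<and> strict_mono r \<and>
    (\<forall>k t. real k \<le> t \<longrightarrow> real k - 1 - 2 * \<delta> \<le> gp (x (r k)) (\<gamma> t))"
proof -
  have "\<forall>n. \<exists>g. geodesic_seg g p (x n)" using geodesic by blast
  from choice[OF this] obtain g where g: "\<And>n. geodesic_seg (g n) p (x n)" by blast
  \<comment> \<open>Clamping the parameter makes \<open>f n\<close> total, with \<open>f n t\<close>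
    in the compact ball of radius \<open>\<bar>t\<bar>\<close>; at a given \<open>t \<ge> 0\<close>
    it has no effect once \<open>n\<close> is large.\<close>
  define f where "f n t = g n (max 0 (min t (dist p (x n))))" for n t
  have f_seg: "f n t = g n t" if "0 \<le> t" "t \<le> dist p (x n)" for n t
    using that by (simp add: f_def)
  have f_in: "f n t \<in> cball p \<bar>t\<bar>" for n t
    using geodesic_seg_dist(1)[OF g, of "max 0 (min t (dist p (x n)))" n] by (auto simp: f_def)
  obtain \<gamma> where \<gamma>: "\<And>t. \<gamma> t \<in> cball p \<bar>t\<bar>"
    and near: "\<And>T e N. finite T \<Longrightarrow> e > 0 \<Longrightarrow> \<exists>n\<ge>N. \<forall>t\<in>T. dist (f n t) (\<gamma> t) < e"
    using compact_pointwise_cluster[of "\<lambda>t. cball p \<bar>t\<bar>" f, OF proper f_in] by blast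
  have big: "\<exists>N. \<forall>n\<ge>N. R \<le> dist p (x n)" for R
    using inf by (simp add: filterlim_at_top eventually_sequentially)
  have iso: "dist (\<gamma> s) (\<gamma> t) = \<bar>s - t\<bar>" if "s \<ge> 0" "t \<ge> 0" for s t
  proof -
    have "\<bar>dist (\<gamma> s) (\<gamma> t) - \<bar>s - t\<bar>\<bar> \<le> 0"
    proof (rule field_le_epsilon)
      fix e :: real assume "e > 0"
      obtain N where N: "\<And>n. n \<ge> N \<Longrightarrow> max s t \<le> dist p (x n)" using big by blast
      obtain n where n: "n \<ge> N" "dist (f n s) (\<gamma> s) < e/2" "dist (f n t) (\<gamma> t) < e/2"
        using near[of "{s, t}" "e/2" N] \<open>e > 0\<close> by auto
      have "dist (f n s) (f n t) = \<bar>s - t\<bar>"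
        using N[OF n(1)] that geodesic_seg_isometric[OF g, of n] unfolding isometric_path_def
        by (simp add: f_seg)
      then show "\<bar>dist (\<gamma> s) (\<gamma> t) - \<bar>s - t\<bar>\<bar> \<le> 0 + e"
        using n(2,3) dist_triangle[of "\<gamma> s" "\<gamma> t" "f n s"] dist_triangle[of "f n s" "\<gamma> t" "f n t"]
          dist_triangle[of "f n s" "f n t" "\<gamma> s"] dist_triangle[of "\<gamma> s" "f n t" "\<gamma> t"]
        by (simp add: dist_commute)
    qed
    then show ?thesis by simp
  qed
  have ray: "geodesic_ray \<gamma> p"
    unfolding geodesic_ray_def using iso \<gamma>[of 0] by simp
  have "\<exists>n\<ge>N. real k \<le> dist p (x n) \<and> dist (f n k) (\<gamma> k) < 1" for k N
  proof -
    obtain N' where N': "\<And>n. n \<ge> N' \<Longrightarrow> real k \<le> dist p (x n)" using big by blast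
    obtain n where "n \<ge> max N N'" "dist (f n k) (\<gamma> k) < 1"
      using near[of "{real k}" 1 "max N N'"] by auto
    then show ?thesis using N' by auto
  qed
  then obtain r where r: "strict_mono r" "\<And>k. real k \<le> dist p (x (r k)) \<and> dist (f (r k) k) (\<gamma> k) < 1"
    using strict_mono_choice[of "\<lambda>k n. real k \<le> dist p (x n) \<and> dist (f n k) (\<gamma> k) < 1"] by blast
  have "real k - 1 - 2 * \<delta> \<le> gp (x (r k)) (\<gamma> t)" if "real k \<le> t" for k t
  proof -
    let ?x = "x (r k)" and ?q = "f (r k) k"
    have k: "real k \<in> {0..dist p ?x}" using r(2) by simp
    have q: "dist p ?q = k" "dist ?q ?x = dist p ?x - k"
      using geodesic_seg_dist[OF g k] r(2) f_seg by auto
    have rk: "dist p (\<gamma> k) = k" "dist p (\<gamma> t) = t" using geodesic_ray_dist[OF ray] that by auto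
    have "gp ?x ?q = k" using q by (simp add: gromov_product_def dist_commute)
    moreover have "gp ?q (\<gamma> k) \<ge> real k - 1" using q(1) rk(1) r(2)[of k] by (simp add: gromov_product_def)
    moreover have "gp (\<gamma> k) (\<gamma> t) = k" using rk iso[of k t] that by (simp add: gromov_product_def)
    ultimately show ?thesis using hyperbolic[of ?x ?q "\<gamma> k"] hyperbolic[of ?x "\<gamma> k" "\<gamma> t"] delta_nonneg
      by linarith
  qed
  with ray r(1) show ?thesis by blast
qed

section \<open>Boundary sequences and rays\<close>

abbreviation close :: "(nat \<Rightarrow> 'a) \<Rightarrow> (nat \<Rightarrow> 'a) \<Rightarrow> bool" where
  "close s t \<equiv> (\<lambda>n. E (s n) (t n)) \<longlonglongrightarrow> 0"

lemma close_iff: "close s t \<longleftrightarrow> (\<forall>e>0. \<exists>N. \<forall>n\<ge>N. E (s n) (t n) < e)"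
  by (auto simp: LIMSEQ_iff E_nonneg)

lemma close_le:
  assumes "\<And>n. E (s n) (t n) \<le> f n" "f \<longlonglongrightarrow> 0" shows "close s t"
  by (rule tendsto_sandwich[OF _ _ tendsto_const assms(2)]) (auto simp: E_nonneg assms(1))

lemma close_sym: "close s t \<Longrightarrow> close t s"
  by (simp add: E_commute)

lemma close_trans:
  assumes "close s t" "close t u" shows "close s u"
proof (rule close_le)
  show "(\<lambda>n. E (s n) (t n) + E (t n) (u n)) \<longlonglongrightarrow> 0" using tendsto_add[OF assms] by simp
qed (rule E_triangle)

lemma eps_Cauchy_close:
  assumes "eps_Cauchy \<epsilon> p s" "close s t" shows "eps_Cauchy \<epsilon> p t"
  unfolding eps_Cauchy_def
proof (intro allI impI)
  fix e :: real assume "e > 0"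
  then have "e / 3 > 0" by simp
  obtain N1 where N1: "\<And>m n. m \<ge> N1 \<Longrightarrow> n \<ge> N1 \<Longrightarrow> E (s m) (s n) < e/3"
    using assms(1) \<open>e/3 > 0\<close> unfolding eps_Cauchy_def by blast
  obtain N2 where N2: "\<And>n. n \<ge> N2 \<Longrightarrow> E (s n) (t n) < e/3"
    using assms(2) \<open>e/3 > 0\<close> unfolding close_iff by blast
  have "E (t m) (t n) < e" if "m \<ge> max N1 N2" "n \<ge> max N1 N2" for m n
    using E_triangle[of "t m" "t n" "s m"] E_triangle[of "s m" "t n" "s n"] N1[of m n] N2[of m] N2[of n] that
      E_commute[of "t m" "s m"]
    by auto
  then show "\<exists>N. \<forall>m\<ge>N. \<forall>n\<ge>N. E (t m) (t n) < e" by blast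
qed

lemma boundary_seq_close:
  assumes "boundary_seq \<epsilon> p s" "close s t" shows "boundary_seq \<epsilon> p t"
  using assms eps_Cauchy_close close_trans[of s t "\<lambda>_. _"]
  unfolding boundary_seq_def eps_convergent_def by blast

lemma eps_Cauchy_subseq_close:
  assumes "eps_Cauchy \<epsilon> p s" "strict_mono r" shows "close s (s \<circ> r)"
  unfolding close_iff
proof (intro allI impI)
  fix e :: real assume "e > 0"
  then obtain N where "\<And>m n. m \<ge> N \<Longrightarrow> n \<ge> N \<Longrightarrow> E (s m) (s n) < e"
    using assms(1) unfolding eps_Cauchy_def by blast
  moreover have "n \<le> r n" for n using assms(2) by (rule seq_suble)
  ultimately show "\<exists>N. \<forall>n\<ge>N. E (s n) ((s \<circ> r) n) < e" by (metis comp_apply order_trans)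
qed

text \<open>Otherwise properness yields a subsequence converging in d, hence in the smaller
  \<open>d_eps\<close>, and a Cauchy sequence follows its subsequence to that limit in X.\<close>

lemma boundary_seq_unbounded:
  assumes "boundary_seq \<epsilon> p s"
  shows "filterlim (\<lambda>n. dist p (s n)) at_top sequentially"
proof (rule ccontr)
  assume "\<not> ?thesis"
  then obtain R where "\<not> eventually (\<lambda>n. R \<le> dist p (s n)) sequentially"
    unfolding filterlim_at_top by blast
  then have R: "\<exists>n\<ge>N. dist p (s n) \<le> R" for N
    unfolding eventually_sequentially by (meson linear)
  obtain r :: "nat \<Rightarrow> nat" where r: "strict_mono r" "\<And>k. dist p (s (r k)) \<le> R"
    using strict_mono_choice[of "\<lambda>k n. dist p (s n) \<le> R", OF R] by blast
  then have "(s \<circ> r) n \<in> cball p R" for n by simp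
  from proper[of p R, unfolded compact_eq_seq_compact_metric seq_compact_def, rule_format, of "s \<circ> r", OF this]
  obtain l r' where r': "strict_mono r'" "((s \<circ> r) \<circ> r') \<longlonglongrightarrow> l" by blast
  have "close (s \<circ> (r \<circ> r')) (\<lambda>_. l)"
  proof (rule close_le[of "s \<circ> (r \<circ> r')" "\<lambda>_. l" "\<lambda>n. dist ((s \<circ> r \<circ> r') n) l"])
    show "E ((s \<circ> (r \<circ> r')) n) l \<le> dist ((s \<circ> r \<circ> r') n) l" for n by (simp add: E_le_dist)
    show "(\<lambda>n. dist ((s \<circ> r \<circ> r') n) l) \<longlonglongrightarrow> 0" using r'(2) tendsto_dist_iff by blast
  qed
  moreover have "close s (s \<circ> (r \<circ> r'))"
    using assms strict_mono_o[OF r(1) r'(1)] eps_Cauchy_subseq_close[of s "r \<circ> r'"] by (simp add: boundary_seq_def)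
  ultimately have "close s (\<lambda>_. l)" using close_trans[of s "s \<circ> (r \<circ> r')" "\<lambda>_. l"] by simp
  then show False using assms by (auto simp: boundary_seq_def eps_convergent_def)
qed

lemma exp_tendsto_0:
  assumes "filterlim f at_top sequentially" shows "(\<lambda>n. C * exp (- \<epsilon> * f n)) \<longlonglongrightarrow> 0"
proof -
  have "filterlim (\<lambda>n. \<epsilon> * f n) at_top sequentially"
    using assms eps_pos by (intro filterlim_tendsto_pos_mult_at_top[OF tendsto_const]) auto
  then have "filterlim (\<lambda>n. - (\<epsilon> * f n)) at_bot sequentially"
    by (simp add: filterlim_uminus_at_top)
  from filterlim_compose[OF exp_at_bot this] have "(\<lambda>n. exp (- \<epsilon> * f n)) \<longlonglongrightarrow> 0" by simp
  from tendsto_mult_left[OF this, of C] show ?thesis by simp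
qed

text \<open>Large Gromov products force small \<open>d_eps\<close>-distances unconditionally, by
  \<open>E_le_gp\<close>; the reverse implication is what the Gehring-Hayman conditions
  supply.\<close>

lemma close_of_gp:
  assumes "\<And>n. f n \<le> gp (s n) (t n)" "filterlim f at_top sequentially"
  shows "close s t"
proof (rule close_le)
  show "E (s n) (t n) \<le> 2 * K * exp (- \<epsilon> * f n)" for n
  proof (rule order_trans[OF E_le_gp])
    show "2 * K * exp (- \<epsilon> * gp (s n) (t n)) \<le> 2 * K * exp (- \<epsilon> * f n)"
      using assms(1)[of n] eps_pos K_pos by (intro mult_left_mono) auto
  qed
qed (rule exp_tendsto_0[OF assms(2)])

text \<open>\<open>E_ray_le\<close> makes the sequence Cauchy, and a limit in X would trap its tail
  in a unit ball. The parameters \<open>f\<close> are kept general for the interleaved and shifted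
  sequences that occur later.\<close>

lemma ray_boundary_seq:
  assumes ray: "geodesic_ray \<eta> q" and f: "filterlim f at_top sequentially" "\<And>n. f n \<ge> 0"
  shows "boundary_seq \<epsilon> p (\<lambda>n. \<eta> (f n))"
  unfolding boundary_seq_def
proof
  define C where "C = K * exp (\<epsilon> * dist p q)"
  show "eps_Cauchy \<epsilon> p (\<lambda>n. \<eta> (f n))"
    unfolding eps_Cauchy_def
  proof (intro allI impI)
    fix e :: real assume "e > 0"
    have "(\<lambda>n. C * exp (- \<epsilon> * f n)) \<longlonglongrightarrow> 0" by (rule exp_tendsto_0[OF f(1)])
    from tendstoD[OF this \<open>e > 0\<close>] obtain N where N: "\<And>n. n \<ge> N \<Longrightarrow> C * exp (- \<epsilon> * f n) < e"
      using K_pos unfolding eventually_sequentially by (auto simp: dist_real_def C_def)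
    have *: "E (\<eta> (f m)) (\<eta> (f n)) < e" if "m \<ge> N" "f m \<le> f n" for m n
      using E_ray_le[OF ray f(2) that(2)] N[OF that(1)] unfolding C_def by linarith
    have "E (\<eta> (f m)) (\<eta> (f n)) < e" if "m \<ge> N" "n \<ge> N" for m n
      using *[of m n] *[of n m] that E_commute[of "\<eta> (f m)"] by (metis linear)
    then show "\<exists>N. \<forall>m\<ge>N. \<forall>n\<ge>N. E (\<eta> (f m)) (\<eta> (f n)) < e" by blast
  qed
  show "\<not> eps_convergent \<epsilon> p (\<lambda>n. \<eta> (f n))"
  proof
    assume "eps_convergent \<epsilon> p (\<lambda>n. \<eta> (f n))"
    then obtain x where "close (\<lambda>n. \<eta> (f n)) (\<lambda>_. x)" unfolding eps_convergent_def by blast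
    moreover have "exp (- 2 * \<epsilon>) * \<rho> x > 0" by (simp add: rho_pos)
    ultimately obtain N where N: "\<And>n. n \<ge> N \<Longrightarrow> E (\<eta> (f n)) x < exp (- 2 * \<epsilon>) * \<rho> x"
      unfolding close_iff by blast
    obtain N' where N': "\<And>n. n \<ge> N' \<Longrightarrow> dist q x + 1 \<le> f n"
      using f(1) unfolding filterlim_at_top eventually_sequentially by blast
    let ?n = "max N N'"
    have "dist x (\<eta> (f ?n)) < 1" using N[of ?n] by (intro dist_less_1) (simp add: E_commute)
    then show False
      using N'[of ?n] dist_triangle[of q "\<eta> (f ?n)" x] geodesic_ray_dist[OF ray f(2)[of ?n]] by simp
  qed
qed

lemma ray_nat_boundary_seq: "geodesic_ray \<eta> q \<Longrightarrow> boundary_seq \<epsilon> p (\<lambda>n. \<eta> (real n))"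
  by (rule ray_boundary_seq) (auto intro: filterlim_real_sequentially)

lemma subseq_ray_close:
  assumes "\<And>k t. real k \<le> t \<Longrightarrow> real k - 1 - 2 * \<delta> \<le> gp (x (r k)) (\<gamma> t)"
  shows "close (x \<circ> r) (\<lambda>n. \<gamma> (real n))"
  by (rule close_of_gp[where f="\<lambda>n. real n - (1 + 2 * \<delta>)"]) (use assms filterlim_real_shift in \<open>auto simp: algebra_simps\<close>)

lemma boundary_seq_ray:
  assumes "boundary_seq \<epsilon> p s"
  obtains \<gamma> where "geodesic_ray \<gamma> p" "close s (\<lambda>n. \<gamma> (real n))"
proof -
  obtain \<gamma> r where r: "geodesic_ray \<gamma> p" "strict_mono r"
    "\<And>k t. real k \<le> t \<Longrightarrow> real k - 1 - 2 * \<delta> \<le> gp (s (r k)) (\<gamma> t)"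
    using ray_subsequence[OF boundary_seq_unbounded[OF assms]] by blast
  have "close s (s \<circ> r)" using assms r(2) by (intro eps_Cauchy_subseq_close) (auto simp: boundary_seq_def)
  from close_trans[OF this subseq_ray_close[of s r \<gamma>]] r(1,3) that show ?thesis by blast
qed

lemma exists_ray: "\<exists>\<gamma>. geodesic_ray \<gamma> p"
proof -
  have "\<exists>x. dist p x > real n" for n
    using unbounded unfolding bounded_any_center[of _ p] by (metis UNIV_I linorder_not_less)
  then obtain x where x: "\<And>n. dist p (x n) > real n" by metis
  have "filterlim (\<lambda>n. dist p (x n)) at_top sequentially"
    by (rule filterlim_at_top_mono[OF filterlim_real_sequentially]) (use x in \<open>auto intro!: always_eventually less_imp_le\<close>)
  then show ?thesis using ray_subsequence by blast
qed

section \<open>Points of the metric boundary as classes of sequences\<close>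

definition bclass :: "(nat \<Rightarrow> 'a) \<Rightarrow> (nat \<Rightarrow> 'a) set" where
  "bclass s = {t. boundary_seq \<epsilon> p t \<and> close s t}"

lemma metric_boundary_eq: "metric_boundary \<epsilon> p = bclass ` {s. boundary_seq \<epsilon> p s}"
  by (auto simp: metric_boundary_def bclass_def)

lemma bclass_self: "boundary_seq \<epsilon> p s \<Longrightarrow> s \<in> bclass s"
  by (simp add: bclass_def)

lemma bclass_eqI: "close s t \<Longrightarrow> bclass s = bclass t"
  unfolding bclass_def using close_trans close_sym by blast

lemma metric_boundaryD:
  assumes "\<xi> \<in> metric_boundary \<epsilon> p" "s \<in> \<xi>"
  shows "boundary_seq \<epsilon> p s" "\<xi> = bclass s"
  using assms bclass_eqI unfolding metric_boundary_eq by (auto simp: bclass_def)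

lemma metric_boundary_nonempty: "metric_boundary \<epsilon> p \<noteq> {}"
  using exists_ray ray_nat_boundary_seq unfolding metric_boundary_eq by blast

lemma metric_boundary_member: "\<xi> \<in> metric_boundary \<epsilon> p \<Longrightarrow> \<exists>s. s \<in> \<xi>"
  using bclass_self unfolding metric_boundary_eq by blast

text \<open>\<open>bdist\<close> refers to one chosen representative \<open>u\<close>; closeness of
  \<open>s\<close> and \<open>u\<close> makes it the limit along every representative.\<close>

lemma bdist_tendsto:
  assumes \<xi>: "\<xi> \<in> metric_boundary \<epsilon> p" and s: "s \<in> \<xi>"
  shows "(\<lambda>k. E z (s k)) \<longlonglongrightarrow> bdist \<epsilon> p z \<xi>"
proof -
  define u where "u = (SOME s. s \<in> \<xi>)"
  have u: "u \<in> \<xi>" unfolding u_def by (rule someI[of _ s]) (rule s)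
  have "Cauchy (\<lambda>k. E z (u k))"
    unfolding Cauchy_def
  proof (intro allI impI)
    fix e :: real assume "e > 0"
    then obtain N where N: "\<And>m n. m \<ge> N \<Longrightarrow> n \<ge> N \<Longrightarrow> E (u m) (u n) < e"
      using metric_boundaryD(1)[OF \<xi> u] unfolding boundary_seq_def eps_Cauchy_def by blast
    have "dist (E z (u m)) (E z (u n)) < e" if "m \<ge> N" "n \<ge> N" for m n
      using N[OF that] E_triangle[of z "u m" "u n"] E_triangle[of z "u n" "u m"] E_commute[of "u m" "u n"]
      by (simp add: dist_real_def abs_less_iff)
    then show "\<exists>N. \<forall>m\<ge>N. \<forall>n\<ge>N. dist (E z (u m)) (E z (u n)) < e" by blast
  qed
  then have lim: "(\<lambda>k. E z (u k)) \<longlonglongrightarrow> bdist \<epsilon> p z \<xi>"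
    unfolding bdist_def u_def[symmetric] by (simp add: Cauchy_convergent convergent_LIMSEQ_iff[symmetric])
  have "close u s" using metric_boundaryD(2)[OF \<xi> u] s by (auto simp: bclass_def)
  have "(\<lambda>k. E z (s k) - E z (u k)) \<longlonglongrightarrow> 0"
  proof (rule Lim_null_comparison[OF _ \<open>close u s\<close>])
    show "eventually (\<lambda>k. norm (E z (s k) - E z (u k)) \<le> E (u k) (s k)) sequentially"
    proof (rule always_eventually, rule allI)
      fix k show "norm (E z (s k) - E z (u k)) \<le> E (u k) (s k)"
        using E_triangle[of z "u k" "s k"] E_triangle[of z "s k" "u k"] E_commute[of "u k" "s k"]
        by (simp add: abs_le_iff)
    qed
  qed
  from tendsto_add[OF this lim] show ?thesis by simp
qed

text \<open>Eliminates \<open>bdist\<close>: converging to a boundary point means being one of its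
  representing sequences, so the Gehring-Hayman property can be tested on boundary sequences in
  X.\<close>

lemma bdist_null_iff:
  assumes \<xi>: "\<xi> \<in> metric_boundary \<epsilon> p"
  shows "(\<lambda>n. bdist \<epsilon> p (x n) \<xi>) \<longlonglongrightarrow> 0 \<longleftrightarrow> x \<in> \<xi>"
proof
  assume lim: "(\<lambda>n. bdist \<epsilon> p (x n) \<xi>) \<longlonglongrightarrow> 0"
  obtain s where s: "s \<in> \<xi>" using metric_boundary_member[OF \<xi>] by blast
  note bs = metric_boundaryD[OF \<xi> s]
  have "close s x"
    unfolding close_iff
  proof (intro allI impI)
    fix e :: real assume "e > 0"
    obtain N where N: "\<And>m n. m \<ge> N \<Longrightarrow> n \<ge> N \<Longrightarrow> E (s m) (s n) < e/2"
      using bs(1) \<open>e > 0\<close> unfolding boundary_seq_def eps_Cauchy_def by (metis half_gt_zero)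
    obtain N' where N': "\<And>n. n \<ge> N' \<Longrightarrow> bdist \<epsilon> p (x n) \<xi> < e/2"
      using order_tendstoD(2)[OF lim, of "e/2"] \<open>e > 0\<close> unfolding eventually_sequentially by auto
    have "E (s n) (x n) < e" if n: "n \<ge> max N N'" for n
    proof -
      have "E (s n) (x n) - e/2 \<le> bdist \<epsilon> p (x n) \<xi>"
      proof (rule tendsto_lowerbound[OF bdist_tendsto[OF \<xi> s]])
        show "eventually (\<lambda>k. E (s n) (x n) - e/2 \<le> E (x n) (s k)) sequentially"
          unfolding eventually_sequentially
        proof (intro exI[of _ N] allI impI)
          fix k assume "k \<ge> N"
          then show "E (s n) (x n) - e/2 \<le> E (x n) (s k)"
            using N[of n k] n E_triangle[of "s n" "x n" "s k"] E_commute[of "s k" "x n"] by auto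
        qed
      qed simp
      then show ?thesis using N'[of n] n by simp
    qed
    then show "\<exists>N. \<forall>n\<ge>N. E (s n) (x n) < e" by blast
  qed
  then show "x \<in> \<xi>" using bs boundary_seq_close by (auto simp: bclass_def)
next
  assume x: "x \<in> \<xi>"
  note bs = metric_boundaryD[OF \<xi> x]
  show "(\<lambda>n. bdist \<epsilon> p (x n) \<xi>) \<longlonglongrightarrow> 0"
    unfolding LIMSEQ_iff
  proof (intro allI impI)
    fix e :: real assume "e > 0"
    obtain N where N: "\<And>m n. m \<ge> N \<Longrightarrow> n \<ge> N \<Longrightarrow> E (x m) (x n) < e/2"
      using bs(1) \<open>e > 0\<close> unfolding boundary_seq_def eps_Cauchy_def by (metis half_gt_zero)
    have "norm (bdist \<epsilon> p (x n) \<xi> - 0) < e" if "n \<ge> N" for n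
    proof -
      have "bdist \<epsilon> p (x n) \<xi> \<le> e/2"
        by (rule tendsto_upperbound[OF bdist_tendsto[OF \<xi> x]])
          (use N that in \<open>auto simp: eventually_sequentially intro!: exI[of _ N] less_imp_le\<close>)
      moreover have "0 \<le> bdist \<epsilon> p (x n) \<xi>"
        by (rule tendsto_lowerbound[OF bdist_tendsto[OF \<xi> x]]) (auto simp: E_nonneg)
      ultimately show ?thesis using \<open>e > 0\<close> by simp
    qed
    then show "\<exists>N. \<forall>n\<ge>N. norm (bdist \<epsilon> p (x n) \<xi> - 0) < e" by blast
  qed
qed

lemma GH_boundary_iff:
  "GH_boundary \<epsilon> p \<longleftrightarrow> (\<forall>x. boundary_seq \<epsilon> p x \<longrightarrow> (\<exists>C\<ge>1. \<forall>n m \<gamma>. geodesic_seg \<gamma> (x n) (x m) \<longrightarrow>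
     eps.cl \<gamma> 0 (dist (x n) (x m)) \<le> ereal (C * E (x n) (x m))))"
  unfolding GH_boundary_def using bdist_null_iff metric_boundaryD bclass_self
  by (smt (verit, best) image_eqI mem_Collect_eq metric_boundary_eq)

section \<open>The canonical boundary map\<close>

definition rclass :: "(real \<Rightarrow> 'a) \<Rightarrow> (real \<Rightarrow> 'a) set" where
  "rclass \<gamma> = {\<eta>. geodesic_ray \<eta> p \<and> (\<exists>B. \<forall>t\<ge>0. dist (\<gamma> t) (\<eta> t) \<le> B)}"

lemma gromov_boundary_eq: "gromov_boundary p = rclass ` {\<gamma>. geodesic_ray \<gamma> p}"
  by (auto simp: gromov_boundary_def rclass_def)

lemma asymptotic_rays_close:
  assumes "geodesic_ray \<gamma> p" "\<And>t. t \<ge> 0 \<Longrightarrow> dist (\<gamma> t) (\<eta> t) \<le> B"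
  shows "close (\<lambda>n. \<gamma> (real n)) (\<lambda>n. \<eta> (real n))"
proof (rule close_of_gp[where f="\<lambda>n. real n - B"])
  show "real n - B \<le> gp (\<gamma> (real n)) (\<eta> (real n))" for n
    using gromov_product_ge[of p "\<gamma> (real n)" "\<eta> (real n)"] geodesic_ray_dist[OF assms(1), of n] assms(2)[of n]
    by simp
qed (rule filterlim_real_shift)

lemma rclass_eqI:
  assumes "\<And>t. t \<ge> 0 \<Longrightarrow> dist (\<gamma> t) (\<eta> t) \<le> B"
  shows "rclass \<gamma> = rclass \<eta>"
proof -
  have "\<exists>B. \<forall>t\<ge>0. dist (\<eta> t) (\<theta> t) \<le> B" if "\<forall>t\<ge>0. dist (\<gamma> t) (\<theta> t) \<le> B'" for \<theta> B'
    using assms that by (intro exI[of _ "B + B'"]) (smt (verit) dist_triangle3)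
  moreover have "\<exists>B. \<forall>t\<ge>0. dist (\<gamma> t) (\<theta> t) \<le> B" if "\<forall>t\<ge>0. dist (\<eta> t) (\<theta> t) \<le> B'" for \<theta> B'
    using assms that by (intro exI[of _ "B + B'"]) (smt (verit) dist_triangle)
  ultimately show ?thesis unfolding rclass_def by blast
qed

lemma Phi_rclass:
  assumes ray: "geodesic_ray \<gamma> p"
  shows "Phi \<epsilon> p (rclass \<gamma>) = bclass (\<lambda>n. \<gamma> (real n))"
  unfolding Phi_def
proof (rule the_equality)
  let ?\<xi> = "bclass (\<lambda>n. \<gamma> (real n))"
  have \<xi>: "?\<xi> \<in> metric_boundary \<epsilon> p" using ray_nat_boundary_seq[OF ray] by (simp add: metric_boundary_eq)
  have "(\<lambda>k. bdist \<epsilon> p (\<eta> (real k)) ?\<xi>) \<longlonglongrightarrow> 0" if \<eta>: "\<eta> \<in> rclass \<gamma>" for \<eta>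
  proof -
    have "close (\<lambda>n. \<gamma> (real n)) (\<lambda>n. \<eta> (real n))"
      using asymptotic_rays_close[OF ray] \<eta> by (auto simp: rclass_def)
    then show ?thesis
      using \<eta> ray_nat_boundary_seq by (subst bdist_null_iff[OF \<xi>]) (auto simp: bclass_def rclass_def)
  qed
  then show "?\<xi> \<in> metric_boundary \<epsilon> p \<and> (\<forall>\<eta>\<in>rclass \<gamma>. (\<lambda>k. bdist \<epsilon> p (\<eta> (real k)) ?\<xi>) \<longlonglongrightarrow> 0)"
    using \<xi> by blast
  fix \<xi> assume \<xi>: "\<xi> \<in> metric_boundary \<epsilon> p \<and> (\<forall>\<eta>\<in>rclass \<gamma>. (\<lambda>k. bdist \<epsilon> p (\<eta> (real k)) \<xi>) \<longlonglongrightarrow> 0)"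
  \<comment> \<open>The ray belongs to its own class, so any other candidate contains its sequence
    and coincides with \<open>?\<xi>\<close>.\<close>
  have "\<gamma> \<in> rclass \<gamma>" using ray by (auto simp: rclass_def)
  then have "(\<lambda>k. \<gamma> (real k)) \<in> \<xi>" using \<xi> bdist_null_iff by blast
  then show "\<xi> = ?\<xi>" using metric_boundaryD(2) \<xi> by blast
qed

text \<open>Every boundary sequence is close to a ray by \<open>boundary_seq_ray\<close>, so
  surjectivity is automatic and the right-hand side expresses injectivity.\<close>

lemma bij_Phi_iff:
  "bij_betw (Phi \<epsilon> p) (gromov_boundary p) (metric_boundary \<epsilon> p) \<longleftrightarrow>
    (\<forall>\<gamma> \<eta>. geodesic_ray \<gamma> p \<and> geodesic_ray \<eta> p \<and> close (\<lambda>n. \<gamma> (real n)) (\<lambda>n. \<eta> (real n))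
      \<longrightarrow> (\<exists>B. \<forall>t\<ge>0. dist (\<gamma> t) (\<eta> t) \<le> B))" (is "_ \<longleftrightarrow> ?R")
proof
  assume bij: "bij_betw (Phi \<epsilon> p) (gromov_boundary p) (metric_boundary \<epsilon> p)"
  show ?R
  proof (intro allI impI)
    fix \<gamma> \<eta> assume *: "geodesic_ray \<gamma> p \<and> geodesic_ray \<eta> p \<and> close (\<lambda>n. \<gamma> (real n)) (\<lambda>n. \<eta> (real n))"
    then have "Phi \<epsilon> p (rclass \<gamma>) = Phi \<epsilon> p (rclass \<eta>)" using Phi_rclass bclass_eqI by auto
    then have "rclass \<gamma> = rclass \<eta>"
      using bij * unfolding bij_betw_def gromov_boundary_eq by (auto dest: inj_onD)
    moreover have "\<eta> \<in> rclass \<eta>" using * by (auto simp: rclass_def)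
    ultimately have "\<eta> \<in> rclass \<gamma>" by simp
    then show "\<exists>B. \<forall>t\<ge>0. dist (\<gamma> t) (\<eta> t) \<le> B" by (auto simp: rclass_def)
  qed
next
  assume R: ?R
  show "bij_betw (Phi \<epsilon> p) (gromov_boundary p) (metric_boundary \<epsilon> p)"
    unfolding bij_betw_def
  proof
    show "inj_on (Phi \<epsilon> p) (gromov_boundary p)"
    proof (rule inj_onI)
      fix X Y assume "X \<in> gromov_boundary p" "Y \<in> gromov_boundary p" and eq: "Phi \<epsilon> p X = Phi \<epsilon> p Y"
      then obtain \<gamma> \<eta> where ge: "geodesic_ray \<gamma> p" "X = rclass \<gamma>" "geodesic_ray \<eta> p" "Y = rclass \<eta>"
        unfolding gromov_boundary_eq by blast
      then have "(\<lambda>n. \<eta> (real n)) \<in> bclass (\<lambda>n. \<gamma> (real n))"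
        using eq Phi_rclass bclass_self[OF ray_nat_boundary_seq] by metis
      then have "close (\<lambda>n. \<gamma> (real n)) (\<lambda>n. \<eta> (real n))" by (simp add: bclass_def)
      then show "X = Y" using R ge rclass_eqI by meson
    qed
    show "Phi \<epsilon> p ` gromov_boundary p = metric_boundary \<epsilon> p"
    proof
      show "Phi \<epsilon> p ` gromov_boundary p \<subseteq> metric_boundary \<epsilon> p"
        using Phi_rclass ray_nat_boundary_seq unfolding gromov_boundary_eq metric_boundary_eq by auto
      show "metric_boundary \<epsilon> p \<subseteq> Phi \<epsilon> p ` gromov_boundary p"
      proof
        fix \<xi> assume "\<xi> \<in> metric_boundary \<epsilon> p"
        then obtain s where s: "boundary_seq \<epsilon> p s" "\<xi> = bclass s" unfolding metric_boundary_eq by blast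
        obtain \<gamma> where "geodesic_ray \<gamma> p" "close s (\<lambda>n. \<gamma> (real n))" by (rule boundary_seq_ray[OF s(1)])
        then show "\<xi> \<in> Phi \<epsilon> p ` gromov_boundary p"
          using s(2) bclass_eqI Phi_rclass unfolding gromov_boundary_eq by (auto intro!: image_eqI[of _ _ "rclass \<gamma>"])
      qed
    qed
  qed
qed

end

subsection \<open>The Gehring-Hayman conditions\<close>

lemma filterlim_div_2: "filterlim (\<lambda>n::nat. n div 2) at_top sequentially"
  unfolding filterlim_at_top eventually_sequentially
proof
  fix Z :: nat
  show "\<exists>N. \<forall>n\<ge>N. Z \<le> n div 2" by (intro exI[of _ "2 * Z"]) auto
qed

context hyperbolic_uniformization
begin

lemma GH_theorem_imp_boundary_gromov_seq:
  assumes "GH_theorem \<epsilon> p"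
  shows "GH_boundary \<epsilon> p" "GH_gromov_seq \<epsilon> p"
proof -
  obtain A where A: "A > 0" "\<And>x y \<gamma>. geodesic_seg \<gamma> x y \<Longrightarrow> eps.cl \<gamma> 0 (dist x y) \<le> ereal (A * E x y)"
    using assms unfolding GH_theorem_def by blast
  have *: "eps.cl \<gamma> 0 (dist x y) \<le> ereal (max 1 A * E x y)" if "geodesic_seg \<gamma> x y" for x y \<gamma>
  proof -
    have "A * E x y \<le> max 1 A * E x y" by (rule mult_right_mono) (auto simp: E_nonneg)
    then show ?thesis using A(2)[OF that] by (meson ereal_less_eq(3) order_trans)
  qed
  show "GH_boundary \<epsilon> p" unfolding GH_boundary_def using * by (intro ballI allI impI exI[of _ "max 1 A"]) auto
  show "GH_gromov_seq \<epsilon> p" unfolding GH_gromov_seq_def using * by (intro allI impI exI[of _ "max 1 A"]) auto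
qed

text \<open>Hyperbolicity first replaces \<open>\<gamma> k\<close> by \<open>\<gamma> t\<close>,
  then \<open>\<eta> k\<close> by \<open>\<eta> t\<close>, at the cost of \<delta> each time. Both
  points lie at distance \<open>t\<close> from \<open>p\<close>, so a product of at least
  \<open>t - 2 * \<delta>\<close> means distance at most \<open>4 * \<delta>\<close>.\<close>

lemma rays_fellow_travel:
  assumes "geodesic_ray \<gamma> p" "geodesic_ray \<eta> p" "0 \<le> t" "t \<le> k" "t \<le> gp (\<gamma> k) (\<eta> k)"
  shows "dist (\<gamma> t) (\<eta> t) \<le> 4 * \<delta>"
proof -
  have 1: "gp (\<zeta> t) (\<zeta> k) = t" if "geodesic_ray \<zeta> p" for \<zeta>
  proof -
    have "dist (\<zeta> t) (\<zeta> k) = \<bar>t - k\<bar>" using that assms(3,4) by (simp add: geodesic_ray_def)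
    then show ?thesis
      using geodesic_ray_dist[OF that, of t] geodesic_ray_dist[OF that, of k] assms(3,4)
      by (simp add: gromov_product_def)
  qed
  have "t - \<delta> \<le> gp (\<gamma> t) (\<eta> k)" using hyperbolic[of "\<gamma> t" "\<gamma> k" "\<eta> k"] 1[OF assms(1)] assms(5) by simp
  then have "t - 2 * \<delta> \<le> gp (\<gamma> t) (\<eta> t)"
    using hyperbolic[of "\<gamma> t" "\<eta> k" "\<eta> t"] 1[OF assms(2)] gromov_product_commute[of p "\<eta> k" "\<eta> t"] delta_nonneg
    by (simp add: min_def split: if_splits)
  then show ?thesis
    using geodesic_ray_dist[OF assms(1,3)] geodesic_ray_dist[OF assms(2,3)] by (simp add: gromov_product_def)
qed

lemma GH_theorem_imp_bij_Phi:
  assumes "GH_theorem \<epsilon> p"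
  shows "bij_betw (Phi \<epsilon> p) (gromov_boundary p) (metric_boundary \<epsilon> p)"
  unfolding bij_Phi_iff
proof (intro allI impI)
  fix \<gamma> \<eta>
  assume *: "geodesic_ray \<gamma> p \<and> geodesic_ray \<eta> p \<and> close (\<lambda>n. \<gamma> (real n)) (\<lambda>n. \<eta> (real n))"
  obtain c where c: "c > 0" "\<And>x y. separated c x y" using assms unfolding GH_theorem_iff by blast
  have "dist (\<gamma> t) (\<eta> t) \<le> 4 * \<delta>" if "t \<ge> 0" for t
  proof -
    \<comment> \<open>Below this threshold \<open>separated\<close> forces the Gromov product up to
      \<open>t\<close>; the choice \<open>k \<ge> t + 1\<close> settles pairs at distance at most
      1.\<close>
    have "c * exp (- \<epsilon> * t) > 0" using c(1) by simp
    then obtain N where N: "\<And>n. n \<ge> N \<Longrightarrow> E (\<gamma> (real n)) (\<eta> (real n)) < c * exp (- \<epsilon> * t)"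
      using * unfolding close_iff by blast
    define k where "k = max N (nat \<lceil>t + 1\<rceil>)"
    have k: "k \<ge> N" "real k \<ge> t + 1" unfolding k_def by linarith+
    have "t \<le> gp (\<gamma> (real k)) (\<eta> (real k))"
    proof (cases "dist (\<gamma> (real k)) (\<eta> (real k)) \<le> 1")
      case True
      then show ?thesis
        using gromov_product_ge[of p "\<gamma> (real k)" "\<eta> (real k)"] geodesic_ray_dist[of \<gamma> p "real k"] * k by simp
    next
      case False
      then have "c * exp (- \<epsilon> * gp (\<gamma> (real k)) (\<eta> (real k))) \<le> E (\<gamma> (real k)) (\<eta> (real k))"
        using c(2)[of "\<gamma> (real k)" "\<eta> (real k)"] by (simp add: separated_def)
      also have "\<dots> < c * exp (- \<epsilon> * t)" by (rule N[OF k(1)])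
      finally show ?thesis using c(1) eps_pos by simp
    qed
    then show ?thesis using * k that by (intro rays_fellow_travel[of \<gamma> \<eta> t "real k"]) auto
  qed
  then show "\<exists>B. \<forall>t\<ge>0. dist (\<gamma> t) (\<eta> t) \<le> B" by blast
qed

lemma GH_boundary_imp_theorem:
  assumes "GH_boundary \<epsilon> p"
  shows "GH_theorem \<epsilon> p"
  unfolding GH_theorem_iff
proof (rule ccontr)
  assume neg: "\<not> (\<exists>c>0. \<forall>x y. separated c x y)"
  have "\<forall>n. \<exists>xy. \<not> separated (inverse (real (Suc n))) (fst xy) (snd xy)"
  proof
    fix n
    have "inverse (real (Suc n)) > 0" by simp
    then show "\<exists>xy. \<not> separated (inverse (real (Suc n))) (fst xy) (snd xy)" using neg by (metis fst_conv snd_conv)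
  qed
  from choice[OF this] obtain xy where xy: "\<And>n. \<not> separated (inverse (real (Suc n))) (fst (xy n)) (snd (xy n))"
    by blast
  define x y where "x n = fst (xy n)" and "y n = snd (xy n)" for n
  have nsep: "\<not> separated (inverse (real (Suc n))) (x n) (y n)" for n
    using xy by (simp add: x_def y_def)
  \<comment> \<open>The exponential is at most 1. The factor \<open>min 1 (dist (x n) (y n))\<close>
    is kept: it cancels against the same factor in \<open>E_lower\<close> and yields the decay of
    \<open>\<rho> (x n)\<close> even when the two points are close.\<close>
  have small: "E (x n) (y n) < inverse (real (Suc n)) * min 1 (dist (x n) (y n))" for n
  proof -
    have "exp (- \<epsilon> * gp (x n) (y n)) \<le> 1" using eps_pos gromov_product_nonneg[of p "x n" "y n"] by simp
    then have "inverse (real (Suc n)) * exp (- \<epsilon> * gp (x n) (y n)) * min 1 (dist (x n) (y n))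
      \<le> inverse (real (Suc n)) * 1 * min 1 (dist (x n) (y n))"
      by (intro mult_right_mono mult_left_mono) auto
    then show ?thesis using nsep[of n] unfolding separated_def by linarith
  qed
  have E_small: "E (x n) (y n) \<le> inverse (real (Suc n))" for n
  proof -
    have "inverse (real (Suc n)) * min 1 (dist (x n) (y n)) \<le> inverse (real (Suc n)) * 1"
      by (rule mult_left_mono) auto
    then show ?thesis using small[of n] by linarith
  qed
  have rho_small: "exp (- 2 * \<epsilon>) * \<rho> (x n) < inverse (real (Suc n))" for n
  proof -
    have "exp (- 2 * \<epsilon>) * \<rho> (x n) * min 1 (dist (x n) (y n)) < inverse (real (Suc n)) * min 1 (dist (x n) (y n))"
      using E_lower[of "x n" "y n"] small[of n] by linarith
    then show ?thesis by (rule mult_right_less_imp_less) simp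
  qed
  have inv0: "(\<lambda>n. inverse (real (Suc n))) \<longlonglongrightarrow> 0" by (rule LIMSEQ_inverse_real_of_nat)
  have "filterlim (\<lambda>n. dist p (x n)) at_top sequentially"
    unfolding filterlim_at_top
  proof
    fix R
    have "eventually (\<lambda>n. inverse (real (Suc n)) < exp (- 2 * \<epsilon>) * exp (- \<epsilon> * R)) sequentially"
      by (rule order_tendstoD(2)[OF inv0]) simp
    then show "eventually (\<lambda>n. R \<le> dist p (x n)) sequentially"
    proof eventually_elim
      case (elim n)
      then have "exp (- 2 * \<epsilon>) * \<rho> (x n) < exp (- 2 * \<epsilon>) * exp (- \<epsilon> * R)" using rho_small[of n] by linarith
      then have "\<rho> (x n) < exp (- \<epsilon> * R)" by simp
      then show ?case using rho_ge_exp[of "x n" R] by linarith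
    qed
  qed
  from ray_subsequence[OF this] obtain \<gamma> r where r: "geodesic_ray \<gamma> p" "strict_mono r"
    "\<And>k t. real k \<le> t \<Longrightarrow> real k - 1 - 2 * \<delta> \<le> gp (x (r k)) (\<gamma> t)" by blast
  have xc: "close (x \<circ> r) (\<lambda>n. \<gamma> (real n))" by (rule subseq_ray_close) (rule r(3))
  have rk: "k \<le> r k" for k using r(2) by (rule seq_suble)
  have xyc: "close (x \<circ> r) (y \<circ> r)"
  proof (rule close_le)
    show "E ((x \<circ> r) n) ((y \<circ> r) n) \<le> inverse (real (Suc n))" for n
    proof -
      have "inverse (real (Suc (r n))) \<le> inverse (real (Suc n))"
        using rk[of n] by (intro le_imp_inverse_le) auto
      then show ?thesis using order_trans[OF E_small[of "r n"]] by (simp only: comp_apply)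
    qed
  qed (rule inv0)
  \<comment> \<open>The pair \<open>x (r N)\<close>, \<open>y (r N)\<close> reappears at the indices
    \<open>2 * N\<close> and \<open>2 * N + 1\<close>, so the single constant \<open>C\<close> of
    the sequence \<open>z\<close> serves all pairs at once.\<close>
  define z where "z n = (if even n then x (r (n div 2)) else y (r (n div 2)))" for n
  define f where "f k = E (x (r k)) (\<gamma> (real k)) + E (x (r k)) (y (r k))" for k
  have "f \<longlonglongrightarrow> 0" using tendsto_add[OF xc xyc] by (simp add: f_def[abs_def])
  have zc: "close z (\<lambda>n. \<gamma> (real (n div 2)))"
  proof (rule close_le)
    show "E (z n) (\<gamma> (real (n div 2))) \<le> f (n div 2)" for n
      using E_triangle[of "y (r (n div 2))" "\<gamma> (real (n div 2))" "x (r (n div 2))"]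
        E_nonneg[of "x (r (n div 2))" "y (r (n div 2))"] E_commute[of "x (r (n div 2))" "y (r (n div 2))"]
      by (simp add: z_def f_def)
    show "(\<lambda>n. f (n div 2)) \<longlonglongrightarrow> 0" by (rule filterlim_compose[OF \<open>f \<longlonglongrightarrow> 0\<close> filterlim_div_2])
  qed
  have "boundary_seq \<epsilon> p (\<lambda>n. \<gamma> (real (n div 2)))"
    by (rule ray_boundary_seq[OF r(1)]) (auto intro: filterlim_compose[OF filterlim_real_sequentially filterlim_div_2])
  from boundary_seq_close[OF this close_sym[OF zc]] have "boundary_seq \<epsilon> p z" .
  then obtain C where C: "C \<ge> 1" "\<And>n m \<gamma>. geodesic_seg \<gamma> (z n) (z m) \<Longrightarrow>
      eps.cl \<gamma> 0 (dist (z n) (z m)) \<le> ereal (C * E (z n) (z m))"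
    using assms unfolding GH_boundary_iff by blast
  have sep: "separated (c1 / C) (z n) (z m)" for n m
  proof -
    obtain \<theta> where \<theta>: "geodesic_seg \<theta> (z n) (z m)" using geodesic by blast
    show ?thesis by (rule separated_of_geodesic_length[OF \<theta> C(2)[OF \<theta>]]) (use C(1) in auto)
  qed
  have "eventually (\<lambda>n. inverse (real (Suc n)) < c1 / C) sequentially"
    by (rule order_tendstoD(2)[OF inv0]) (use c1_pos C(1) in auto)
  then obtain N where N: "\<And>n. n \<ge> N \<Longrightarrow> inverse (real (Suc n)) < c1 / C"
    unfolding eventually_sequentially by blast
  have "separated (c1 / C) (x (r N)) (y (r N))" using sep[of "2 * N" "2 * N + 1"] by (simp add: z_def)
  then have "separated (inverse (real (Suc (r N)))) (x (r N)) (y (r N))"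
    by (rule separated_mono) (use N[of "r N"] rk[of N] in auto)
  then show False using nsep by blast
qed

text \<open>Injectivity of the boundary map forces all rays arising from subsequences of a boundary
  sequence to be asymptotic, so that the sequence cannot split into different ends.\<close>

lemma boundary_seq_gromov_sequence:
  assumes bij: "bij_betw (Phi \<epsilon> p) (gromov_boundary p) (metric_boundary \<epsilon> p)"
    and x: "boundary_seq \<epsilon> p x"
  shows "gromov_sequence p x"
proof -
  obtain \<gamma> where \<gamma>: "geodesic_ray \<gamma> p" "close x (\<lambda>n. \<gamma> (real n))" by (rule boundary_seq_ray[OF x])
  have key: "\<exists>N. \<forall>n\<ge>N. \<forall>t\<ge>real N. B \<le> gp (x n) (\<gamma> t)" for B
  proof (rule ccontr)
    assume neg: "\<not> ?thesis"
    \<comment> \<open>The bound \<open>t \<ge> real k\<close> travels with the selected index; after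
      a further subsequence \<open>t\<close> still exceeds \<open>k\<close>, as the estimate along
      \<open>\<eta>\<close> demands.\<close>
    have "\<exists>n\<ge>N. \<exists>t\<ge>real k. gp (x n) (\<gamma> t) < B" for k N
    proof -
      obtain n t where "n \<ge> max k N" "t \<ge> real (max k N)" "gp (x n) (\<gamma> t) < B"
        using neg by (metis linorder_not_less)
      then show ?thesis by (intro exI[of _ n] conjI exI[of _ t]) auto
    qed
    from strict_mono_choice[of "\<lambda>k n. \<exists>t\<ge>real k. gp (x n) (\<gamma> t) < B", OF this]
    obtain r :: "nat \<Rightarrow> nat" where r: "strict_mono r" "\<And>k. \<exists>t\<ge>real k. gp (x (r k)) (\<gamma> t) < B" by blast
    have xr: "close x (x \<circ> r)" using x r(1) by (intro eps_Cauchy_subseq_close) (auto simp: boundary_seq_def)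
    have bxr: "boundary_seq \<epsilon> p (x \<circ> r)" by (rule boundary_seq_close[OF x xr])
    from ray_subsequence[OF boundary_seq_unbounded[OF bxr]] obtain \<eta> r' where
      r': "geodesic_ray \<eta> p" "strict_mono r'"
      "\<And>k t. real k \<le> t \<Longrightarrow> real k - 1 - 2 * \<delta> \<le> gp ((x \<circ> r) (r' k)) (\<eta> t)" by blast
    have "close (x \<circ> r) (x \<circ> r \<circ> r')"
      using bxr r'(2) eps_Cauchy_subseq_close[of "x \<circ> r" r'] by (simp add: boundary_seq_def)
    moreover have "close (x \<circ> r \<circ> r') (\<lambda>n. \<eta> (real n))" by (rule subseq_ray_close) (rule r'(3))
    ultimately have "close (x \<circ> r) (\<lambda>n. \<eta> (real n))" by (rule close_trans)
    from close_trans[OF xr this] have "close x (\<lambda>n. \<eta> (real n))" .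
    from close_trans[OF close_sym[OF \<gamma>(2)] this] have "close (\<lambda>n. \<gamma> (real n)) (\<lambda>n. \<eta> (real n))" .
    then obtain D where D: "\<And>t. t \<ge> 0 \<Longrightarrow> dist (\<gamma> t) (\<eta> t) \<le> D"
      using bij \<gamma>(1) r'(1) unfolding bij_Phi_iff by blast
    \<comment> \<open>So large that both \<open>k - 1 - 2 * \<delta>\<close> and
      \<open>k - D\<close> remain at least \<open>B\<close> after the loss of a further
      \<delta>.\<close>
    define k where "k = nat \<lceil>\<bar>B\<bar> + \<bar>D\<bar> + 1 + 3 * \<delta>\<rceil>"
    have k: "real k \<ge> \<bar>B\<bar> + \<bar>D\<bar> + 1 + 3 * \<delta>" unfolding k_def by linarith
    obtain t where t: "t \<ge> real (r' k)" "gp (x (r (r' k))) (\<gamma> t) < B" using r(2) by blast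
    have "k \<le> r' k" using r'(2) by (rule seq_suble)
    then have kt: "real k \<le> t" using t(1) by linarith
    have 1: "real k - 1 - 2 * \<delta> \<le> gp (x (r (r' k))) (\<eta> t)" using r'(3)[OF kt] by simp
    have "t \<ge> 0" using kt by linarith
    then have 2: "real k - D \<le> gp (\<eta> t) (\<gamma> t)"
      using gromov_product_ge[of p "\<eta> t" "\<gamma> t"] D[of t] geodesic_ray_dist[OF r'(1), of t] kt
      by (simp add: dist_commute)
    show False
      using hyperbolic[of "x (r (r' k))" "\<eta> t" "\<gamma> t"] 1 2 t(2) k delta_nonneg by linarith
  qed
  show ?thesis unfolding gromov_sequence_def
  proof
    fix B
    obtain N where N: "\<And>n t. n \<ge> N \<Longrightarrow> t \<ge> real N \<Longrightarrow> B + \<delta> \<le> gp (x n) (\<gamma> t)" using key by blast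
    have "B \<le> gp (x n) (x m)" if "n \<ge> N" "m \<ge> N" for n m
      using hyperbolic[of "x n" "\<gamma> (real N)" "x m"] N[OF that(1), of "real N"] N[OF that(2), of "real N"]
        gromov_product_commute[of p "\<gamma> (real N)" "x m"] by (auto simp: min_def split: if_splits)
    then show "\<exists>N. \<forall>n\<ge>N. \<forall>m\<ge>N. B \<le> gp (x n) (x m)" by blast
  qed
qed

lemma bij_gromov_seq_imp_GH_boundary:
  assumes "bij_betw (Phi \<epsilon> p) (gromov_boundary p) (metric_boundary \<epsilon> p)" "GH_gromov_seq \<epsilon> p"
  shows "GH_boundary \<epsilon> p"
  unfolding GH_boundary_iff
proof (intro allI impI)
  fix x assume "boundary_seq \<epsilon> p x"
  then have "gromov_sequence p x" by (rule boundary_seq_gromov_sequence[OF assms(1)])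
  then show "\<exists>C\<ge>1. \<forall>n m \<gamma>. geodesic_seg \<gamma> (x n) (x m) \<longrightarrow>
     eps.cl \<gamma> 0 (dist (x n) (x m)) \<le> ereal (C * E (x n) (x m))"
    using assms(2) unfolding GH_gromov_seq_def by simp
qed

end

subsection \<open>Uniform spaces\<close>

lemma IVT_subinterval:
  fixes F :: "real \<Rightarrow> real"
  assumes "continuous_on {a..b} F" "a \<le> s" "s \<le> t" "t \<le> b" "F s \<le> v" "v \<le> F t"
  obtains u where "s \<le> u" "u \<le> t" "F u = v"
  using IVT'[of F s v t] assms continuous_on_subset[OF assms(1), of "{s..t}"] by auto

context hyperbolic_uniformization
begin

text \<open>A boundary sequence eventually stays at distance at least 1 from \<open>z\<close>, where
  the minimum in \<open>E_lower\<close> is 1.\<close>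

lemma bdist_ge:
  assumes \<xi>: "\<xi> \<in> metric_boundary \<epsilon> p"
  shows "exp (- 2 * \<epsilon>) * \<rho> z \<le> bdist \<epsilon> p z \<xi>"
proof -
  obtain s where s: "s \<in> \<xi>" using metric_boundary_member[OF \<xi>] by blast
  have "filterlim (\<lambda>n. dist p (s n)) at_top sequentially"
    by (rule boundary_seq_unbounded[OF metric_boundaryD(1)[OF \<xi> s]])
  then have "eventually (\<lambda>n. dist p z + 1 \<le> dist p (s n)) sequentially"
    by (simp add: filterlim_at_top)
  then have "eventually (\<lambda>n. exp (- 2 * \<epsilon>) * \<rho> z \<le> E z (s n)) sequentially"
  proof eventually_elim
    case (elim n)
    then have "1 \<le> dist z (s n)" using dist_triangle[of p "s n" z] by linarith
    then show ?case using E_lower[of z "s n"] by simp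
  qed
  then show ?thesis by (rule tendsto_lowerbound[OF bdist_tendsto[OF \<xi> s]]) simp
qed

lemma dist_to_boundary_ge: "exp (- 2 * \<epsilon>) * \<rho> z \<le> dist_to_boundary \<epsilon> p z"
  unfolding dist_to_boundary_def using metric_boundary_nonempty bdist_ge by (intro cInf_greatest) auto

lemma dist_to_boundary_le_bdist:
  "\<xi> \<in> metric_boundary \<epsilon> p \<Longrightarrow> dist_to_boundary \<epsilon> p z \<le> bdist \<epsilon> p z \<xi>"
  unfolding dist_to_boundary_def using bdist_ge
  by (intro cInf_lower bdd_belowI[where m="exp (- 2 * \<epsilon>) * \<rho> z"]) auto

lemma not_mcomplete_eps: "\<not> eps.mcomplete"
proof
  assume mc: "eps.mcomplete"
  obtain \<gamma> where "geodesic_ray \<gamma> p" using exists_ray by blast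
  from ray_nat_boundary_seq[OF this]
  have cau: "eps_Cauchy \<epsilon> p (\<lambda>n. \<gamma> (real n))" and nc: "\<not> eps_convergent \<epsilon> p (\<lambda>n. \<gamma> (real n))"
    by (auto simp: boundary_seq_def)
  have "eps.MCauchy (\<lambda>n. \<gamma> (real n))"
    using cau unfolding eps.MCauchy_def eps_Cauchy_def by (auto; meson)
  then obtain x where "limitin eps.mtopology (\<lambda>n. \<gamma> (real n)) x sequentially"
    using mc unfolding eps.mcomplete_def by blast
  then have "close (\<lambda>n. \<gamma> (real n)) (\<lambda>_. x)"
    unfolding eps.limit_metric_sequentially by (simp add: close_iff)
  then show False using nc by (auto simp: eps_convergent_def)
qed

lemma locally_compact_eps: "locally_compact_space eps.mtopology"
  unfolding mtopology_eps locally_compact_space_def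
proof (intro ballI)
  fix x :: 'a
  show "\<exists>U C. openin euclidean U \<and> compactin euclidean C \<and> x \<in> U \<and> U \<subseteq> C"
    using proper[of x 1] by (intro exI[of _ "ball x 1"] exI[of _ "cball x 1"]) auto
qed

lemma GH_theorem_imp_uniform:
  assumes "GH_theorem \<epsilon> p"
  shows "uniform_space \<epsilon> p"
proof -
  obtain A where A: "A > 0" "\<And>x y \<gamma>. geodesic_seg \<gamma> x y \<Longrightarrow> eps.cl \<gamma> 0 (dist x y) \<le> ereal (A * E x y)"
    using assms unfolding GH_theorem_def by blast
  \<comment> \<open>\<open>K\<close> is the constant of the length bounds,
    \<open>exp (2 * \<epsilon> * \<delta>)\<close> pays for \<open>geodesic_near\<close>, and
    \<open>exp (2 * \<epsilon>)\<close> for \<open>dist_to_boundary_ge\<close>.\<close>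
  define A' where "A' = max A (K * exp (2 * \<epsilon> * \<delta>) * exp (2 * \<epsilon>))"
  have "A' > 0" using A(1) by (simp add: A'_def)
  have key: "K * exp (- \<epsilon> * r) \<le> A' * dist_to_boundary \<epsilon> p z" if "dist p z \<le> r + 2 * \<delta>" for r z
  proof -
    have "K * exp (- \<epsilon> * r) = K * exp (2 * \<epsilon> * \<delta>) * exp (2 * \<epsilon>) * (exp (- 2 * \<epsilon>) * exp (- \<epsilon> * (r + 2 * \<delta>)))"
      by (simp add: algebra_simps flip: exp_add)
    also have "\<dots> \<le> A' * dist_to_boundary \<epsilon> p z"
    proof (rule mult_mono)
      have "exp (- 2 * \<epsilon>) * exp (- \<epsilon> * (r + 2 * \<delta>)) \<le> exp (- 2 * \<epsilon>) * \<rho> z"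
        by (intro mult_left_mono rho_ge_exp[OF that]) auto
      then show "exp (- 2 * \<epsilon>) * exp (- \<epsilon> * (r + 2 * \<delta>)) \<le> dist_to_boundary \<epsilon> p z"
        using dist_to_boundary_ge[of z] by linarith
    qed (use \<open>A' > 0\<close> in \<open>auto simp: A'_def\<close>)
    finally show ?thesis .
  qed
  have "uniform_curve \<epsilon> p A' \<gamma> 0 (dist x y)" if seg: "geodesic_seg \<gamma> x y" for x y \<gamma>
    unfolding uniform_curve_def
  proof (intro conjI ballI)
    show "continuous_map (subtopology euclideanreal {0..dist x y}) eps.mtopology \<gamma>"
      unfolding mtopology_eps
      using isometric_path_continuous[OF geodesic_seg_isometric[OF seg]] by (simp add: continuous_map_iff_continuous)
    have "A * E x y \<le> A' * E x y" by (rule mult_right_mono) (auto simp: A'_def E_nonneg)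
    then show "eps.cl \<gamma> 0 (dist x y) \<le> ereal (A' * E (\<gamma> 0) (\<gamma> (dist x y)))"
      using A(2)[OF seg] seg unfolding geodesic_seg_def by (metis ereal_less_eq(3) order_trans)
    fix t assume t: "t \<in> {0..dist x y}"
    \<comment> \<open>Up to the foot the initial subarc is controlled, beyond it the final
      one.\<close>
    show "min (eps.cl \<gamma> 0 t) (eps.cl \<gamma> t (dist x y)) \<le> ereal (A' * dist_to_boundary \<epsilon> p (\<gamma> t))"
    proof (cases "t \<le> dist p x - gp x y")
      case True
      have "eps.cl \<gamma> 0 t \<le> ereal (K * exp (- \<epsilon> * (dist p x - t)))" by (rule geodesic_length_left[OF seg t])
      also have "\<dots> \<le> ereal (A' * dist_to_boundary \<epsilon> p (\<gamma> t))"
        using key[OF geodesic_near(1)[OF seg t True]] by simp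
      finally show ?thesis by (simp add: min.coboundedI1)
    next
      case False
      have "eps.cl \<gamma> t (dist x y) \<le> ereal (K * exp (- \<epsilon> * (dist p y - (dist x y - t))))"
        by (rule geodesic_length_right[OF seg t])
      also have "\<dots> \<le> ereal (A' * dist_to_boundary \<epsilon> p (\<gamma> t))"
        using key[OF geodesic_near(2)[OF seg t]] False by simp
      finally show ?thesis by (simp add: min.coboundedI2)
    qed
  qed simp
  then have "\<exists>\<gamma> a b. \<gamma> a = x \<and> \<gamma> b = y \<and> uniform_curve \<epsilon> p A' \<gamma> a b" for x y
    using geodesic[of x y] unfolding geodesic_seg_def by blast
  then show ?thesis
    unfolding uniform_space_def using not_mcomplete_eps locally_compact_eps \<open>A' > 0\<close> by blast
qed

text \<open>Go from \<open>z\<close> to a nearby point \<open>\<eta> s\<close> of a ray, then along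
  the ray to its boundary point. Both parts have \<open>d_eps\<close>-size at most of order
  \<open>\<rho> z\<close>, the second because \<open>dist p z\<close> exceeds \<open>s\<close> by a
  bounded amount at most.\<close>

lemma dist_to_boundary_le:
  assumes "roughly_starlike M TYPE('a)" "M \<ge> 0"
  obtains C where "C > 0" "\<And>z. dist_to_boundary \<epsilon> p z \<le> C * \<rho> z"
proof -
  obtain q where q: "\<And>x::'a. \<exists>\<gamma>. geodesic_ray \<gamma> q \<and> infdist x (\<gamma> ` {0..}) \<le> M"
    using assms(1) unfolding roughly_starlike_def by blast
  define b where "b = dist p q"
  define C where "C = exp (\<epsilon> * (M + 1)) * (M + 1) + K * exp (\<epsilon> * b) * exp (\<epsilon> * (b + M + 1))"
  have "M + 1 > 0" using assms(2) by simp
  then have "exp (\<epsilon> * (M + 1)) * (M + 1) > 0" "K * exp (\<epsilon> * b) * exp (\<epsilon> * (b + M + 1)) > 0"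
    using K_pos by auto
  then have "C > 0" unfolding C_def by (rule add_pos_pos)
  have "dist_to_boundary \<epsilon> p z \<le> C * \<rho> z" for z
  proof -
    obtain \<eta> where ray: "geodesic_ray \<eta> q" and "infdist z (\<eta> ` {0..}) \<le> M" using q by blast
    \<comment> \<open>\<open>infdist\<close> is an infimum; enlarging \<open>M\<close> by 1 provides
      an actual point of the ray.\<close>
    then have "infdist z (\<eta> ` {0..}) < M + 1" by simp
    then have "(INF a\<in>\<eta> ` {0..}. dist z a) < M + 1" by (subst (asm) infdist_notempty) auto
    then obtain s where s: "s \<ge> 0" "dist z (\<eta> s) < M + 1"
      by (subst (asm) cINF_less_iff) (auto intro: bdd_belowI[where m=0])
    define u where "u n = \<eta> (s + real n)" for n
    have "filterlim (\<lambda>n. s + real n) at_top sequentially"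
      by (rule filterlim_tendsto_add_at_top[OF tendsto_const filterlim_real_sequentially])
    then have bu: "boundary_seq \<epsilon> p u" unfolding u_def using s(1) by (intro ray_boundary_seq[OF ray]) auto
    then have \<xi>: "bclass u \<in> metric_boundary \<epsilon> p" by (simp add: metric_boundary_eq)
    let ?B = "E z (\<eta> s) + K * exp (\<epsilon> * b) * exp (- \<epsilon> * s)"
    have "bdist \<epsilon> p z (bclass u) \<le> ?B"
    proof (rule tendsto_upperbound[OF bdist_tendsto[OF \<xi> bclass_self[OF bu]]])
      have "E z (u n) \<le> ?B" for n
        using E_triangle[of z "u n" "\<eta> s"] E_ray_le[OF ray s(1), of "s + real n"] by (simp add: u_def b_def)
      then show "eventually (\<lambda>n. E z (u n) \<le> ?B) sequentially" by simp
    qed simp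
    then have "dist_to_boundary \<epsilon> p z \<le> ?B" using dist_to_boundary_le_bdist[OF \<xi>, of z] by linarith
    also have "E z (\<eta> s) \<le> exp (\<epsilon> * (M + 1)) * (M + 1) * \<rho> z"
    proof -
      have "E z (\<eta> s) \<le> exp (- \<epsilon> * (dist p z - dist z (\<eta> s))) * dist z (\<eta> s)" by (rule E_le_near)
      also have "\<dots> \<le> exp (- \<epsilon> * (dist p z - (M + 1))) * (M + 1)"
        using s eps_pos by (intro mult_mono) auto
      also have "\<dots> = exp (\<epsilon> * (M + 1)) * (M + 1) * \<rho> z"
        by (simp add: rho_eps_def algebra_simps exp_add exp_diff exp_minus divide_simps)
      finally show ?thesis .
    qed
    also have "exp (- \<epsilon> * s) \<le> exp (\<epsilon> * (b + M + 1)) * \<rho> z"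
    proof -
      have "dist p z \<le> b + s + (M + 1)"
        using dist_triangle[of p z q] dist_triangle[of q z "\<eta> s"] geodesic_ray_dist[OF ray s(1)] s(2)
        by (simp add: b_def dist_commute)
      from rho_ge_exp[OF this] have "exp (\<epsilon> * (b + M + 1)) * exp (- \<epsilon> * (b + s + (M + 1))) \<le> exp (\<epsilon> * (b + M + 1)) * \<rho> z"
        by (intro mult_left_mono) auto
      then show ?thesis by (simp add: algebra_simps flip: exp_add)
    qed
    finally show ?thesis using K_pos by (simp add: C_def algebra_simps)
  qed
  with \<open>C > 0\<close> show ?thesis using that by blast
qed

text \<open>Cutting the curve from its end into arcs of \<open>F\<close>-increment \<kappa>, which
  is below the threshold of \<open>dist_less_1\<close> throughout, gives steps of d-length below 1.
  \<open>F\<close> is any dominating function, so both directions of a curve are covered.\<close>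

lemma chain_dist_le:
  fixes F :: "real \<Rightarrow> real"
  assumes cont: "continuous_on {a..b} F" and "a \<le> s"
    and EF: "\<And>s t. a \<le> s \<Longrightarrow> s \<le> t \<Longrightarrow> t \<le> b \<Longrightarrow> E (\<gamma> s) (\<gamma> t) \<le> F t - F s"
    and \<kappa>: "\<kappa> > 0"
  shows "s \<le> t \<Longrightarrow> t \<le> b \<Longrightarrow> (\<And>v. v \<in> {s..t} \<Longrightarrow> \<kappa> < exp (- 2 * \<epsilon>) * \<rho> (\<gamma> v)) \<Longrightarrow> F t - F s \<le> real N * \<kappa>
    \<Longrightarrow> dist (\<gamma> s) (\<gamma> t) \<le> real N"
proof (induction N arbitrary: t)
  case 0
  then have "E (\<gamma> s) (\<gamma> t) \<le> 0" using EF[of s t] \<open>a \<le> s\<close> by simp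
  then have "\<gamma> s = \<gamma> t" using E_nonneg[of "\<gamma> s" "\<gamma> t"] E_zero_iff by (meson antisym)
  then show ?case by simp
next
  case (Suc N)
  show ?case
  proof (cases "F t - F s \<le> \<kappa>")
    case True
    then have "E (\<gamma> s) (\<gamma> t) \<le> \<kappa>" using EF[of s t] Suc.prems(1,2) \<open>a \<le> s\<close> by simp
    also have "\<dots> < exp (- 2 * \<epsilon>) * \<rho> (\<gamma> s)" using Suc.prems(1) by (intro Suc.prems(3)) simp
    finally have "E (\<gamma> s) (\<gamma> t) < exp (- 2 * \<epsilon>) * \<rho> (\<gamma> s)" .
    then show ?thesis using dist_less_1 by fastforce
  next
    case False
    obtain v where v: "s \<le> v" "v \<le> t" "F v = F t - \<kappa>"
      by (rule IVT_subinterval[OF cont \<open>a \<le> s\<close> Suc.prems(1,2), of "F t - \<kappa>"]) (use False \<kappa> in auto)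
    have 1: "dist (\<gamma> s) (\<gamma> v) \<le> real N"
      by (rule Suc.IH) (use v Suc.prems in \<open>auto simp: algebra_simps\<close>)
    have "E (\<gamma> v) (\<gamma> t) \<le> \<kappa>" using EF[of v t] v Suc.prems \<open>a \<le> s\<close> by simp
    then have "E (\<gamma> v) (\<gamma> t) < exp (- 2 * \<epsilon>) * \<rho> (\<gamma> v)" using Suc.prems(3)[of v] v by simp
    then have "dist (\<gamma> v) (\<gamma> t) < 1" by (rule dist_less_1)
    then show ?thesis using 1 dist_triangle[of "\<gamma> s" "\<gamma> t" "\<gamma> v"] by simp
  qed
qed

text \<open>Dividing the accumulated length by the factor \<open>exp (\<epsilon> * (\<delta> + 1))\<close> moves the point a bounded
  \<open>dist\<close>-distance but raises the expected Gromov product by more than \<open>\<delta>\<close>; this gain pays for the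
  loss in each application of the hyperbolicity inequality along the chain.\<close>

lemma half_curve_gromov_product:
  fixes F :: "real \<Rightarrow> real"
  assumes cont: "continuous_on {a..b} F" and F0: "F a = 0" and "A > 0"
    and EF: "\<And>s t. a \<le> s \<Longrightarrow> s \<le> t \<Longrightarrow> t \<le> b \<Longrightarrow> E (\<gamma> s) (\<gamma> t) \<le> F t - F s"
    and unif: "\<And>t. t \<in> {a..b} \<Longrightarrow> F t \<le> A * \<rho> (\<gamma> t)"
    and N: "2 * exp (\<epsilon> * (\<delta> + 1)) * A / exp (- 2 * \<epsilon>) \<le> real N"
    and t: "t \<in> {a..b}" "exp (- 2 * \<epsilon>) * \<rho> (\<gamma> t) \<le> F t"
  shows "- ln (F t) / \<epsilon> - (real N + 3 + \<delta>) \<le> gp (\<gamma> a) (\<gamma> t)"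
proof -
  define \<mu> where "\<mu> = exp (\<epsilon> * (\<delta> + 1))"
  define c0 where "c0 = exp (- 2 * \<epsilon>)"
  \<comment> \<open>Small enough for the induction to start vacuously:
    \<open>F t \<le> \<theta>\<close> puts \<open>\<gamma> t\<close> within distance 1 of
    \<open>\<gamma> a\<close>, where \<open>c0 * \<rho> (\<gamma> t)\<close> is at least
    \<open>2 * \<theta>\<close>, contrary to the lower bound on \<open>F t\<close>.\<close>
  define \<theta> where "\<theta> = c0 * exp (- \<epsilon>) * \<rho> (\<gamma> a) / 2"
  have "\<mu> > 1" using eps_pos delta_nonneg by (simp add: \<mu>_def)
  have "c0 > 0" by (simp add: c0_def)
  have "\<theta> > 0" by (simp add: \<theta>_def c0_def rho_pos)
  have Fmono: "F s \<le> F t" if "a \<le> s" "s \<le> t" "t \<le> b" for s t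
    using EF[OF that] E_nonneg[of "\<gamma> s" "\<gamma> t"] by linarith
  have claim: "t \<in> {a..b} \<Longrightarrow> c0 * \<rho> (\<gamma> t) \<le> F t \<Longrightarrow> F t \<le> \<mu> ^ n * \<theta> \<Longrightarrow>
      - ln (F t) / \<epsilon> - (real N + 3 + \<delta>) \<le> gp (\<gamma> a) (\<gamma> t)" for n t
  proof (induction n arbitrary: t)
    case 0
    have "\<theta> < c0 * \<rho> (\<gamma> a)"
    proof -
      have "exp (- \<epsilon>) \<le> 1" using eps_pos by simp
      then have "c0 * \<rho> (\<gamma> a) * exp (- \<epsilon>) \<le> c0 * \<rho> (\<gamma> a) * 1"
        using \<open>c0 > 0\<close> rho_nonneg by (intro mult_left_mono) auto
      moreover have "c0 * \<rho> (\<gamma> a) * exp (- \<epsilon>) = 2 * \<theta>" by (simp add: \<theta>_def)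
      ultimately show ?thesis using \<open>\<theta> > 0\<close> by linarith
    qed
    then have "E (\<gamma> a) (\<gamma> t) < c0 * \<rho> (\<gamma> a)" using EF[of a t] F0 0 by simp
    then have "dist (\<gamma> a) (\<gamma> t) < 1" unfolding c0_def by (rule dist_less_1)
    then have "exp (- \<epsilon>) * \<rho> (\<gamma> a) \<le> exp (- \<epsilon> * dist (\<gamma> a) (\<gamma> t)) * \<rho> (\<gamma> a)"
      using eps_pos rho_nonneg by (intro mult_right_mono) auto
    also have "\<dots> \<le> \<rho> (\<gamma> t)" by (rule rho_harnack)
    finally have "c0 * (exp (- \<epsilon>) * \<rho> (\<gamma> a)) \<le> c0 * \<rho> (\<gamma> t)" using \<open>c0 > 0\<close> by simp
    moreover have "c0 * (exp (- \<epsilon>) * \<rho> (\<gamma> a)) = 2 * \<theta>" by (simp add: \<theta>_def)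
    ultimately show ?case using 0 \<open>\<theta> > 0\<close> by simp
  next
    case (Suc n)
    define u where "u = F t"
    have "u > 0" using Suc.prems(2) \<open>c0 > 0\<close> rho_pos[of "\<gamma> t"] unfolding u_def by (smt (verit) mult_pos_pos)
    have ul: "u / \<mu> \<le> u" "u / \<mu> > 0" using \<open>\<mu> > 1\<close> \<open>u > 0\<close> by (auto simp: field_simps)
    obtain s where s: "a \<le> s" "s \<le> t" "F s = u / \<mu>"
      by (rule IVT_subinterval[OF cont, of a t "u / \<mu>"]) (use Suc.prems(1) F0 ul in \<open>auto simp: u_def\<close>)
    \<comment> \<open>From \<open>s\<close> to \<open>t\<close> the weight is at least
      \<open>u / (\<mu> * A)\<close>; the extra factor 2 makes the inequality strict. An increment
      of at most \<open>u\<close> thus fits into \<open>N\<close> steps of size \<kappa>, with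
      \<open>N\<close> independent of \<open>t\<close>.\<close>
    define \<kappa> where "\<kappa> = c0 * u / (2 * \<mu> * A)"
    have dN: "dist (\<gamma> s) (\<gamma> t) \<le> real N"
    proof (rule chain_dist_le[OF cont s(1) EF, of \<kappa>])
      show "\<kappa> > 0" using \<open>c0 > 0\<close> \<open>u > 0\<close> \<open>\<mu> > 1\<close> \<open>A > 0\<close> by (simp add: \<kappa>_def)
      show "\<kappa> < exp (- 2 * \<epsilon>) * \<rho> (\<gamma> v)" if v: "v \<in> {s..t}" for v
      proof -
        have "u / \<mu> \<le> F v" using Fmono[of s v] s v Suc.prems(1) by simp
        also have "\<dots> \<le> A * \<rho> (\<gamma> v)" using unif[of v] s v Suc.prems(1) by simp
        finally have "u / (\<mu> * A) \<le> \<rho> (\<gamma> v)" using \<open>A > 0\<close> \<open>\<mu> > 1\<close> by (simp add: field_simps)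
        moreover have "u / (2 * \<mu> * A) < u / (\<mu> * A)" using \<open>A > 0\<close> \<open>\<mu> > 1\<close> \<open>u > 0\<close> by (simp add: field_simps)
        ultimately have "c0 * (u / (2 * \<mu> * A)) < c0 * \<rho> (\<gamma> v)"
          using \<open>c0 > 0\<close> by (intro mult_strict_left_mono) auto
        then show ?thesis by (simp add: \<kappa>_def c0_def)
      qed
      have "u = (2 * \<mu> * A / c0) * \<kappa>" using \<open>A > 0\<close> \<open>\<mu> > 1\<close> \<open>c0 > 0\<close> by (simp add: \<kappa>_def)
      also have "\<dots> \<le> real N * \<kappa>"
        using N \<open>\<kappa> > 0\<close> unfolding \<mu>_def c0_def by (intro mult_right_mono) auto
      finally show "F t - F s \<le> real N * \<kappa>" using s(3) ul unfolding u_def by linarith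
    qed (use s Suc.prems in auto)
    \<comment> \<open>The hypothesis \<open>c0 * \<rho> (\<gamma> t) \<le> F t\<close> read
      logarithmically; the 2 is the exponent in \<open>c0\<close>.\<close>
    have high: "dist p (\<gamma> t) \<ge> - ln u / \<epsilon> - 2"
    proof -
      have "ln (c0 * \<rho> (\<gamma> t)) \<le> ln u"
        using Suc.prems(2) \<open>c0 > 0\<close> rho_pos[of "\<gamma> t"] unfolding u_def by (intro ln_mono) auto
      moreover have "ln (c0 * \<rho> (\<gamma> t)) = - \<epsilon> * (2 + dist p (\<gamma> t))"
        by (simp add: c0_def rho_eps_def algebra_simps flip: exp_add)
      ultimately show ?thesis using eps_pos by (simp add: field_simps)
    qed
    \<comment> \<open>If \<open>F s\<close> is below the threshold, the chain has come within
      distance 1 of \<open>\<gamma> a\<close> and the product is estimated directly; otherwise the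
      induction hypothesis applies to \<open>s\<close>.\<close>
    show ?case
    proof (cases "F s < c0 * \<rho> (\<gamma> s)")
      case True
      have "E (\<gamma> s) (\<gamma> a) < c0 * \<rho> (\<gamma> s)"
        using EF[of a s] s Suc.prems(1) F0 True E_commute[of "\<gamma> s" "\<gamma> a"] by simp
      then have "dist (\<gamma> s) (\<gamma> a) < 1" unfolding c0_def by (rule dist_less_1)
      then have "dist (\<gamma> t) (\<gamma> a) \<le> real N + 1"
        using dist_triangle[of "\<gamma> t" "\<gamma> a" "\<gamma> s"] dN by (simp add: dist_commute)
      then show ?thesis
        using gromov_product_ge[of p "\<gamma> t" "\<gamma> a"] high delta_nonneg
        by (simp add: gromov_product_commute[of p "\<gamma> a"] u_def)
    next
      case False
      have "u \<le> \<mu> * (\<mu> ^ n * \<theta>)" using Suc.prems(3) by (simp add: u_def mult.assoc)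
      then have "F s \<le> \<mu> ^ n * \<theta>" using \<open>\<mu> > 1\<close> s(3) by (simp add: divide_le_eq mult.commute)
      then have IH: "- ln (F s) / \<epsilon> - (real N + 3 + \<delta>) \<le> gp (\<gamma> a) (\<gamma> s)"
        using False s Suc.prems(1) by (intro Suc.IH) auto
      have "ln (F s) = ln u - \<epsilon> * (\<delta> + 1)"
        using \<open>u > 0\<close> \<open>\<mu> > 1\<close> s(3) by (simp add: ln_div \<mu>_def)
      then have "- ln (F s) / \<epsilon> = - ln u / \<epsilon> + (\<delta> + 1)" using eps_pos by (simp add: field_simps)
      \<comment> \<open>The gain \<open>\<delta> + 1\<close> absorbs the \<delta> of the induction
        hypothesis and leaves 1, so the two bounds agree; their common value loses \<delta> just
        once more.\<close>
      then have 1: "- ln u / \<epsilon> - (real N + 3) + 1 \<le> gp (\<gamma> a) (\<gamma> s)" using IH by linarith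
      have 2: "- ln u / \<epsilon> - 2 - real N \<le> gp (\<gamma> s) (\<gamma> t)"
        using gromov_product_ge[of p "\<gamma> t" "\<gamma> s"] high dN
        by (simp add: gromov_product_commute[of p "\<gamma> s"] dist_commute)
      show ?thesis using hyperbolic[of "\<gamma> a" "\<gamma> s" "\<gamma> t"] 1 2 unfolding u_def by linarith
    qed
  qed
  obtain n where "F t / \<theta> < \<mu> ^ n" using real_arch_pow[OF \<open>\<mu> > 1\<close>] by blast
  then have "F t \<le> \<mu> ^ n * \<theta>" using \<open>\<theta> > 0\<close> by (simp add: field_simps)
  then show ?thesis using claim t by (simp add: c0_def)
qed

lemma uniform_imp_GH_theorem:
  assumes us: "uniform_space \<epsilon> p" and "roughly_starlike M TYPE('a)" "M \<ge> 0"
  shows "GH_theorem \<epsilon> p"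
proof -
  obtain A where A: "A > 0" "\<And>x y. \<exists>\<gamma> a b. \<gamma> a = x \<and> \<gamma> b = y \<and> uniform_curve \<epsilon> p A \<gamma> a b"
    using us unfolding uniform_space_def by blast
  obtain C where C: "C > 0" "\<And>z. dist_to_boundary \<epsilon> p z \<le> C * \<rho> z"
    using dist_to_boundary_le[OF assms(2,3)] by blast
  define A' where "A' = A * C"
  have "A' > 0" using A C by (simp add: A'_def)
  obtain N :: nat where N: "2 * exp (\<epsilon> * (\<delta> + 1)) * A' / exp (- 2 * \<epsilon>) \<le> real N"
    using real_arch_simple by blast
  \<comment> \<open>Each half of the curve has the loss \<open>N + 3 + \<delta>\<close>, and joining
    them at the midpoint costs another \<delta>. In \<open>c\<close>, the first entry is the
    constant of \<open>separated_near\<close> for \<open>R = 2\<close>, and the 2 in the second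
    comes from the half length \<open>L / 2\<close>.\<close>
  define D where "D = real N + 3 + 2 * \<delta>"
  define c where "c = min (exp (- 2 * \<epsilon> - \<epsilon> * 2)) (2 / (A * exp (\<epsilon> * D)))"
  have "separated c x y" for x y
  proof (cases "dist x y \<le> 2")
    case True
    from separated_near[OF True] show ?thesis by (rule separated_mono) (simp add: c_def)
  next
    case far: False
    obtain \<gamma> a b where ends: "\<gamma> a = x" "\<gamma> b = y" and uc: "uniform_curve \<epsilon> p A \<gamma> a b" using A(2) by blast
    have ab: "a \<le> b" and cm: "continuous_map (subtopology euclideanreal {a..b}) eps.mtopology \<gamma>"
      and len: "eps.cl \<gamma> a b \<le> ereal (A * E x y)"
      and mid: "\<And>t. t \<in> {a..b} \<Longrightarrow> min (eps.cl \<gamma> a t) (eps.cl \<gamma> t b) \<le> ereal (A * dist_to_boundary \<epsilon> p (\<gamma> t))"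
      using uc ends unfolding uniform_curve_def by auto
    have cont: "continuous_on {a..b} \<gamma>" using cm unfolding mtopology_eps by (simp add: continuous_map_iff_continuous)
    have fin: "eps.cl \<gamma> a b < \<infinity>" using len by (rule le_less_trans) simp
    have "eps.rd_continuous \<gamma> a b"
      unfolding eps.rd_continuous_def
    proof
      fix t assume "t \<in> {a..b}"
      then have "((\<lambda>s. dist (\<gamma> t) (\<gamma> s)) \<longlongrightarrow> 0) (at t within {a..b})"
        using dist_rd_continuous[OF cont] unfolding dist_len.rd_continuous_def by blast
      then show "((\<lambda>s. E (\<gamma> t) (\<gamma> s)) \<longlongrightarrow> 0) (at t within {a..b})"
        by (rule tendsto_sandwich[OF _ _ tendsto_const, rotated 2]) (auto simp: E_nonneg E_le_dist)
    qed
    define F where "F = eps.len \<gamma> a"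
    define L where "L = F b"
    have contF: "continuous_on {a..b} F"
      unfolding F_def by (rule eps.continuous_on_len[OF fin \<open>eps.rd_continuous \<gamma> a b\<close>])
    have F0: "F a = 0" by (simp add: F_def)
    have EF: "E (\<gamma> s) (\<gamma> t) \<le> F t - F s" if "a \<le> s" "s \<le> t" "t \<le> b" for s t
      using eps.len_step[OF fin that] by (simp add: F_def)
    have clF: "eps.cl \<gamma> a t = ereal (F t)" "eps.cl \<gamma> t b = ereal (L - F t)" if "t \<in> {a..b}" for t
    proof -
      show "eps.cl \<gamma> a t = ereal (F t)" using eps.cl_eq_len[OF fin, of a t] that by (simp add: F_def)
      have "eps.len \<gamma> a b = eps.len \<gamma> a t + eps.len \<gamma> t b" using that by (intro eps.len_add[OF fin]) auto
      then show "eps.cl \<gamma> t b = ereal (L - F t)"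
        using eps.cl_eq_len[OF fin, of t b] that by (simp add: F_def L_def)
    qed
    have unif: "min (F t) (L - F t) \<le> A' * \<rho> (\<gamma> t)" if "t \<in> {a..b}" for t
    proof -
      have "min (F t) (L - F t) \<le> A * dist_to_boundary \<epsilon> p (\<gamma> t)"
        using mid[OF that] clF[OF that] by (simp add: min_def split: if_splits)
      also have "\<dots> \<le> A * (C * \<rho> (\<gamma> t))" using A(1) C(2) by (intro mult_left_mono) auto
      finally show ?thesis by (simp add: A'_def mult.assoc)
    qed
    have LE: "L \<le> A * E x y" using len clF(1)[of b] ab by (simp add: L_def)
    have "E x y \<le> L" using EF[of a b] ab F0 ends by (simp add: L_def)
    moreover have "E x y > 0" using far E_zero_iff[of x y] E_nonneg[of x y] by (cases "x = y") auto
    ultimately have "L > 0" by linarith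
    obtain \<tau> where \<tau>: "a \<le> \<tau>" "\<tau> \<le> b" "F \<tau> = L / 2"
      by (rule IVT_subinterval[OF contF, of a b "L / 2"]) (use ab F0 \<open>L > 0\<close> in \<open>auto simp: L_def\<close>)
    let ?m = "\<gamma> \<tau>"
    have Fmono: "F s \<le> F t" if "a \<le> s" "s \<le> t" "t \<le> b" for s t
      using EF[OF that] E_nonneg[of "\<gamma> s" "\<gamma> t"] by linarith
    \<comment> \<open>Otherwise \<open>dist_less_1\<close> would place both endpoints within
      distance 1 of the midpoint; this is why pairs at distance at most 2 are treated
      separately.\<close>
    have notnear: "exp (- 2 * \<epsilon>) * \<rho> ?m \<le> L / 2"
    proof (rule ccontr)
      assume "\<not> ?thesis"
      then have "E ?m x < exp (- 2 * \<epsilon>) * \<rho> ?m" "E ?m y < exp (- 2 * \<epsilon>) * \<rho> ?m"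
        using EF[of a \<tau>] EF[of \<tau> b] \<tau> F0 ends E_commute[of ?m x] by (auto simp: L_def)
      then have "dist ?m x < 1" "dist ?m y < 1" by (auto intro: dist_less_1)
      then show False using far dist_triangle3[of x y ?m] by linarith
    qed
    have gx: "- ln (L / 2) / \<epsilon> - (real N + 3 + \<delta>) \<le> gp x ?m"
    proof -
      have "- ln (F \<tau>) / \<epsilon> - (real N + 3 + \<delta>) \<le> gp (\<gamma> a) ?m"
      proof (rule half_curve_gromov_product[where F=F, OF _ F0 \<open>A' > 0\<close> _ _ N])
        show "continuous_on {a..\<tau>} F" using contF \<tau> by (auto intro: continuous_on_subset)
        show "E (\<gamma> s) (\<gamma> t) \<le> F t - F s" if "a \<le> s" "s \<le> t" "t \<le> \<tau>" for s t
          using EF that \<tau> by auto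
        show "F t \<le> A' * \<rho> (\<gamma> t)" if "t \<in> {a..\<tau>}" for t
          using unif[of t] Fmono[of t \<tau>] that \<tau> by (auto simp: min_def split: if_splits)
      qed (use \<tau> notnear in auto)
      then show ?thesis using \<tau> ends by simp
    qed
    have gy: "- ln (L / 2) / \<epsilon> - (real N + 3 + \<delta>) \<le> gp y ?m"
    proof -
      \<comment> \<open>The second half is run backwards from \<open>y\<close>, with the length
        measured from \<open>y\<close>.\<close>
      define F' where "F' s = L - F (- s)" for s
      have "- ln (F' (- \<tau>)) / \<epsilon> - (real N + 3 + \<delta>) \<le> gp (\<gamma> (- (- b))) (\<gamma> (- (- \<tau>)))"
      proof (rule half_curve_gromov_product[where \<gamma>="\<lambda>s. \<gamma> (- s)" and F=F', OF _ _ \<open>A' > 0\<close> _ _ N])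
        show "continuous_on {- b..- \<tau>} F'"
          unfolding F'_def using \<tau>
          by (intro continuous_intros continuous_on_compose2[OF contF]) auto
        show "F' (- b) = 0" by (simp add: F'_def L_def)
        show "E (\<gamma> (- s)) (\<gamma> (- t)) \<le> F' t - F' s" if "- b \<le> s" "s \<le> t" "t \<le> - \<tau>" for s t
          using EF[of "- t" "- s"] that \<tau> E_commute[of "\<gamma> (- s)"] by (simp add: F'_def)
        show "F' t \<le> A' * \<rho> (\<gamma> (- t))" if "t \<in> {- b..- \<tau>}" for t
          using unif[of "- t"] Fmono[of \<tau> "- t"] that \<tau> by (auto simp: F'_def min_def split: if_splits)
      qed (use \<tau> notnear in \<open>auto simp: F'_def\<close>)
      then show ?thesis using \<tau> ends by (simp add: F'_def)
    qed
    have "- ln (L / 2) / \<epsilon> - D \<le> gp x y"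
      using hyperbolic[of x ?m y] gx gy gromov_product_commute[of p y ?m] unfolding D_def by linarith
    then have "- \<epsilon> * gp x y \<le> ln (L / 2) + \<epsilon> * D" using eps_pos by (simp add: field_simps)
    then have "exp (- \<epsilon> * gp x y) \<le> exp (ln (L / 2) + \<epsilon> * D)" by simp
    also have "\<dots> = L / 2 * exp (\<epsilon> * D)" using \<open>L > 0\<close> by (simp add: exp_add)
    also have "\<dots> \<le> A * E x y / 2 * exp (\<epsilon> * D)" using LE by simp
    finally have "2 / (A * exp (\<epsilon> * D)) * exp (- \<epsilon> * gp x y) \<le> E x y"
      using A(1) by (simp add: field_simps)
    then have "separated (2 / (A * exp (\<epsilon> * D))) x y" using far by (simp add: separated_def)
    then show ?thesis by (rule separated_mono) (simp add: c_def)
  qed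
  moreover have "c > 0" using A(1) by (simp add: c_def)
  ultimately show ?thesis unfolding GH_theorem_iff by blast
qed

end

theorem theorem1p3:
  fixes \<delta> M \<epsilon> :: real and p :: "'a::metric_space"
  assumes "\<delta> \<ge> 0" and "M \<ge> 0"
    and "gromov_hyperbolic \<delta> TYPE('a)"
    and "roughly_starlike M TYPE('a)"
    and "\<epsilon> > 0"
  shows "(GH_boundary \<epsilon> p
            \<longleftrightarrow> bij_betw (Phi \<epsilon> p) (gromov_boundary p) (metric_boundary \<epsilon> p) \<and> GH_gromov_seq \<epsilon> p)
       \<and> (bij_betw (Phi \<epsilon> p) (gromov_boundary p) (metric_boundary \<epsilon> p) \<and> GH_gromov_seq \<epsilon> p
            \<longleftrightarrow> GH_theorem \<epsilon> p)
       \<and> (GH_theorem \<epsilon> p \<longleftrightarrow> uniform_space \<epsilon> p)"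
proof -
  interpret hyperbolic_uniformization \<epsilon> p \<delta>
    by unfold_locales (use assms(1,3,5) in \<open>auto simp: gromov_hyperbolic_def\<close>)
  \<comment> \<open>(1) gives (3), (3) gives both parts of (2), (2) gives (1), and (3) is equivalent
    to (4).\<close>
  show ?thesis
    using GH_theorem_imp_boundary_gromov_seq GH_theorem_imp_bij_Phi GH_boundary_imp_theorem
      bij_gromov_seq_imp_GH_boundary GH_theorem_imp_uniform uniform_imp_GH_theorem[OF _ assms(4,2)]
    by blast
qed

end
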